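(* Let $(Q,I)$ be a gentle presentation with $Q$ finite, connected and having at least one arrow, and let $A=\Bbbk Q/I$. Let $(S,M)$ be the marked surface induced by the ribbon graph $G$ of $A$. Let $\mathscr G$ be the generating set of $\mathrm{HH}^*(A)$ described in the context, built using a spanning tree $T$ of $Q$, and let $\mathcal F=\{(c,c):c\in Q_1\setminus T\}\subset\mathscr G$. Then there is a one-to-one correspondence between $\mathscr G\setminus\mathcal F$ and the set consisting of the boundary components of $S$ with $0$ or $1$ marked points and the $G$-punctures of $(S,M)$, that is, the punctures corresponding to vertices of $G$ in the interior of $S$.
   Context: $\Bbbk$ is a field. Paths in $Q=(Q_0,Q_1,s,t)$ are written from right to left ($c_m\cdots c_1$ has first arrow $c_1$, last arrow $c_m$); vertices are the paths of length $0$. $(Q,I)$ is a gentle presentation: $I$ is an ideal of $\Bbbk Q$ generated by paths of length $2$; every vertex is the source of at most two and the target of at most two arrows; for every arrow $a$ there is at most one arrow $b$ with $t(b)=s(a)$ and $ab\notin I$, at most one arrow $c$ with $t(a)=s(c)$ and $ca\notin I$, at most one arrow $b$ with $t(b)=s(a)$ and $ab\in I$, and at most one arrow $c$ with $t(a)=s(c)$ and $ca\in I$. $R$ is the set of paths of length $2$ in $I$; $\mathcal B$ the set of paths with no subpath in $R$; $\Gamma$ the set of paths all of whose subpaths of length $2$ are in $R$. A path is $\mathcal B$-maximal (resp. $\Gamma$-maximal) if it is in $\mathcal B$ (resp. $\Gamma$) and is not a proper subpath of another element of that set. A spanning tree is the set of arrows of a connected subquiver, acyclic as an undirected graph, containing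 all vertices. Cohomology. $\Gamma_m\parallel\mathcal B$ is the set of pairs $(\gamma,\alpha)$ with $\gamma\in\Gamma$ of length $m$ and $\alpha\in\mathcal B$ having the same source and target. The complex $\Bbbk(\Gamma\parallel\mathcal B)$ with $d^m(\gamma,\alpha)=\sum_b(b\gamma,b\alpha)-(-1)^m\sum_a(\gamma a,\alpha a)$ (sums over arrows for which the pair is in $\Gamma_{m+1}\parallel\mathcal B$) has cohomology $\mathrm{HH}^*(A)$. A cycle is a path of positive length with equal source and target; $\mathrm{rot}(c_m\cdots c_1)=c_{m-1}\cdots c_1c_m$; circuits are classes of cycles under rotation; the period of $C$ is the least $i\ge1$ with $\mathrm{rot}^i(C)=C$; a cycle is primitive if it is not a proper power of another cycle; $C$ is complete if $C^2\in\Gamma$, cocomplete if $C^2\in\mathcal B$. $\overline{\mathscr C}^{\mathsf{basic}}(\mathcal B)$ is a set of representatives of the primitive cocomplete circuits. Given a set of representatives $D$ of the primitive complete circuits, $\overline{\mathscr C}^{\mathsf{basic}}(\Gamma)$ consists of these $D$ if $\mathrm{char}\,\Bbbk=2$, and otherwise of those $D$ of even length and the squares $D^2$ of those of odd length. $\mathscr G$ is the set of classes of: the pairs $(s(\alpha),\alpha)$ with $\alpha$ a $\mathcal B$-maximal cycle; $\langle\langle\alpha\rangle\rangle=\sum_{i=0}^{r-1}(s(\mathrm{rot}^i\alpha),\mathrm{rot}^i\alpha)$ for $\alpha\in\overline{\mathscr C}^{\mathsf{basic}}(\mathcal B)$ of period $r$; the pairs $(c,c)$ with $c\in Q_1\setminus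 T$; the pairs $(\gamma,\alpha)\in\Gamma\parallel\mathcal B$ with $\gamma$ $\Gamma$-maximal and $\gamma,\alpha$ neither beginning nor ending with the same arrow; $\langle\langle C\rangle\rangle=\sum_{i=0}^{r-1}(\mathrm{rot}^iC,s(\mathrm{rot}^iC))$ for $C\in\overline{\mathscr C}^{\mathsf{basic}}(\Gamma)$ of period $r$. Ribbon graph $G$. Its edges are the vertices of $Q$. Its vertices are: (1) the maximal non-zero paths of finite length, i.e. the $\mathcal B$-maximal paths; (2) the trivial paths at those vertices $v\in Q_0$ through which exactly one maximal non-zero path (of type (1) or (3), passages counted with multiplicity) passes; (3) one for each primitive cocomplete circuit (the infinite maximal path obtained from its powers). An edge $v$ is attached to a vertex $q$ once for each passage of the path $q$ through $v$; by gentleness every edge has exactly two ends. The ends at $q$ are cyclically ordered by the order in which $q$ visits them: for $q$ of finite length visiting $v_0,\dots,v_l$ in order the cyclic order is the cyclic closure of $v_0<\dots<v_l$, and the pair $(v_l,v_0)$ closing the cycle is marked; for $q$ of type (3) it is the cyclic order of the circuit, with no marked pair. Surface $(S,M)$. For each vertex $q$ of $G$ of valency $n$ take an oriented $2n$-gon $P_q$ with alternately red and black sides, whose $n$ red sides correspond, in clockwise cyclic order, to the ends of edges at $q$. If $q$ has finite length (types (1), (2)), put a marked point in the middle of the black side lying between the two ends of the marked pair; if $q$ is of type (3), put a point (a $G$-puncture) in the interior of $P_q$. $S$ is the oriented surface obtained from $\bigsqcup_qP_q$ by identifying, for each edge $v$ of $G$, the two red sides corresponding to its two ends, with opposite orientations.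 The boundary of $S$ is the union of the black sides; the marked points on the boundary are the points corresponding to vertices of $G$ of types (1) and (2). *)

theory Defs
  imports
    "HOL-Analysis.Analysis"
    "HOL-Library.Poly_Mapping"
    "HOL-Algebra.Ideal"
    "Graph_Theory.Digraph_Component"
begin

section \<open>Paths of a quiver\<close>

text \<open>
  A quiver is a \<^typ>\<open>('v, 'a) pre_digraph\<close> (loops and parallel arrows allowed).  A path
  \<open>c_m \<cdots> c_1\<close> (read from right to left) is encoded by its source together with the list
  \<open>[c_1, \<dots>, c_m]\<close> of its arrows in the order in which they are traversed; the source is needed
  for the trivial paths, whose list of arrows is empty.
\<close>

type_synonym ('v, 'a) qpath = "'v \<times> 'a list"

definition psource :: "('v, 'a) qpath \<Rightarrow> 'v" where
  "psource p = fst p"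

definition ptarget :: "('v, 'a) pre_digraph \<Rightarrow> ('v, 'a) qpath \<Rightarrow> 'v" where
  "ptarget Q p = last (pre_digraph.awalk_verts Q (fst p) (snd p))"

definition plength :: "('v, 'a) qpath \<Rightarrow> nat" where
  "plength p = length (snd p)"

definition qpaths :: "('v, 'a) pre_digraph \<Rightarrow> ('v, 'a) qpath set" where
  "qpaths Q = {(u, cs). \<exists>w. pre_digraph.awalk Q u cs w}"

definition triv :: "'v \<Rightarrow> ('v, 'a) qpath" where
  "triv v = (v, [])"

definition arrow :: "('v, 'a) pre_digraph \<Rightarrow> 'a \<Rightarrow> ('v, 'a) qpath" where
  "arrow Q c = (tail Q c, [c])"

definition composable :: "('v, 'a) pre_digraph \<Rightarrow> ('v, 'a) qpath \<Rightarrow> ('v, 'a) qpath \<Rightarrow> bool" where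
  "composable Q q p \<longleftrightarrow> ptarget Q p = psource q"

text \<open>\<open>pcomp q p\<close> is the path \<open>q p\<close> (first \<open>p\<close>, then \<open>q\<close>); meaningful if \<open>q\<close>, \<open>p\<close> are composable.\<close>

definition pcomp :: "('v, 'a) qpath \<Rightarrow> ('v, 'a) qpath \<Rightarrow> ('v, 'a) qpath" where
  "pcomp q p = (fst p, snd p @ snd q)"

definition subpath :: "('v, 'a) pre_digraph \<Rightarrow> ('v, 'a) qpath \<Rightarrow> ('v, 'a) qpath \<Rightarrow> bool" where
  "subpath Q u p \<longleftrightarrow> u \<in> qpaths Q \<and>
     (\<exists>x \<in> qpaths Q. \<exists>y \<in> qpaths Q. composable Q u x \<and> composable Q y u \<and> p = pcomp y (pcomp u x))"

definition maximal_in ::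
  "('v, 'a) pre_digraph \<Rightarrow> ('v, 'a) qpath set \<Rightarrow> ('v, 'a) qpath \<Rightarrow> bool" where
  "maximal_in Q X p \<longleftrightarrow> p \<in> X \<and> \<not> (\<exists>q \<in> X. q \<noteq> p \<and> subpath Q p q)"


section \<open>The path algebra and gentle presentations\<close>

definition path_mult ::
  "('v, 'a) pre_digraph \<Rightarrow> (('v, 'a) qpath \<Rightarrow>\<^sub>0 'k::field) \<Rightarrow> (('v, 'a) qpath \<Rightarrow>\<^sub>0 'k)
     \<Rightarrow> (('v, 'a) qpath \<Rightarrow>\<^sub>0 'k)" where
  "path_mult Q x y =
     (\<Sum>q \<in> Poly_Mapping.keys x. \<Sum>p \<in> Poly_Mapping.keys y.
        if composable Q q p
        then Poly_Mapping.single (pcomp q p) (Poly_Mapping.lookup x q * Poly_Mapping.lookup y p)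
        else 0)"

definition path_algebra ::
  "('v, 'a) pre_digraph \<Rightarrow> (('v, 'a) qpath \<Rightarrow>\<^sub>0 'k::field) ring" where
  "path_algebra Q =
     \<lparr> carrier = {x. Poly_Mapping.keys x \<subseteq> qpaths Q},
       monoid.mult = path_mult Q,
       one = (\<Sum>v \<in> verts Q. Poly_Mapping.single (triv v) 1),
       zero = 0,
       add = (+) \<rparr>"

text \<open>
  \<^const>\<open>genideal\<close> intersects over ideals in the sense of the locale \<^locale>\<open>ideal\<close>, which
  includes the ring axioms; hence the lemmas up to \<open>ring_path_algebra\<close>, without which the
  generated ideals used below could be degenerate.
\<close>

lemma keys_sum_subset:
  fixes f :: "'c \<Rightarrow> 'd \<Rightarrow>\<^sub>0 'e::comm_monoid_add"
  assumes "\<And>a. a \<in> A \<Longrightarrow> Poly_Mapping.keys (f a) \<subseteq> Z"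
  shows "Poly_Mapping.keys (sum f A) \<subseteq> Z"
  using assms by (induction A rule: infinite_finite_induct) (auto dest: subsetD[OF Poly_Mapping.keys_add])

lemma path_mult_sup:
  assumes "finite A" "finite B" "Poly_Mapping.keys x \<subseteq> A" "Poly_Mapping.keys y \<subseteq> B"
  shows "path_mult Q x y = (\<Sum>q \<in> A. \<Sum>p \<in> B. if composable Q q p
         then Poly_Mapping.single (pcomp q p) (Poly_Mapping.lookup x q * Poly_Mapping.lookup y p) else 0)"
  unfolding path_mult_def
  apply (rule sum.mono_neutral_cong_left[OF assms(1,3)])
  subgoal by (auto simp: in_keys_iff intro!: sum.neutral)
  apply (rule sum.mono_neutral_cong_left[OF assms(2,4)])
  by (auto simp: in_keys_iff)

lemma path_mult_add_l: "path_mult Q (x+x') y = path_mult Q x y + path_mult Q x' y"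
proof -
  let ?A = "Poly_Mapping.keys x \<union> Poly_Mapping.keys x'" let ?B = "Poly_Mapping.keys y"
  have s: "Poly_Mapping.keys (x+x') \<subseteq> ?A" by (rule Poly_Mapping.keys_add)
  have f: "finite ?A" "finite ?B" by auto
  show ?thesis
    unfolding path_mult_sup[OF f s order_refl]
      path_mult_sup[OF f _ order_refl, of x, simplified]
      path_mult_sup[OF f _ order_refl, of x', simplified]
    by (simp add: sum.distrib[symmetric] lookup_add single_add distrib_right if_distrib cong: if_cong)
qed

lemma path_mult_add_r: "path_mult Q y (x+x') = path_mult Q y x + path_mult Q y x'"
proof -
  let ?A = "Poly_Mapping.keys x \<union> Poly_Mapping.keys x'" let ?B = "Poly_Mapping.keys y"
  have s: "Poly_Mapping.keys (x+x') \<subseteq> ?A" by (rule Poly_Mapping.keys_add)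
  have f: "finite ?A" "finite ?B" by auto
  show ?thesis
    unfolding path_mult_sup[OF f(2,1) order_refl s]
      path_mult_sup[OF f(2,1) order_refl, of x, simplified]
      path_mult_sup[OF f(2,1) order_refl, of x', simplified]
    by (simp add: sum.distrib[symmetric] lookup_add single_add distrib_left if_distrib cong: if_cong)
qed

lemma path_mult_0[simp]: "path_mult Q 0 y = 0" "path_mult Q y 0 = 0" by (auto simp: path_mult_def)

lemma path_mult_single: "path_mult Q (Poly_Mapping.single q a) (Poly_Mapping.single p b) =
  (if composable Q q p then Poly_Mapping.single (pcomp q p) (a*b) else 0)"
  by (auto simp: path_mult_def)

lemma ptarget_pcomp: "composable Q q p \<Longrightarrow> ptarget Q (pcomp q p) = ptarget Q q"
  by (auto simp: composable_def pcomp_def ptarget_def psource_def pre_digraph.awalk_verts_conv split: if_splits)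

lemma sum_singles: "(\<Sum>p\<in>Poly_Mapping.keys x. Poly_Mapping.single p (Poly_Mapping.lookup x p)) = x"
  by (rule poly_mapping_eqI) (auto simp: lookup_sum lookup_single when_def in_keys_iff sum.delta)

lemma poly_mapping_single_induct [case_names single add]:
  fixes x :: "'a \<Rightarrow>\<^sub>0 'b::comm_monoid_add"
  assumes "\<And>p a. P (Poly_Mapping.single p a)" "\<And>x y. P x \<Longrightarrow> P y \<Longrightarrow> P (x + y)"
  shows "P x"
proof -
  have z: "P 0" using assms(1)[of undefined 0] by simp
  have "P (sum f A)" if "\<And>a. P (f a)" for f and A :: "'a set"
    using that by (induction A rule: infinite_finite_induct) (auto simp: z assms(2))
  then show ?thesis by (subst sum_singles[symmetric]) (auto simp: assms(1))
qed

lemma path_mult_assoc: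
  fixes x y z :: "_ \<Rightarrow>\<^sub>0 'k::field"
  shows "path_mult Q (path_mult Q x y) z = path_mult Q x (path_mult Q y z)"
proof (induction x rule: poly_mapping_single_induct)
  case (single p a)
  show ?case
  proof (induction y rule: poly_mapping_single_induct)
    case (single q b)
    show ?case
    proof (induction z rule: poly_mapping_single_induct)
      case (single r c)
      have t: "composable Q p q \<Longrightarrow> composable Q (pcomp p q) r = composable Q q r"
        "composable Q q r \<Longrightarrow> composable Q p (pcomp q r) = composable Q p q"
        "pcomp (pcomp p q) r = pcomp p (pcomp q r)"
        by (simp_all add: ptarget_pcomp composable_def) (auto simp: pcomp_def psource_def)
      show ?case by (auto simp: path_mult_single t mult.assoc)
    qed (simp_all add: path_mult_add_l path_mult_add_r)
  qed (simp_all add: path_mult_add_l path_mult_add_r)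
qed (simp_all add: path_mult_add_l path_mult_add_r)

lemma pcomp_in_qpaths:
  assumes "wf_digraph Q" "q \<in> qpaths Q" "p \<in> qpaths Q" "composable Q q p"
  shows "pcomp q p \<in> qpaths Q"
proof -
  interpret wf_digraph Q by fact
  show ?thesis using assms(2-) unfolding qpaths_def pcomp_def composable_def ptarget_def psource_def
    by auto
qed

lemma keys_path_mult:
  assumes "wf_digraph Q"
    and "Poly_Mapping.keys x \<subseteq> qpaths Q" "Poly_Mapping.keys y \<subseteq> qpaths Q"
  shows "Poly_Mapping.keys (path_mult Q x y) \<subseteq> qpaths Q"
  unfolding path_mult_def using assms(2,3) pcomp_in_qpaths[OF assms(1)]
  apply (intro keys_sum_subset)
  by (auto simp: subset_iff split: if_splits)

lemma path_mult_one:
  fixes x :: "('v, 'a) qpath \<Rightarrow>\<^sub>0 'k::field"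
  assumes "fin_digraph Q" "Poly_Mapping.keys x \<subseteq> qpaths Q"
  shows "path_mult Q (\<Sum>v \<in> verts Q. Poly_Mapping.single (triv v) 1) x = x"
    and "path_mult Q x (\<Sum>v \<in> verts Q. Poly_Mapping.single (triv v) 1) = x"
proof -
  interpret fin_digraph Q by fact
  have suml: "path_mult Q (sum f A) y = (\<Sum>a\<in>A. path_mult Q (f a) y)"
    and sumr: "path_mult Q y (sum f A) = (\<Sum>a\<in>A. path_mult Q y (f a))"
    for f A and y :: "_ \<Rightarrow>\<^sub>0 'k"
    by (induction A rule: infinite_finite_induct) (auto simp: path_mult_add_l path_mult_add_r)
  have *: "(\<Sum>v \<in> verts Q. path_mult Q (Poly_Mapping.single (triv v) 1) (Poly_Mapping.single p c)) = Poly_Mapping.single p c"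
     "(\<Sum>v \<in> verts Q. path_mult Q (Poly_Mapping.single p c) (Poly_Mapping.single (triv v) 1)) = Poly_Mapping.single p c"
     if "p \<in> qpaths Q" for p and c :: 'k
  proof -
    have "ptarget Q p \<in> verts Q" "psource p \<in> verts Q"
      using that awlast_in_verts[of "fst p" "snd p"]
      by (auto simp: qpaths_def ptarget_def psource_def awalk_def simp del: awlast_if_cas)
    moreover have "pcomp (triv v) p = p" "psource p = v \<Longrightarrow> pcomp p (triv v) = p" for v
      by (auto simp: pcomp_def triv_def psource_def)
    moreover have "composable Q (triv v) p \<longleftrightarrow> ptarget Q p = v" "composable Q p (triv v) \<longleftrightarrow> psource p = v" for v
      by (auto simp: composable_def triv_def psource_def ptarget_def)
    ultimately show "(\<Sum>v \<in> verts Q. path_mult Q (Poly_Mapping.single (triv v) 1) (Poly_Mapping.single p c)) = Poly_Mapping.single p c"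
     "(\<Sum>v \<in> verts Q. path_mult Q (Poly_Mapping.single p c) (Poly_Mapping.single (triv v) 1)) = Poly_Mapping.single p c"
      by (simp_all add: path_mult_single sum.delta' sum.delta cong: if_cong)
  qed
  let ?e = "\<Sum>v \<in> verts Q. Poly_Mapping.single (triv v) (1::'k)"
  let ?x = "\<Sum>p \<in> Poly_Mapping.keys x. Poly_Mapping.single p (Poly_Mapping.lookup x p)"
  have "path_mult Q ?e ?x = ?x"
    unfolding sumr by (rule sum.cong[OF refl]) (use * assms(2) in \<open>auto simp: suml\<close>)
  then show "path_mult Q ?e x = x"
    by (simp only: sum_singles)
  have "path_mult Q ?x ?e = ?x"
    unfolding suml by (rule sum.cong[OF refl]) (use * assms(2) in \<open>auto simp: sumr\<close>)
  then show "path_mult Q x ?e = x"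
    by (simp only: sum_singles)
qed

lemma ring_path_algebra:
  assumes "fin_digraph Q"
  shows "ring (path_algebra Q :: (('v,'a) qpath \<Rightarrow>\<^sub>0 'k::field) ring)"
proof -
  interpret fin_digraph Q by fact
  have w: "wf_digraph Q" ..
  have m: "mult (path_algebra Q) = path_mult Q" by (simp add: path_algebra_def)
  have c: "carrier (path_algebra Q) = {x. Poly_Mapping.keys x \<subseteq> qpaths Q}"
    "one (path_algebra Q) = (\<Sum>v \<in> verts Q. Poly_Mapping.single (triv v) 1)"
    "zero (path_algebra Q) = 0" "add (path_algebra Q) = (+)" by (simp_all add: path_algebra_def)
  have o: "Poly_Mapping.keys (\<Sum>v \<in> verts Q. Poly_Mapping.single (triv v) (1::'k)) \<subseteq> qpaths Q"
    by (intro keys_sum_subset) (auto simp: qpaths_def triv_def awalk_Nil_iff)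
  show ?thesis
  proof (intro ringI abelian_groupI monoidI; simp only: c m mem_Collect_eq)
    fix x :: "('v,'a) qpath \<Rightarrow>\<^sub>0 'k" assume "Poly_Mapping.keys x \<subseteq> qpaths Q"
    then show "\<exists>y\<in>{x. Poly_Mapping.keys x \<subseteq> qpaths Q}. y + x = 0"
      by (intro bexI[of _ "-x"]) auto
  qed (use o w path_mult_one[OF assms] in
      \<open>auto simp: keys_path_mult path_mult_assoc path_mult_add_l path_mult_add_r ac_simps
         dest: subsetD[OF Poly_Mapping.keys_add]\<close>)
qed

definition basis :: "'p \<Rightarrow> ('p \<Rightarrow>\<^sub>0 'k::field)" where
  "basis p = Poly_Mapping.single p 1"

text \<open>The path \<open>a b\<close> of length two (first \<open>b\<close>, then \<open>a\<close>).\<close>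

definition two_path :: "('v, 'a) pre_digraph \<Rightarrow> 'a \<Rightarrow> 'a \<Rightarrow> ('v, 'a) qpath" where
  "two_path Q a b = pcomp (arrow Q a) (arrow Q b)"

definition gentle_presentation ::
  "('v, 'a) pre_digraph \<Rightarrow> (('v, 'a) qpath \<Rightarrow>\<^sub>0 'k::field) set \<Rightarrow> bool" where
  "gentle_presentation Q I \<longleftrightarrow>
     wf_digraph Q \<and>
     (\<exists>X \<subseteq> {p \<in> qpaths Q. plength p = 2}. I = genideal (path_algebra Q) (basis ` X)) \<and>
     (\<forall>v \<in> verts Q.
        finite {a \<in> arcs Q. tail Q a = v} \<and> card {a \<in> arcs Q. tail Q a = v} \<le> 2 \<and>
        finite {a \<in> arcs Q. head Q a = v} \<and> card {a \<in> arcs Q. head Q a = v} \<le> 2) \<and>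
     (\<forall>a \<in> arcs Q.
        (\<exists>\<^sub>\<le>\<^sub>1 b. b \<in> arcs Q \<and> head Q b = tail Q a \<and> basis (two_path Q a b) \<notin> I) \<and>
        (\<exists>\<^sub>\<le>\<^sub>1 c. c \<in> arcs Q \<and> head Q a = tail Q c \<and> basis (two_path Q c a) \<notin> I) \<and>
        (\<exists>\<^sub>\<le>\<^sub>1 b. b \<in> arcs Q \<and> head Q b = tail Q a \<and> basis (two_path Q a b) \<in> I) \<and>
        (\<exists>\<^sub>\<le>\<^sub>1 c. c \<in> arcs Q \<and> head Q a = tail Q c \<and> basis (two_path Q c a) \<in> I))"

definition Rset ::
  "('v, 'a) pre_digraph \<Rightarrow> (('v, 'a) qpath \<Rightarrow>\<^sub>0 'k::field) set \<Rightarrow> ('v, 'a) qpath set" where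
  "Rset Q I = {p \<in> qpaths Q. plength p = 2 \<and> basis p \<in> I}"

definition Bset ::
  "('v, 'a) pre_digraph \<Rightarrow> (('v, 'a) qpath \<Rightarrow>\<^sub>0 'k::field) set \<Rightarrow> ('v, 'a) qpath set" where
  "Bset Q I = {p \<in> qpaths Q. \<forall>r \<in> Rset Q I. \<not> subpath Q r p}"

definition Gamma_set ::
  "('v, 'a) pre_digraph \<Rightarrow> (('v, 'a) qpath \<Rightarrow>\<^sub>0 'k::field) set \<Rightarrow> ('v, 'a) qpath set" where
  "Gamma_set Q I = {p \<in> qpaths Q. \<forall>u. subpath Q u p \<and> plength u = 2 \<longrightarrow> u \<in> Rset Q I}"


section \<open>Spanning trees\<close>

text \<open>
  The acyclicity in \<^const>\<open>spanning_tree\<close> of the library is about directed cycles, so it is not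
  used here.  Each arrow is instead doubled by a formal inverse, and a cycle of the underlying
  undirected multigraph is a directed cycle of the doubled quiver not using an arrow twice.
\<close>

definition doubled :: "('v, 'a) pre_digraph \<Rightarrow> ('v, 'a \<times> bool) pre_digraph" where
  "doubled Q =
     \<lparr> verts = verts Q, arcs = arcs Q \<times> UNIV,
       tail = (\<lambda>(c, fwd). if fwd then tail Q c else head Q c),
       head = (\<lambda>(c, fwd). if fwd then head Q c else tail Q c) \<rparr>"

definition undirected_acyclic :: "('v, 'a) pre_digraph \<Rightarrow> bool" where
  "undirected_acyclic Q \<longleftrightarrow>
     \<not> (\<exists>p. pre_digraph.cycle (doubled Q) p \<and> distinct (map fst p))"

definition spanning_tree_arcs :: "('v, 'a) pre_digraph \<Rightarrow> 'a set \<Rightarrow> bool" where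
  "spanning_tree_arcs Q T \<longleftrightarrow> T \<subseteq> arcs Q \<and>
     Digraph_Component.connected (Q\<lparr>arcs := T\<rparr>) \<and> undirected_acyclic (Q\<lparr>arcs := T\<rparr>)"


section \<open>Cycles and circuits\<close>

definition is_cycle :: "('v, 'a) pre_digraph \<Rightarrow> ('v, 'a) qpath \<Rightarrow> bool" where
  "is_cycle Q C \<longleftrightarrow> C \<in> qpaths Q \<and> plength C > 0 \<and> psource C = ptarget Q C"

text \<open>\<open>c_m \<cdots> c_1\<close> is rotated to \<open>c_(m-1) \<cdots> c_1 c_m\<close>, which traverses \<open>c_m\<close> first.\<close>

definition rot :: "('v, 'a) pre_digraph \<Rightarrow> ('v, 'a) qpath \<Rightarrow> ('v, 'a) qpath" where
  "rot Q C = (tail Q (last (snd C)), last (snd C) # butlast (snd C))"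

definition same_circuit ::
  "('v, 'a) pre_digraph \<Rightarrow> ('v, 'a) qpath \<Rightarrow> ('v, 'a) qpath \<Rightarrow> bool" where
  "same_circuit Q C D \<longleftrightarrow> (\<exists>i. D = (rot Q ^^ i) C)"

definition period :: "('v, 'a) pre_digraph \<Rightarrow> ('v, 'a) qpath \<Rightarrow> nat" where
  "period Q C = (LEAST i. i \<ge> 1 \<and> (rot Q ^^ i) C = C)"

definition ppower :: "('v, 'a) qpath \<Rightarrow> nat \<Rightarrow> ('v, 'a) qpath" where
  "ppower C n = (fst C, concat (replicate n (snd C)))"

definition primitive_cycle :: "('v, 'a) pre_digraph \<Rightarrow> ('v, 'a) qpath \<Rightarrow> bool" where
  "primitive_cycle Q C \<longleftrightarrow> is_cycle Q C \<and> \<not> (\<exists>D n. is_cycle Q D \<and> n \<ge> 2 \<and> C = ppower D n)"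

definition prim_complete_cycles ::
  "('v, 'a) pre_digraph \<Rightarrow> (('v, 'a) qpath \<Rightarrow>\<^sub>0 'k::field) set \<Rightarrow> ('v, 'a) qpath set" where
  "prim_complete_cycles Q I = {C. primitive_cycle Q C \<and> ppower C 2 \<in> Gamma_set Q I}"

definition prim_cocomplete_cycles ::
  "('v, 'a) pre_digraph \<Rightarrow> (('v, 'a) qpath \<Rightarrow>\<^sub>0 'k::field) set \<Rightarrow> ('v, 'a) qpath set" where
  "prim_cocomplete_cycles Q I = {C. primitive_cycle Q C \<and> ppower C 2 \<in> Bset Q I}"

definition circuit_representatives ::
  "('v, 'a) pre_digraph \<Rightarrow> ('v, 'a) qpath set \<Rightarrow> ('v, 'a) qpath set \<Rightarrow> bool" where
  "circuit_representatives Q Y X \<longleftrightarrow> X \<subseteq> Y \<and> (\<forall>C \<in> Y. \<exists>!D. D \<in> X \<and> same_circuit Q C D)"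


section \<open>The complex, cohomology classes and the generating set\<close>

text \<open>
  Elements of the total complex, the direct sum over all \<open>m\<close> of the spaces with basis
  \<open>\<Gamma>_m \<parallel> B\<close>, are finitely supported functions on pairs of paths.  Both the differential and its
  image are homogeneous, so the cosets below are the classes in the direct sum of all \<open>HH^m\<close>.
\<close>

definition parallel_pairs ::
  "('v, 'a) pre_digraph \<Rightarrow> (('v, 'a) qpath \<Rightarrow>\<^sub>0 'k::field) set
     \<Rightarrow> (('v, 'a) qpath \<times> ('v, 'a) qpath) set" where
  "parallel_pairs Q I = {(g, x). g \<in> Gamma_set Q I \<and> x \<in> Bset Q I \<and>
     psource g = psource x \<and> ptarget Q g = ptarget Q x}"

definition cochains ::
  "('v, 'a) pre_digraph \<Rightarrow> (('v, 'a) qpath \<Rightarrow>\<^sub>0 'k::field) set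
     \<Rightarrow> (('v, 'a) qpath \<times> ('v, 'a) qpath \<Rightarrow>\<^sub>0 'k) set" where
  "cochains Q I = {f. Poly_Mapping.keys f \<subseteq> parallel_pairs Q I}"

text \<open>
  Composability is required explicitly: since \<^const>\<open>pcomp\<close> is total, \<open>pcomp (triv v) (arrow Q a)\<close>
  is a path also if \<open>a\<close> does not end at \<open>v\<close>.
\<close>

definition differential ::
  "('v, 'a) pre_digraph \<Rightarrow> (('v, 'a) qpath \<Rightarrow>\<^sub>0 'k::field) set
     \<Rightarrow> (('v, 'a) qpath \<times> ('v, 'a) qpath \<Rightarrow>\<^sub>0 'k) \<Rightarrow> (('v, 'a) qpath \<times> ('v, 'a) qpath \<Rightarrow>\<^sub>0 'k)" where
  "differential Q I f =
     (\<Sum>(g, x) \<in> Poly_Mapping.keys f.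
        (\<Sum>b \<in> {b \<in> arcs Q. composable Q (arrow Q b) g \<and> composable Q (arrow Q b) x \<and>
               (pcomp (arrow Q b) g, pcomp (arrow Q b) x) \<in> parallel_pairs Q I}.
           Poly_Mapping.single (pcomp (arrow Q b) g, pcomp (arrow Q b) x)
             (Poly_Mapping.lookup f (g, x)))
      - (\<Sum>a \<in> {a \<in> arcs Q. composable Q g (arrow Q a) \<and> composable Q x (arrow Q a) \<and>
               (pcomp g (arrow Q a), pcomp x (arrow Q a)) \<in> parallel_pairs Q I}.
           Poly_Mapping.single (pcomp g (arrow Q a), pcomp x (arrow Q a))
             ((- 1) ^ plength g * Poly_Mapping.lookup f (g, x))))"

definition cohomology_class ::
  "('v, 'a) pre_digraph \<Rightarrow> (('v, 'a) qpath \<Rightarrow>\<^sub>0 'k::field) set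
     \<Rightarrow> (('v, 'a) qpath \<times> ('v, 'a) qpath \<Rightarrow>\<^sub>0 'k) \<Rightarrow> (('v, 'a) qpath \<times> ('v, 'a) qpath \<Rightarrow>\<^sub>0 'k) set" where
  "cohomology_class Q I f = {f + differential Q I h | h. h \<in> cochains Q I}"

definition cocomplete_cochain ::
  "('v, 'a) pre_digraph \<Rightarrow> ('v, 'a) qpath \<Rightarrow> (('v, 'a) qpath \<times> ('v, 'a) qpath \<Rightarrow>\<^sub>0 'k::field)" where
  "cocomplete_cochain Q x =
     (\<Sum>i < period Q x. basis (triv (psource ((rot Q ^^ i) x)), (rot Q ^^ i) x))"

definition complete_cochain ::
  "('v, 'a) pre_digraph \<Rightarrow> ('v, 'a) qpath \<Rightarrow> (('v, 'a) qpath \<times> ('v, 'a) qpath \<Rightarrow>\<^sub>0 'k::field)" where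
  "complete_cochain Q C =
     (\<Sum>i < period Q C. basis ((rot Q ^^ i) C, triv (psource ((rot Q ^^ i) C))))"

definition basic_Gamma :: "'k::field itself \<Rightarrow> ('v, 'a) qpath set \<Rightarrow> ('v, 'a) qpath set" where
  "basic_Gamma _ DD =
     (if CHAR('k) = 2 then DD
      else {D \<in> DD. even (plength D)} \<union> (\<lambda>D. ppower D 2) ` {D \<in> DD. odd (plength D)})"

definition begin_alike :: "('v, 'a) qpath \<Rightarrow> ('v, 'a) qpath \<Rightarrow> bool" where
  "begin_alike p q \<longleftrightarrow> snd p \<noteq> [] \<and> snd q \<noteq> [] \<and> hd (snd p) = hd (snd q)"

definition end_alike :: "('v, 'a) qpath \<Rightarrow> ('v, 'a) qpath \<Rightarrow> bool" where
  "end_alike p q \<longleftrightarrow> snd p \<noteq> [] \<and> snd q \<noteq> [] \<and> last (snd p) = last (snd q)"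

definition fundamental_classes ::
  "('v, 'a) pre_digraph \<Rightarrow> (('v, 'a) qpath \<Rightarrow>\<^sub>0 'k::field) set \<Rightarrow> 'a set
     \<Rightarrow> (('v, 'a) qpath \<times> ('v, 'a) qpath \<Rightarrow>\<^sub>0 'k) set set" where
  "fundamental_classes Q I T =
     cohomology_class Q I ` {basis (arrow Q c, arrow Q c) | c. c \<in> arcs Q - T}"

text \<open>
  \<open>CC\<close> and \<open>DD\<close> are sets of representatives of the primitive cocomplete, respectively complete,
  circuits; \<open>T\<close> is a spanning tree.
\<close>

definition generating_classes ::
  "('v, 'a) pre_digraph \<Rightarrow> (('v, 'a) qpath \<Rightarrow>\<^sub>0 'k::field) set \<Rightarrow> 'a set
     \<Rightarrow> ('v, 'a) qpath set \<Rightarrow> ('v, 'a) qpath set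
     \<Rightarrow> (('v, 'a) qpath \<times> ('v, 'a) qpath \<Rightarrow>\<^sub>0 'k) set set" where
  "generating_classes Q I T CC DD =
     cohomology_class Q I `
       {basis (triv (psource x), x) | x. is_cycle Q x \<and> maximal_in Q (Bset Q I) x}
   \<union> cohomology_class Q I ` (cocomplete_cochain Q ` CC)
   \<union> fundamental_classes Q I T
   \<union> cohomology_class Q I `
       {basis (g, x) | g x. (g, x) \<in> parallel_pairs Q I \<and> maximal_in Q (Gamma_set Q I) g \<and>
          \<not> begin_alike g x \<and> \<not> end_alike g x}
   \<union> cohomology_class Q I ` (complete_cochain Q ` basic_Gamma TYPE('k) DD)"


section \<open>The ribbon graph\<close>

text \<open>
  Its edges are the vertices of \<open>Q\<close>.  A vertex is either a path of finite length or the infinite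
  path obtained from the powers of a primitive cocomplete cycle.
\<close>

datatype ('v, 'a) rvertex = Finite_Path "('v, 'a) qpath" | Infinite_Path "('v, 'a) qpath"

text \<open>
  The vertices of \<open>Q\<close> in the order in which they are visited, up to cyclic rotation for an infinite
  path.  The end of the edge \<open>visits Q q ! i\<close> given by the \<open>i\<close>-th passage is the pair \<open>(q, i)\<close>.
\<close>

fun visits :: "('v, 'a) pre_digraph \<Rightarrow> ('v, 'a) rvertex \<Rightarrow> 'v list" where
  "visits Q (Finite_Path p) = pre_digraph.awalk_verts Q (fst p) (snd p)"
| "visits Q (Infinite_Path C) = map (tail Q) (snd C)"

definition valency :: "('v, 'a) pre_digraph \<Rightarrow> ('v, 'a) rvertex \<Rightarrow> nat" where
  "valency Q q = length (visits Q q)"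

definition passages ::
  "('v, 'a) pre_digraph \<Rightarrow> ('v, 'a) rvertex set \<Rightarrow> 'v \<Rightarrow> (('v, 'a) rvertex \<times> nat) set" where
  "passages Q W v = {(q, i). q \<in> W \<and> i < valency Q q \<and> visits Q q ! i = v}"

definition maximal_nonzero_paths ::
  "('v, 'a) pre_digraph \<Rightarrow> (('v, 'a) qpath \<Rightarrow>\<^sub>0 'k::field) set \<Rightarrow> ('v, 'a) qpath set
     \<Rightarrow> ('v, 'a) rvertex set" where
  "maximal_nonzero_paths Q I CC =
     Finite_Path ` {p. maximal_in Q (Bset Q I) p} \<union> Infinite_Path ` CC"

definition rvertices ::
  "('v, 'a) pre_digraph \<Rightarrow> (('v, 'a) qpath \<Rightarrow>\<^sub>0 'k::field) set \<Rightarrow> ('v, 'a) qpath set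
     \<Rightarrow> ('v, 'a) rvertex set" where
  "rvertices Q I CC =
     maximal_nonzero_paths Q I CC \<union>
     (\<lambda>v. Finite_Path (triv v)) `
       {v \<in> verts Q. card (passages Q (maximal_nonzero_paths Q I CC) v) = 1}"


section \<open>The marked surface\<close>

definition quotient_topology :: "'x topology \<Rightarrow> ('x \<times> 'x) set \<Rightarrow> 'x set topology" where
  "quotient_topology X r =
     topology (\<lambda>U. U \<subseteq> topspace X // r \<and> openin X {x \<in> topspace X. r `` {x} \<in> U})"

lemma openin_quotient_topology:
  "openin (quotient_topology X r) U \<longleftrightarrow>
     U \<subseteq> topspace X // r \<and> openin X {x \<in> topspace X. r `` {x} \<in> U}"
proof -
  have inter: "{x \<in> topspace X. r `` {x} \<in> S \<inter> S'} =
      {x \<in> topspace X. r `` {x} \<in> S} \<inter> {x \<in> topspace X. r `` {x} \<in> S'}" for S S'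
    by auto
  have union: "{x \<in> topspace X. r `` {x} \<in> \<Union>K} = (\<Union>S\<in>K. {x \<in> topspace X. r `` {x} \<in> S})" for K
    by auto
  have "istopology (\<lambda>U. U \<subseteq> topspace X // r \<and> openin X {x \<in> topspace X. r `` {x} \<in> U})"
    unfolding istopology_def inter union by blast
  then show ?thesis
    by (simp add: quotient_topology_def)
qed

lemma topspace_quotient_topology [simp]: "topspace (quotient_topology X r) = topspace X // r"
proof
  show "topspace (quotient_topology X r) \<subseteq> topspace X // r"
    using openin_quotient_topology openin_topspace by blast
  have "{x \<in> topspace X. r `` {x} \<in> topspace X // r} = topspace X"
    by (auto simp: quotient_def)
  then have "openin (quotient_topology X r) (topspace X // r)"
    by (simp add: openin_quotient_topology)
  then show "topspace X // r \<subseteq> topspace (quotient_topology X r)"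
    by (rule openin_subset)
qed

lemma quotient_map_quotient_topology:
  "quotient_map X (quotient_topology X r) (\<lambda>x. r `` {x})"
  by (auto simp: quotient_map_def openin_quotient_topology quotient_def)

text \<open>
  The \<open>2n\<close>-gon at a vertex of valency \<open>n\<close> is the closed unit disc, its perimeter being parametrised
  \<^emph>\<open>clockwise\<close> by the interval from \<open>0\<close> to \<open>2n\<close>.  The parameters in \<open>[2i, 2i+1]\<close> form the red side
  of the end \<open>(q, i)\<close>, those in \<open>[2i+1, 2i+2]\<close> the black side between the ends \<open>(q, i)\<close> and
  \<open>(q, i+1)\<close>, where \<open>i+1\<close> is taken modulo \<open>n\<close>.
\<close>

definition perimeter :: "('v, 'a) pre_digraph \<Rightarrow> ('v, 'a) rvertex \<Rightarrow> real \<Rightarrow> ('v, 'a) rvertex \<times> complex"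
  where "perimeter Q q x = (q, cis (- (pi * x / real (valency Q q))))"

definition polygons :: "('v, 'a) rvertex set \<Rightarrow> (('v, 'a) rvertex \<times> complex) topology" where
  "polygons W = sum_topology (\<lambda>q. top_of_set (cball 0 1)) W"

text \<open>
  All polygons carry the orientation of the complex plane and all sides are parametrised clockwise,
  so \<open>t \<mapsto> 1 - t\<close> is the identification of red sides with opposite orientations.
\<close>

definition gluing ::
  "('v, 'a) pre_digraph \<Rightarrow> ('v, 'a) rvertex set
     \<Rightarrow> ((('v, 'a) rvertex \<times> complex) \<times> (('v, 'a) rvertex \<times> complex)) set" where
  "gluing Q W =
     {(perimeter Q q (2 * real i + t), perimeter Q q' (2 * real j + 1 - t)) | q i q' j t.
        (\<exists>v \<in> verts Q. (q, i) \<in> passages Q W v \<and> (q', j) \<in> passages Q W v) \<and>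
        (q, i) \<noteq> (q', j) \<and> 0 \<le> t \<and> t \<le> 1}"

definition glued ::
  "('v, 'a) pre_digraph \<Rightarrow> ('v, 'a) rvertex set
     \<Rightarrow> ((('v, 'a) rvertex \<times> complex) \<times> (('v, 'a) rvertex \<times> complex)) set" where
  "glued Q W = (gluing Q W \<union> (gluing Q W)\<inverse>)\<^sup>*"

definition surface ::
  "('v, 'a) pre_digraph \<Rightarrow> ('v, 'a) rvertex set \<Rightarrow> (('v, 'a) rvertex \<times> complex) set topology" where
  "surface Q W = quotient_topology (polygons W) (glued Q W)"

definition black_points ::
  "('v, 'a) pre_digraph \<Rightarrow> ('v, 'a) rvertex set \<Rightarrow> (('v, 'a) rvertex \<times> complex) set" where
  "black_points Q W =
     {perimeter Q q x | q i x. q \<in> W \<and> i < valency Q q \<and> 2 * real i + 1 \<le> x \<and> x \<le> 2 * real i + 2}"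

definition surface_boundary ::
  "('v, 'a) pre_digraph \<Rightarrow> ('v, 'a) rvertex set \<Rightarrow> (('v, 'a) rvertex \<times> complex) set set" where
  "surface_boundary Q W = (\<lambda>z. glued Q W `` {z}) ` black_points Q W"

definition boundary_components ::
  "('v, 'a) pre_digraph \<Rightarrow> ('v, 'a) rvertex set \<Rightarrow> (('v, 'a) rvertex \<times> complex) set set set" where
  "boundary_components Q W =
     connected_components_of (subtopology (surface Q W) (surface_boundary Q W))"

text \<open>The marked pair is formed by the last and the first end, so the marked black side is the last.\<close>

definition boundary_marked_points ::
  "('v, 'a) pre_digraph \<Rightarrow> ('v, 'a) rvertex set \<Rightarrow> (('v, 'a) rvertex \<times> complex) set set" where
  "boundary_marked_points Q W =
     {glued Q W `` {perimeter Q (Finite_Path p) (2 * real (valency Q (Finite_Path p)) - 1 / 2)}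
        | p. Finite_Path p \<in> W}"

definition G_punctures ::
  "('v, 'a) pre_digraph \<Rightarrow> ('v, 'a) rvertex set \<Rightarrow> (('v, 'a) rvertex \<times> complex) set set" where
  "G_punctures Q W = {glued Q W `` {(Infinite_Path C, 0)} | C. Infinite_Path C \<in> W}"

definition components_with_at_most_one_mark ::
  "('v, 'a) pre_digraph \<Rightarrow> ('v, 'a) rvertex set \<Rightarrow> (('v, 'a) rvertex \<times> complex) set set set" where
  "components_with_at_most_one_mark Q W =
     {K \<in> boundary_components Q W.
        finite (K \<inter> boundary_marked_points Q W) \<and> card (K \<inter> boundary_marked_points Q W) \<le> 1}"

end

theory Submission
  imports Defs "HOL-Library.Equipollence"
begin

text \<open>
  The coefficient of a cochain at a pair of paths neither beginning nor ending with the same arrow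
  depends only on its class, since the differential only produces pairs with a common first or last
  arrow.  Hence the generators outside \<open>F\<close> have pairwise distinct classes, and it remains to count.

  Cut the boundary of the surface into the black sides.  Each arrow occurs exactly once in a maximal
  non-zero path, so the black sides are the arrows together with one marked side for each finite
  path.  At the corner after the side of an arrow \<open>a\<close> the boundary turns into the other end of the
  edge \<open>t(a)\<close>; by gentleness this continues with the arrow \<open>b\<close> such that \<open>b a \<in> I\<close>, or with a
  marked side if there is no such \<open>b\<close>.  Therefore a component without marked point is a primitive
  complete circuit.  A component with one marked point, belonging to the path \<open>\<alpha>\<close>, consists of the
  side of \<open>\<alpha>\<close> followed by a possibly empty chain of relations: if it is empty, \<open>\<alpha>\<close> is a maximal
  cycle, and otherwise it is the unique maximal \<open>\<gamma>\<close> parallel to \<open>\<alpha>\<close> without common first or last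
  arrow.
\<close>

section \<open>Chains of a partial injection on the arrows\<close>

text \<open>Gentleness makes "nonzero composite" and "composite in I" two partial injections on the
  arrows, and every composable pair belongs to exactly one of them. The orbits of either are lines
  (maximal paths) or cycles (primitive circuits), so one abstract theory serves \<open>Bset\<close>
  and \<open>Gamma_set\<close> alike. Red sides are glued with reversed orientation; hence the end
  of a black side meets the beginning of the black side following the opposite end of the edge. This
  makes "next side" a permutation of the finite set of ends, and the boundary components are its
  orbits. The delicate case is that of trivial paths: a maximal \<open>\<gamma>\<close> may be
  parallel to a trivial \<open>\<alpha>\<close>, and then the vertex must be shown to have exactly
  one passage of a maximal nonzero path, so that its trivial path is a vertex of the ribbon graph.
  The G-punctures match the primitive cocomplete circuits directly. In characteristic different from
  2 the square of an odd complete circuit replaces the circuit itself, which does not change the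
  count.\<close>

definition rotl :: "'a list \<Rightarrow> 'a list" where
  "rotl xs = (if xs = [] then [] else last xs # butlast xs)"

text \<open>Each rotation consumes the last entry, so the induction removes entries of
  \<open>ys\<close> from the right while the generalised \<open>xs\<close> absorbs them at its
  front.\<close>

lemma funpow_rotl_append: "(rotl ^^ length ys) (xs @ ys) = ys @ xs"
proof (induction ys arbitrary: xs rule: rev_induct)
  case (snoc y ys)
  have "(rotl ^^ length (ys @ [y])) (xs @ ys @ [y]) = (rotl ^^ length ys) (rotl ((xs @ ys) @ [y]))"
    by (simp add: funpow_Suc_right del: funpow.simps)
  also have "rotl ((xs @ ys) @ [y]) = (y # xs) @ ys"
    by (simp add: rotl_def butlast_append)
  finally show ?case using snoc.IH[of "y # xs"] by simp
qed simp

lemma set_rotl [simp]: "set (rotl xs) = set xs"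
proof (cases xs rule: rev_exhaust)
  case (snoc ys y)
  then show ?thesis by (simp add: rotl_def)
qed (simp add: rotl_def)

lemma set_funpow_rotl [simp]: "set ((rotl ^^ i) xs) = set xs"
  by (induction i) auto

lemma funpow_rot:
  "cs \<noteq> [] \<Longrightarrow> u = tail Q (hd cs) \<Longrightarrow>
   (rot Q ^^ i) (u, cs) = (tail Q (hd ((rotl ^^ i) cs)), (rotl ^^ i) cs)"
proof (induction i)
  case (Suc i)
  have "(rotl ^^ i) cs \<noteq> []"
    using Suc.prems(1) set_funpow_rotl[of i cs] by (metis set_empty)
  then show ?case
    using Suc by (simp add: rot_def[of Q "(_, (rotl ^^ i) cs)"] rotl_def[of "(rotl ^^ i) cs"])
qed simp

lemma snd_funpow_rot: "snd C \<noteq> [] \<Longrightarrow> snd ((rot Q ^^ i) C) = (rotl ^^ i) (snd C)"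
proof (induction i)
  case (Suc i)
  have "(rotl ^^ i) (snd C) \<noteq> []"
    using Suc.prems(1) set_funpow_rotl[of i "snd C"] by (metis set_empty)
  then show ?case
    using Suc by (simp add: rot_def[of Q "(rot Q ^^ i) C"] rotl_def[of "(rotl ^^ i) (snd C)"])
qed simp

lemma nth_concat_replicate:
  "k < m * length xs \<Longrightarrow> concat (replicate m xs) ! k = xs ! (k mod length xs)"
proof (induction m arbitrary: k)
  case (Suc m)
  show ?case
  proof (cases "k < length xs")
    case True
    then show ?thesis by (simp add: nth_append)
  next
    case False
    then have "k - length xs < m * length xs"
      using Suc.prems by auto
    then show ?thesis
      using False Suc.IH[of "k - length xs"] by (simp add: nth_append le_mod_geq)
  qed
qed simp

lemma length_concat_replicate [simp]: "length (concat (replicate m xs)) = m * length xs"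
  by (induction m) auto

lemma successively_nthD: "successively P xs \<Longrightarrow> Suc i < length xs \<Longrightarrow> P (xs ! i) (xs ! Suc i)"
proof (induction xs arbitrary: i)
  case (Cons x xs)
  then show ?case by (cases i; cases xs) auto
qed simp

text \<open>Links a condition on consecutive entries with one on factors of length two, the form in
  which subpaths in \<open>R\<close> appear.\<close>

lemma successively_conv_split:
  "successively P xs \<longleftrightarrow> (\<forall>ys a b zs. xs = ys @ a # b # zs \<longrightarrow> P a b)"
proof (intro iffI allI impI)
  assume R: "\<forall>ys a b zs. xs = ys @ a # b # zs \<longrightarrow> P a b"
  then show "successively P xs"
  proof (induction xs)
    case (Cons x xs)
    have "successively P xs"
      using Cons.prems by (intro Cons.IH) (metis append_Cons)
    moreover have "xs = [] \<or> P x (hd xs)"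
      using Cons.prems[rule_format, of "[]" x "hd xs" "tl xs"] by (cases xs) auto
    ultimately show ?case by (simp add: successively_Cons)
  qed simp
qed (auto simp: successively_append_iff)

section \<open>Paths and subpaths as lists of arrows\<close>

lemma (in wf_digraph) qpaths_Cons_iff:
  "cs \<noteq> [] \<Longrightarrow> (u, cs) \<in> qpaths G \<longleftrightarrow>
     u = tail G (hd cs) \<and> set cs \<subseteq> arcs G \<and> successively (\<lambda>a b. head G a = tail G b) cs"
proof (induction cs arbitrary: u)
  case (Cons c cs)
  show ?case
  proof (cases "cs = []")
    case False
    have "(u, c # cs) \<in> qpaths G \<longleftrightarrow> c \<in> arcs G \<and> u = tail G c \<and> (head G c, cs) \<in> qpaths G"
      by (auto simp: qpaths_def awalk_Cons_iff)
    then show ?thesis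
      using Cons.IH[OF False] False by (auto simp: successively_Cons)
  qed (auto simp: qpaths_def awalk_simps)
qed simp

lemma (in wf_digraph) qpaths_Nil_iff: "(u, []) \<in> qpaths G \<longleftrightarrow> u \<in> verts G"
  by (auto simp: qpaths_def awalk_Nil_iff)

lemma ptarget_conv: "ptarget Q (u, cs) = (if cs = [] then u else head Q (last cs))"
  by (simp add: ptarget_def pre_digraph.awalk_verts_conv)

lemma (in wf_digraph) ptarget_in_verts: "p \<in> qpaths G \<Longrightarrow> ptarget G p \<in> verts G"
  by (auto simp: qpaths_def ptarget_def)

text \<open>The source of the subpath is tied to its position separately, since an empty
  \<open>ds\<close> occurs at every position of the list.\<close>

lemma subpath_Pair_iff:
  fixes Q :: "('v, 'a) pre_digraph"
  assumes "wf_digraph Q" "(u, cs) \<in> qpaths Q"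
  shows "subpath Q (w, ds) (u, cs) \<longleftrightarrow>
    (w, ds) \<in> qpaths Q \<and> (\<exists>xs ys. cs = xs @ ds @ ys \<and> w = ptarget Q (u, xs))"
proof -
  interpret wf_digraph Q by fact
  show ?thesis
  proof
    assume "subpath Q (w, ds) (u, cs)"
    then show "(w, ds) \<in> qpaths Q \<and> (\<exists>xs ys. cs = xs @ ds @ ys \<and> w = ptarget Q (u, xs))"
      unfolding subpath_def by (auto simp: composable_def psource_def pcomp_def)
  next
    assume R: "(w, ds) \<in> qpaths Q \<and> (\<exists>xs ys. cs = xs @ ds @ ys \<and> w = ptarget Q (u, xs))"
    then obtain xs ys where cs: "cs = xs @ ds @ ys" and w: "w = ptarget Q (u, xs)" by blast
    from assms(2) obtain z where z: "awalk u cs z" by (auto simp: qpaths_def)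
    then have *: "awalk u xs w" "awalk w (ds @ ys) z"
      unfolding cs w ptarget_def by (auto simp: awalk_append_iff)
    then have "awalk (ptarget Q (w, ds)) ys z"
      unfolding ptarget_def by (auto simp: awalk_append_iff)
    then show "subpath Q (w, ds) (u, cs)"
      unfolding subpath_def using R cs w *
      by (intro conjI bexI[of _ "(u, xs)"] bexI[of _ "(ptarget Q (w, ds), ys)"])
         (auto simp: composable_def psource_def pcomp_def qpaths_def)
  qed
qed

text \<open>\<open>N a b\<close> says that \<open>b\<close> may follow \<open>a\<close>. As a
  partial injection on a finite set, \<open>N\<close> splits the arrows into lines and cycles; it
  will stand for the nonzero composites and for the relations.\<close>

locale chain_relation = fin_digraph G for G :: "('v, 'a) pre_digraph" +
  fixes N :: "'a \<Rightarrow> 'a \<Rightarrow> bool"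
  assumes N_arcs: "N a b \<Longrightarrow> a \<in> arcs G \<and> b \<in> arcs G \<and> head G a = tail G b"
    and N_fun: "N a b \<Longrightarrow> N a c \<Longrightarrow> b = c"
    and N_inj: "N a c \<Longrightarrow> N b c \<Longrightarrow> a = b"
begin

definition npaths :: "('v, 'a) qpath set" where
  "npaths = {p \<in> qpaths G. successively N (snd p)}"

definition maximal_chain :: "'a list \<Rightarrow> bool" where
  "maximal_chain cs \<longleftrightarrow> cs \<noteq> [] \<and> set cs \<subseteq> arcs G \<and> successively N cs \<and>
     (\<forall>a. \<not> N a (hd cs)) \<and> (\<forall>b. \<not> N (last cs) b)"

text \<open>Distinctness stands for primitivity: under a partial injection, a closed chain with a
  repeated arrow is a proper power.\<close>

definition cyclic_chain :: "'a list \<Rightarrow> bool" where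
  "cyclic_chain cs \<longleftrightarrow> cs \<noteq> [] \<and> set cs \<subseteq> arcs G \<and> successively N cs \<and>
     N (last cs) (hd cs) \<and> distinct cs"

lemma npaths_iff:
  "cs \<noteq> [] \<Longrightarrow> (u, cs) \<in> npaths \<longleftrightarrow> u = tail G (hd cs) \<and> set cs \<subseteq> arcs G \<and> successively N cs"
  using successively_mono[of N cs "\<lambda>a b. head G a = tail G b"] N_arcs
  by (auto simp: npaths_def qpaths_Cons_iff)

lemma npaths_Nil_iff: "(u, []) \<in> npaths \<longleftrightarrow> u \<in> verts G"
  by (simp add: npaths_def qpaths_Nil_iff)

lemma npathsD: "p \<in> npaths \<Longrightarrow> p \<in> qpaths G"
  by (simp add: npaths_def)

text \<open>A chain that properly contains \<open>cs\<close> contains a neighbour of its first or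
  last arrow, so only extensions by one arrow matter.\<close>

lemma maximal_in_npaths_iff:
  assumes "cs \<noteq> []"
  shows "maximal_in G npaths (u, cs) \<longleftrightarrow> maximal_chain cs \<and> u = tail G (hd cs)"
proof
  assume M: "maximal_in G npaths (u, cs)"
  then have p: "u = tail G (hd cs)" "set cs \<subseteq> arcs G" "successively N cs"
    using npaths_iff[OF assms] by (auto simp: maximal_in_def)
  have M': "\<not> subpath G (u, cs) q" if "q \<in> npaths" "q \<noteq> (u, cs)" for q
    using M that by (auto simp: maximal_in_def)
  have pq: "(u, cs) \<in> qpaths G"
    using M by (auto simp: maximal_in_def npaths_def)
  have "\<not> N a (hd cs)" for a
  proof
    assume a: "N a (hd cs)"
    then have q: "(tail G a, a # cs) \<in> npaths"
      using p N_arcs[OF a] by (simp add: npaths_iff successively_Cons)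
    moreover have "subpath G (u, cs) (tail G a, a # cs)"
      unfolding subpath_Pair_iff[OF wf_digraph_axioms npathsD[OF q]]
      using pq p N_arcs[OF a] by (intro conjI exI[of _ "[a]"] exI[of _ "[]"]) (auto simp: ptarget_conv)
    ultimately show False using M' by auto
  qed
  moreover have "\<not> N (last cs) b" for b
  proof
    assume b: "N (last cs) b"
    then have q: "(u, cs @ [b]) \<in> npaths"
      using p assms N_arcs[OF b] by (simp add: npaths_iff successively_append_iff)
    moreover have "subpath G (u, cs) (u, cs @ [b])"
      unfolding subpath_Pair_iff[OF wf_digraph_axioms npathsD[OF q]]
      using pq by (intro conjI exI[of _ "[]"] exI[of _ "[b]"]) (auto simp: ptarget_conv)
    ultimately show False using M' by auto
  qed
  ultimately show "maximal_chain cs \<and> u = tail G (hd cs)"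
    using p assms by (simp add: maximal_chain_def)
next
  assume M: "maximal_chain cs \<and> u = tail G (hd cs)"
  then have p: "(u, cs) \<in> npaths"
    by (simp add: maximal_chain_def npaths_iff)
  have "q = (u, cs)" if q: "q \<in> npaths" and s: "subpath G (u, cs) q" for q
  proof -
    obtain w ds where [simp]: "q = (w, ds)" by force
    obtain xs ys where ds: "ds = xs @ cs @ ys" and u: "u = ptarget G (w, xs)"
      using s subpath_Pair_iff[OF wf_digraph_axioms npathsD[OF q[unfolded \<open>q = (w, ds)\<close>]]] by auto
    have "successively N ds"
      using q by (simp add: npaths_def)
    then have "xs = []" "ys = []"
      using M by (auto simp: ds successively_append_iff maximal_chain_def)
    then show ?thesis using ds u by (simp add: ptarget_conv)
  qed
  then show "maximal_in G npaths (u, cs)"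
    using p by (auto simp: maximal_in_def)
qed

text \<open>A trivial path is a subpath of every arrow at its vertex, so it can be maximal only at
  an isolated vertex.\<close>

lemma maximal_in_npaths_trivial:
  assumes "maximal_in G npaths (u, [])" "a \<in> arcs G"
  shows "tail G a \<noteq> u" "head G a \<noteq> u"
proof -
  have q: "(tail G a, [a]) \<in> npaths"
    using assms(2) by (simp add: npaths_iff)
  have u: "(u, []) \<in> qpaths G"
    using assms(1) by (auto simp: maximal_in_def npaths_def)
  have "subpath G (u, []) (tail G a, [a])" if "tail G a = u \<or> head G a = u"
    unfolding subpath_Pair_iff[OF wf_digraph_axioms npathsD[OF q]]
  proof (intro conjI u)
    show "\<exists>xs ys. [a] = xs @ [] @ ys \<and> u = ptarget G (tail G a, xs)"
      using that by (elim disjE) (rule exI[of _ "[]"] exI[of _ "[a]"], simp add: ptarget_conv)+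
  qed
  then show "tail G a \<noteq> u" "head G a \<noteq> u"
    using assms(1) q by (auto simp: maximal_in_def)
qed

lemma maximal_in_npathsE:
  assumes "maximal_in G npaths p" "\<exists>a \<in> arcs G. tail G a = fst p \<or> head G a = fst p"
  shows "maximal_chain (snd p)" "fst p = tail G (hd (snd p))"
proof -
  have "snd p \<noteq> []"
  proof
    assume "snd p = []"
    then have "p = (fst p, [])" by (simp add: prod_eq_iff)
    then show False
      using assms maximal_in_npaths_trivial[of "fst p"] by metis
  qed
  then show "maximal_chain (snd p)" "fst p = tail G (hd (snd p))"
    using assms(1) maximal_in_npaths_iff[of "snd p" "fst p"] by simp_all
qed

text \<open>Injectivity transports a coincidence of entries back to the start of the chain with the
  smaller index; functionality transports it forward again in \<open>chain_forward\<close>.\<close>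

lemma chain_back:
  assumes "successively N cs" "successively N ds" "i \<le> j" "i < length cs" "j < length ds"
    "cs ! i = ds ! j"
  shows "cs ! 0 = ds ! (j - i)"
  using assms(3-)
proof (induction i arbitrary: j)
  case (Suc i)
  then obtain j' where j: "j = Suc j'" by (cases j) auto
  have "N (cs ! i) (cs ! Suc i)" "N (ds ! j') (ds ! Suc j')"
    using successively_nthD[OF assms(1)] successively_nthD[OF assms(2)] Suc.prems(2,3) j by simp_all
  then have "cs ! i = ds ! j'"
    using Suc.prems j N_inj by metis
  then show ?case using Suc j by auto
qed simp

lemma chain_forward:
  assumes "successively N cs" "successively N ds" "cs ! 0 = ds ! 0" "k < length cs" "k < length ds"
  shows "cs ! k = ds ! k"
  using assms(4-)
proof (induction k)
  case (Suc k)
  have "N (cs ! k) (cs ! Suc k)" "N (ds ! k) (ds ! Suc k)"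
    using assms(1,2) Suc.prems by (auto intro: successively_nthD)
  then show ?case using Suc N_fun by (metis Suc_lessD)
qed (use assms(3) in simp)

text \<open>A longer \<open>ds\<close> runs along \<open>cs\<close> and then supplies a successor of
  its last arrow.\<close>

lemma maximal_chain_length_le:
  assumes "maximal_chain cs" "successively N ds" "cs ! 0 = ds ! 0"
  shows "length ds \<le> length cs"
proof (rule ccontr)
  assume l: "\<not> length ds \<le> length cs"
  moreover have "cs \<noteq> []" using assms(1) by (simp add: maximal_chain_def)
  ultimately have "N (ds ! (length cs - 1)) (ds ! length cs)"
    using successively_nthD[OF assms(2), of "length cs - 1"] by simp
  moreover have "ds ! (length cs - 1) = last cs"
    using chain_forward[OF _ assms(2,3), of "length cs - 1"] assms(1) l \<open>cs \<noteq> []\<close>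
    by (simp add: maximal_chain_def last_conv_nth)
  ultimately show False using assms(1) by (simp add: maximal_chain_def)
qed

lemma maximal_chain_unique_aux:
  assumes "maximal_chain cs" "maximal_chain ds" "i \<le> j" "i < length cs" "j < length ds"
    "cs ! i = ds ! j"
  shows "cs = ds \<and> i = j"
proof -
  have s: "successively N cs" "successively N ds" "cs \<noteq> []" "ds \<noteq> []"
    using assms by (auto simp: maximal_chain_def)
  have *: "cs ! 0 = ds ! (j - i)"
    using chain_back[OF s(1,2) assms(3-)] .
  \<comment> \<open>If \<open>i < j\<close>, the first arrow of \<open>cs\<close> has a predecessor
    in \<open>ds\<close>.\<close>
  have ij: "i = j"
  proof (rule ccontr)
    assume "i \<noteq> j"
    then have "N (ds ! (j - i - 1)) (ds ! (j - i))"
      using successively_nthD[OF s(2), of "j - i - 1"] assms by (simp add: Suc_diff_Suc)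
    then show False
      using assms(1) * s by (simp add: maximal_chain_def hd_conv_nth)
  qed
  then have 0: "cs ! 0 = ds ! 0" using * by simp
  then have "length cs = length ds"
    using maximal_chain_length_le[OF assms(1) s(2)] maximal_chain_length_le[OF assms(2) s(1)] by simp
  then show ?thesis
    using ij chain_forward[OF s(1,2) 0] by (auto intro: nth_equalityI)
qed

lemma maximal_chain_unique:
  assumes "maximal_chain cs" "maximal_chain ds" "i < length cs" "j < length ds" "cs ! i = ds ! j"
  shows "cs = ds \<and> i = j"
  using maximal_chain_unique_aux[OF assms(1,2), of i j] maximal_chain_unique_aux[OF assms(2,1), of j i] assms
  by (cases "i \<le> j") auto

section \<open>Cyclic chains and primitive circuits\<close>

lemma cyclic_chain_nth:
  assumes "cyclic_chain cs" "i < length cs"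
  shows "N (cs ! i) (cs ! (Suc i mod length cs))"
proof (cases "Suc i = length cs")
  case True
  moreover from True have "i = length cs - 1" by linarith
  ultimately have "cs ! i = last cs" "cs ! 0 = hd cs"
    using assms by (simp_all add: cyclic_chain_def last_conv_nth hd_conv_nth)
  then show ?thesis using assms True by (simp add: cyclic_chain_def)
qed (use assms in \<open>auto simp: cyclic_chain_def intro: successively_nthD\<close>)

lemma cyclic_chain_closed:
  assumes "cyclic_chain cs" "N a b"
  shows "a \<in> set cs \<longleftrightarrow> b \<in> set cs"
proof
  assume "a \<in> set cs"
  then show "b \<in> set cs"
    using cyclic_chain_nth[OF assms(1)] N_fun[OF assms(2)]
    by (metis assms(1) cyclic_chain_def in_set_conv_nth length_greater_0_conv mod_less_divisor)
next
  assume "b \<in> set cs"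
  then obtain i where i: "i < length cs" "b = cs ! i" by (auto simp: in_set_conv_nth)
  show "a \<in> set cs"
  proof (cases i)
    case 0
    then have "N (last cs) b" using assms(1) i by (auto simp: cyclic_chain_def hd_conv_nth)
    then show ?thesis using N_inj[OF assms(2)] assms(1) by (auto simp: cyclic_chain_def)
  next
    case (Suc k)
    then have "N (cs ! k) b" using cyclic_chain_nth[OF assms(1), of k] i by simp
    then show ?thesis using N_inj[OF assms(2)] i Suc by auto
  qed
qed

text \<open>The arrow set of a cyclic chain is closed under predecessors, so a common arrow drags
  the first arrow of the maximal chain into the cycle, where it has a predecessor.\<close>

lemma maximal_cyclic_disjoint:
  assumes "maximal_chain cs" "cyclic_chain ds"
  shows "set cs \<inter> set ds = {}"
proof (rule ccontr)
  assume "set cs \<inter> set ds \<noteq> {}"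
  then obtain a where "a \<in> set cs" "a \<in> set ds" by blast
  then obtain i where i: "i < length cs" "cs ! i \<in> set ds"
    by (metis in_set_conv_nth)
  have "cs ! 0 \<in> set ds"
    using i
  proof (induction i)
    case (Suc i)
    then have "N (cs ! i) (cs ! Suc i)"
      using assms(1) by (auto simp: maximal_chain_def intro: successively_nthD)
    then show ?case using Suc cyclic_chain_closed[OF assms(2)] by auto
  qed simp
  then obtain k where k: "k < length ds" "hd cs = ds ! k"
    using assms(1) by (auto simp: in_set_conv_nth hd_conv_nth maximal_chain_def)
  then have "\<exists>a. N a (hd cs)"
    using cyclic_chain_nth[OF assms(2), of "k - 1"] assms(2)
    by (cases k) (auto simp: cyclic_chain_def hd_conv_nth)
  then show False using assms(1) by (simp add: maximal_chain_def)
qed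

text \<open>Take a longest chain of distinct arrows through \<open>a\<close>. Unless it closes up, a
  neighbour beyond either end is a new arrow by functionality and injectivity, and adding it
  contradicts the choice.\<close>

lemma chain_cover:
  assumes "a \<in> arcs G"
  obtains (maximal) cs where "maximal_chain cs" "a \<in> set cs"
    | (cyclic) cs where "cyclic_chain cs" "a \<in> set cs"
proof -
  let ?P = "\<lambda>cs. distinct cs \<and> set cs \<subseteq> arcs G \<and> successively N cs \<and> a \<in> set cs"
  have "\<forall>cs. ?P cs \<longrightarrow> length cs < Suc (card (arcs G))"
    using card_mono[OF finite_arcs] by (metis distinct_card le_imp_less_Suc)
  moreover have "?P [a]" using assms by simp
  ultimately obtain cs where P: "?P cs" and mx: "\<And>ds. ?P ds \<Longrightarrow> length ds \<le> length cs"
    using ex_has_greatest_nat[of ?P "[a]" length] by metis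
  have ne: "cs \<noteq> []" using P by auto
  show thesis
  proof (cases "N (last cs) (hd cs)")
    case True
    then show ?thesis using P ne by (intro cyclic[of cs]) (auto simp: cyclic_chain_def)
  next
    case False
    have "\<not> N b (hd cs)" for b
    proof
      assume b: "N b (hd cs)"
      have "b \<notin> set cs"
      proof
        assume "b \<in> set cs"
        then obtain i where i: "i < length cs" "b = cs ! i" by (auto simp: in_set_conv_nth)
        \<comment> \<open>Were \<open>b\<close> the last arrow, \<open>N b (hd cs)\<close> would
          close the chain.\<close>
        have "Suc i \<noteq> length cs"
        proof
          assume "Suc i = length cs"
          then have "b = last cs" using i ne by (metis diff_Suc_1 last_conv_nth)
          then show False using b False by simp
        qed
        then have "cs ! Suc i = cs ! 0"
          using N_fun[OF b] successively_nthD[of N cs i] P i ne by (simp add: hd_conv_nth)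
        then show False
          using P i ne \<open>Suc i \<noteq> length cs\<close> by (simp add: nth_eq_iff_index_eq)
      qed
      then show False
        using mx[of "b # cs"] P b N_arcs[OF b] by (simp add: successively_Cons)
    qed
    moreover have "\<not> N (last cs) b" for b
    proof
      assume b: "N (last cs) b"
      have "b \<notin> set cs"
      proof
        assume "b \<in> set cs"
        then obtain i where i: "i < length cs" "b = cs ! i" by (auto simp: in_set_conv_nth)
        show False
        proof (cases i)
          case 0
          then show False using i b False ne by (simp add: hd_conv_nth)
        next
          case (Suc k)
          then have "N (cs ! k) b" using successively_nthD[of N cs k] P i by simp
          \<comment> \<open>A predecessor of \<open>b\<close> inside the chain would have to be the
            last arrow, whose index exceeds \<open>k\<close>.\<close>
          then have "cs ! k = cs ! (length cs - 1)"
            using N_inj[OF b] ne by (simp add: last_conv_nth)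
          then show False using P Suc i by (simp add: nth_eq_iff_index_eq)
        qed
      qed
      then show False
        using mx[of "cs @ [b]"] P b N_arcs[OF b] ne by (simp add: successively_append_iff)
    qed
    ultimately show ?thesis using P ne by (intro maximal[of cs]) (auto simp: maximal_chain_def)
  qed
qed

text \<open>If \<open>ds\<close> were longer, it would be back at its first arrow at index
  \<open>length cs\<close>, against distinctness.\<close>

lemma cyclic_chain_unique_aux:
  assumes "cyclic_chain cs" "cyclic_chain ds" "hd cs = hd ds" "length cs \<le> length ds"
  shows "cs = ds"
proof -
  have s: "successively N cs" "successively N ds" "cs ! 0 = ds ! 0" "cs \<noteq> []"
    using assms by (auto simp: cyclic_chain_def hd_conv_nth)
  have "length cs = length ds"
  proof (rule ccontr)
    assume "length cs \<noteq> length ds"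
    then have l: "length cs < length ds" using assms(4) by simp
    have "N (ds ! (length cs - 1)) (ds ! length cs)"
      using successively_nthD[OF s(2), of "length cs - 1"] l s(4) by simp
    moreover have "ds ! (length cs - 1) = last cs"
      using chain_forward[OF s(1-3), of "length cs - 1"] l s(4) by (simp add: last_conv_nth)
    ultimately have "ds ! length cs = ds ! 0"
      using N_fun assms(1,3) s by (metis cyclic_chain_def hd_conv_nth)
    then show False
      using assms(2) l s(4) by (simp add: cyclic_chain_def nth_eq_iff_index_eq)
  qed
  then show ?thesis
    using chain_forward[OF s(1-3)] by (auto intro: nth_equalityI)
qed

lemma cyclic_chain_unique:
  "cyclic_chain cs \<Longrightarrow> cyclic_chain ds \<Longrightarrow> hd cs = hd ds \<Longrightarrow> cs = ds"
  using cyclic_chain_unique_aux[of cs ds] cyclic_chain_unique_aux[of ds cs]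
  by (metis nat_le_linear)

lemma cyclic_chain_rotate:
  "cyclic_chain (xs @ a # ys) \<Longrightarrow> cyclic_chain (a # ys @ xs)"
  by (cases "xs = []")
     (auto simp: cyclic_chain_def successively_append_iff successively_Cons hd_append split: if_splits)

text \<open>A repeated arrow propagates along the periodic continuation of the cycle, so the least
  return time divides the length and the cycle is a proper power. Conversely, a proper power repeats
  its arrows.\<close>

lemma primitive_npath_cycles:
  "{C. primitive_cycle G C \<and> ppower C 2 \<in> npaths} = {(tail G (hd cs), cs) | cs. cyclic_chain cs}"
proof (intro equalityI subsetI)
  fix C assume "C \<in> {(tail G (hd cs), cs) | cs. cyclic_chain cs}"
  then obtain cs where C: "C = (tail G (hd cs), cs)" and cyc: "cyclic_chain cs" by auto
  have "is_cycle G C"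
    unfolding is_cycle_def C
    using cyc N_arcs[of "last cs" "hd cs"] npathsD[of "(tail G (hd cs), cs)"]
    by (auto simp: cyclic_chain_def plength_def psource_def ptarget_conv npaths_iff)
  moreover have False if "is_cycle G D" "n \<ge> 2" "C = ppower D n" for D n
  proof -
    obtain m where n: "n = Suc (Suc m)" using \<open>n \<ge> 2\<close> by (metis Suc_le_D numeral_2_eq_2 Suc_le_mono)
    have "cs = snd D @ snd D @ concat (replicate m (snd D))"
      using that(3) C n by (simp add: ppower_def)
    moreover have "snd D \<noteq> []"
      using that(1) by (simp add: is_cycle_def plength_def)
    ultimately show False using cyc by (auto simp: cyclic_chain_def)
  qed
  moreover have "ppower C 2 \<in> npaths"
    using cyc by (simp add: ppower_def C numeral_2_eq_2 npaths_iff cyclic_chain_def successively_append_iff)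
  ultimately show "C \<in> {C. primitive_cycle G C \<and> ppower C 2 \<in> npaths}"
    by (auto simp: primitive_cycle_def)
next
  fix C assume C: "C \<in> {C. primitive_cycle G C \<and> ppower C 2 \<in> npaths}"
  obtain u cs where [simp]: "C = (u, cs)" by force
  have ne: "cs \<noteq> []" using C by (auto simp: primitive_cycle_def is_cycle_def plength_def)
  have "(u, cs @ cs) \<in> npaths" using C by (simp add: ppower_def numeral_2_eq_2)
  then have u: "u = tail G (hd cs)" and cs: "set cs \<subseteq> arcs G" "successively N cs" "N (last cs) (hd cs)"
    using ne by (auto simp: npaths_iff successively_append_iff)
  let ?n = "length cs"
  \<comment> \<open>The periodic continuation of \<open>cs\<close>. Consecutive terms are related by
    \<open>N\<close> throughout because the square of \<open>C\<close> is still a chain.\<close>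
  define s where "s = (\<lambda>k. cs ! (k mod ?n))"
  have step: "N (s k) (s (Suc k))" for k
  proof (cases "Suc (k mod ?n) = ?n")
    case True
    moreover from True have "k mod ?n = ?n - 1" by linarith
    ultimately have "s k = last cs" "s (Suc k) = hd cs"
      using ne by (simp_all add: s_def last_conv_nth hd_conv_nth mod_Suc)
    then show ?thesis using cs by simp
  next
    case False
    then have "Suc (k mod ?n) < ?n" using ne by (metis Suc_lessI length_greater_0_conv mod_less_divisor)
    then show ?thesis
      using successively_nthD[OF cs(2), of "k mod ?n"] False by (simp add: s_def mod_Suc)
  qed
  have "distinct cs"
  proof (rule ccontr)
    assume "\<not> distinct cs"
    then obtain i j where ij: "i < ?n" "j < ?n" "i < j" "cs ! i = cs ! j"
      unfolding distinct_conv_nth by (metis nat_neq_iff)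
    \<comment> \<open>Injectivity moves the repetition back to the first arrow, so
      \<open>j - i\<close> is a return time.\<close>
    then have "cs ! 0 = cs ! (j - i)"
      using chain_back[OF cs(2,2), of i j] by simp
    then have *: "0 < j - i \<and> s (j - i) = s 0"
      using ij by (simp add: s_def)
    define d where "d = (LEAST d. 0 < d \<and> s d = s 0)"
    have d: "0 < d" "s d = s 0" "d \<le> j - i"
      using LeastI[of "\<lambda>d. 0 < d \<and> s d = s 0", OF *] Least_le[of "\<lambda>d. 0 < d \<and> s d = s 0", OF *]
      by (auto simp: d_def)
    have dn: "d < ?n" using d(3) ij by simp
    have per: "s (k + d) = s k" for k
    proof (induction k)
      case (Suc k)
      then show ?case using step[of k] step[of "k + d"] N_fun by (metis add_Suc)
    qed (use d in simp)
    have per': "s (k + m * d) = s k" for k m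
      by (induction m) (use per in \<open>auto simp: add.assoc[symmetric] add.commute[of d]\<close>)
    have smod: "s (k mod d) = s k" for k
      using per'[of "k mod d" "k div d"] by simp
    \<comment> \<open>The length modulo \<open>d\<close> would again be a return time below
      \<open>d\<close>, hence it is zero by minimality.\<close>
    have "s ?n = s 0" by (simp add: s_def)
    then have "s (?n mod d) = s 0" using smod by simp
    then have n0: "?n mod d = 0"
      using not_less_Least[of "?n mod d" "\<lambda>d. 0 < d \<and> s d = s 0"] d(1)
      by (metis d_def mod_less_divisor neq0_conv)
    define m where "m = ?n div d"
    have nm: "?n = m * d" using n0 div_mult_mod_eq[of ?n d] by (simp add: m_def)
    then have m2: "m \<ge> 2" using dn ne by (cases m; cases "m - 1") auto
    have lt: "length (take d cs) = d" using dn by simp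
    have "cs = concat (replicate m (take d cs))"
    proof (rule nth_equalityI)
      fix k assume k: "k < ?n"
      then have "concat (replicate m (take d cs)) ! k = cs ! (k mod d)"
        using nth_concat_replicate[of k m "take d cs"] lt nm d(1) by simp
      also have "\<dots> = s (k mod d)"
        using d(1) dn by (simp add: s_def) (metis mod_less mod_less_divisor order.strict_trans)
      also have "\<dots> = cs ! k" using smod k by (simp add: s_def)
      finally show "cs ! k = concat (replicate m (take d cs)) ! k" by simp
    qed (use lt nm in \<open>simp only: length_concat_replicate\<close>)
    then have "C = ppower (u, take d cs) m" by (simp add: ppower_def)
    moreover have "is_cycle G (u, take d cs)"
    proof -
      have "take d cs \<noteq> []" using d(1) ne by simp
      moreover have "successively N (take d cs)"
        using cs(2) successively_append_iff[of N "take d cs" "drop d cs"] by simp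
      ultimately have "(u, take d cs) \<in> npaths"
        using u cs(1) d(1) ne set_take_subset[of d cs] by (simp add: npaths_iff hd_take)
      \<comment> \<open>The arrow following the first \<open>d\<close> ones is
        \<open>s d = s 0\<close>, so this prefix returns to \<open>u\<close>.\<close>
      moreover have "head G (last (take d cs)) = u"
      proof -
        have "last (take d cs) = s (d - 1)"
          using d(1) dn ne by (simp add: last_conv_nth s_def)
        moreover have "N (s (d - 1)) (s d)" using step[of "d - 1"] d(1) by simp
        moreover have "s 0 = hd cs" using ne by (simp add: s_def hd_conv_nth)
        ultimately show ?thesis using N_arcs d(2) u by metis
      qed
      ultimately show ?thesis
        using \<open>take d cs \<noteq> []\<close> npathsD
        by (simp add: is_cycle_def plength_def psource_def ptarget_conv)
    qed
    ultimately show False using C m2 by (auto simp: primitive_cycle_def)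
  qed
  then show "C \<in> {(tail G (hd cs), cs) | cs. cyclic_chain cs}"
    using u cs ne by (auto simp: cyclic_chain_def)
qed

lemma same_circuit_rotate:
  "same_circuit G (tail G (hd (xs @ a # ys)), xs @ a # ys) (tail G a, a # ys @ xs)"
proof -
  have "(rot G ^^ length (a # ys)) (tail G (hd (xs @ a # ys)), xs @ a # ys) = (tail G a, a # ys @ xs)"
    using funpow_rot[of "xs @ a # ys" "tail G (hd (xs @ a # ys))" G "length (a # ys)"]
      funpow_rotl_append[of "a # ys" xs] by (simp del: funpow.simps)
  then show ?thesis unfolding same_circuit_def by metis
qed

context
  fixes X
  assumes X: "circuit_representatives G {C. primitive_cycle G C \<and> ppower C 2 \<in> npaths} X"
begin

lemma representative_cyclic:
  "x \<in> X \<Longrightarrow> cyclic_chain (snd x)" "x \<in> X \<Longrightarrow> fst x = tail G (hd (snd x))"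
  using X unfolding circuit_representatives_def primitive_npath_cycles by auto

text \<open>Rotating both cycles until \<open>a\<close> comes first yields the same list by
  \<open>cyclic_chain_unique\<close>; \<open>x\<close> and \<open>y\<close> both represent its
  circuit, and representatives are unique.\<close>

lemma representative_eqI:
  assumes "x \<in> X" "y \<in> X" "a \<in> set (snd x)" "a \<in> set (snd y)"
  shows "x = y"
proof -
  obtain xs ys where x: "snd x = xs @ a # ys" using assms(3) by (meson split_list)
  let ?Y = "{C. primitive_cycle G C \<and> ppower C 2 \<in> npaths}"
  have "same_circuit G (tail G a, a # ys @ xs) z" if z: "z \<in> X" "a \<in> set (snd z)" for z
  proof -
    obtain zs ws where zw: "snd z = zs @ a # ws" using z(2) by (meson split_list)
    have "a # ys @ xs = a # ws @ zs"
      by (rule cyclic_chain_unique)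
         (use cyclic_chain_rotate representative_cyclic(1)[OF assms(1)] representative_cyclic(1)[OF z(1)]
          in \<open>simp_all add: x zw\<close>)
    \<comment> \<open>Uniqueness of representatives is about rotations leading to \<open>z\<close>,
      so the suffix \<open>zs\<close> is rotated back to the front.\<close>
    moreover have "same_circuit G (tail G a, a # ws @ zs) z"
    proof (cases zs)
      case Nil
      then show ?thesis using zw representative_cyclic(2)[OF z(1)]
        by (auto simp: same_circuit_def prod_eq_iff intro!: exI[of _ 0])
    next
      case (Cons b zs')
      then show ?thesis
        using same_circuit_rotate[of "a # ws" b zs'] zw representative_cyclic(2)[OF z(1)]
        by (metis append_Cons append.assoc hd_append2 list.sel(1) prod.collapse append_Nil)
    qed
    ultimately show ?thesis by simp
  qed
  moreover have "(tail G a, a # ys @ xs) \<in> ?Y"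
    unfolding primitive_npath_cycles
    using cyclic_chain_rotate representative_cyclic(1)[OF assms(1)] x by auto
  ultimately show ?thesis
    using X assms unfolding circuit_representatives_def by blast
qed

lemma representative_cover:
  assumes "cyclic_chain cs" "a \<in> set cs"
  obtains x where "x \<in> X" "a \<in> set (snd x)"
proof -
  have "(tail G (hd cs), cs) \<in> {C. primitive_cycle G C \<and> ppower C 2 \<in> npaths}"
    unfolding primitive_npath_cycles using assms(1) by auto
  then obtain x where x: "x \<in> X" "same_circuit G (tail G (hd cs), cs) x"
    using X unfolding circuit_representatives_def by blast
  have "cs \<noteq> []" using assms(1) by (simp add: cyclic_chain_def)
  then have "set (snd x) = set cs"
    using x(2) by (auto simp: same_circuit_def funpow_rot)
  then show thesis using that x(1) assms(2) by simp
qed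

end

end

section \<open>Ends of the edges of the ribbon graph\<close>

text \<open>
  The black side following the end \<open>e\<close> corresponds to the arrow \<open>out_arrow e\<close>, or is the marked
  side of its polygon if \<open>out_arrow e = None\<close>.
\<close>

fun out_arrow :: "('v, 'a) rvertex \<times> nat \<Rightarrow> 'a option" where
  "out_arrow (Finite_Path p, i) = (if i < length (snd p) then Some (snd p ! i) else None)"
| "out_arrow (Infinite_Path C, i) = Some (snd C ! i)"

fun succ_end :: "('v, 'a) pre_digraph \<Rightarrow> ('v, 'a) rvertex \<times> nat \<Rightarrow> ('v, 'a) rvertex \<times> nat" where
  "succ_end Q (q, i) = (q, Suc i mod valency Q q)"

fun pred_end :: "('v, 'a) pre_digraph \<Rightarrow> ('v, 'a) rvertex \<times> nat \<Rightarrow> ('v, 'a) rvertex \<times> nat" where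
  "pred_end Q (q, i) = (q, if i = 0 then valency Q q - 1 else i - 1)"

definition edge_at :: "('v, 'a) pre_digraph \<Rightarrow> ('v, 'a) rvertex \<times> nat \<Rightarrow> 'v" where
  "edge_at Q e = visits Q (fst e) ! snd e"

text \<open>The last passage: the black side after it closes the cyclic order and is therefore the
  marked one.\<close>

definition last_end :: "('v, 'a) qpath \<Rightarrow> ('v, 'a) rvertex \<times> nat" where
  "last_end p = (Finite_Path p, length (snd p))"

lemma valency_simps [simp]:
  "valency Q (Finite_Path p) = Suc (length (snd p))"
  "valency Q (Infinite_Path C) = length (snd C)"
  by (simp_all add: valency_def pre_digraph.length_awalk_verts)

lemma inj_last_end: "inj last_end"
  by (auto simp: last_end_def inj_def)

lemma finite_card_le_2:
  assumes "\<And>a. a \<in> A \<Longrightarrow> f a \<in> X" "finite X" "card X \<le> 2" "inj_on f A"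
  shows "finite A" "card A \<le> 2"
  using assms by (meson finite_imageD finite_subset image_subset_iff)
    (meson assms card_inj_on_le image_subset_iff le_trans)

section \<open>The two partial injections of a gentle presentation\<close>

locale gentle_surface = fin_digraph Q
  for Q :: "('v, 'a) pre_digraph" +
  fixes I :: "(('v, 'a) qpath \<Rightarrow>\<^sub>0 'k::field) set"
    and CC DD :: "('v, 'a) qpath set"
  assumes connected: "Digraph_Component.connected Q"
    and arcs_nonempty: "arcs Q \<noteq> {}"
    and gentle: "gentle_presentation Q I"
    and CC: "circuit_representatives Q (prim_cocomplete_cycles Q I) CC"
    and DD: "circuit_representatives Q (prim_complete_cycles Q I) DD"
begin

text \<open>Arguments are in order of traversal: first \<open>a\<close>, then \<open>b\<close>, so
  the composite written from right to left is \<open>b a\<close>.\<close>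

definition nB :: "'a \<Rightarrow> 'a \<Rightarrow> bool" where
  "nB a b \<longleftrightarrow> a \<in> arcs Q \<and> b \<in> arcs Q \<and> head Q a = tail Q b \<and> basis (two_path Q b a) \<notin> I"

definition nG :: "'a \<Rightarrow> 'a \<Rightarrow> bool" where
  "nG a b \<longleftrightarrow> a \<in> arcs Q \<and> b \<in> arcs Q \<and> head Q a = tail Q b \<and> basis (two_path Q b a) \<in> I"

lemma gentle_arc:
  assumes "a \<in> arcs Q"
  shows "\<exists>\<^sub>\<le>\<^sub>1 b. b \<in> arcs Q \<and> head Q b = tail Q a \<and> basis (two_path Q a b) \<notin> I"
    and "\<exists>\<^sub>\<le>\<^sub>1 c. c \<in> arcs Q \<and> head Q a = tail Q c \<and> basis (two_path Q c a) \<notin> I"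
    and "\<exists>\<^sub>\<le>\<^sub>1 b. b \<in> arcs Q \<and> head Q b = tail Q a \<and> basis (two_path Q a b) \<in> I"
    and "\<exists>\<^sub>\<le>\<^sub>1 c. c \<in> arcs Q \<and> head Q a = tail Q c \<and> basis (two_path Q c a) \<in> I"
  using gentle assms by (simp_all add: gentle_presentation_def)

sublocale B: chain_relation Q nB
proof
  show "nB a b \<Longrightarrow> a \<in> arcs Q \<and> b \<in> arcs Q \<and> head Q a = tail Q b" for a b
    by (simp add: nB_def)
  show "b = c" if "nB a b" "nB a c" for a b c
    using that by (intro Uniq_D[OF gentle_arc(2)[of a]]) (auto simp: nB_def)
  show "a = b" if "nB a c" "nB b c" for a b c
    using that by (intro Uniq_D[OF gentle_arc(1)[of c]]) (auto simp: nB_def)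
qed

sublocale \<Gamma>: chain_relation Q nG
proof
  show "nG a b \<Longrightarrow> a \<in> arcs Q \<and> b \<in> arcs Q \<and> head Q a = tail Q b" for a b
    by (simp add: nG_def)
  show "b = c" if "nG a b" "nG a c" for a b c
    using that by (intro Uniq_D[OF gentle_arc(4)[of a]]) (auto simp: nG_def)
  show "a = b" if "nG a c" "nG b c" for a b c
    using that by (intro Uniq_D[OF gentle_arc(3)[of c]]) (auto simp: nG_def)
qed

text \<open>The inequality of truth values is an exclusive or. This dichotomy decides whether two
  arrows meeting at a vertex lie consecutively on one nonzero path or face each other across the
  glued edge.\<close>

lemma nB_or_nG: "a \<in> arcs Q \<Longrightarrow> b \<in> arcs Q \<Longrightarrow> head Q a = tail Q b \<Longrightarrow> nB a b \<noteq> nG a b"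
  by (auto simp: nB_def nG_def)

lemma length_two_qpath_iff:
  "r \<in> qpaths Q \<and> plength r = 2 \<longleftrightarrow>
     (\<exists>a b. a \<in> arcs Q \<and> b \<in> arcs Q \<and> head Q a = tail Q b \<and> r = (tail Q a, [a, b]))"
  by (cases r) (auto simp: plength_def numeral_2_eq_2 length_Suc_conv qpaths_Cons_iff)

lemma two_path_eq: "two_path Q b a = (tail Q a, [a, b])"
  by (simp add: two_path_def pcomp_def arrow_def)

lemma length_two_subpath_iff:
  assumes "p \<in> qpaths Q"
  shows "subpath Q (tail Q a, [a, b]) p \<longleftrightarrow> (\<exists>xs ys. snd p = xs @ a # b # ys)"
proof -
  obtain u cs where p: "p = (u, cs)" by force
  have "(tail Q a, [a, b]) \<in> qpaths Q \<and> tail Q a = ptarget Q (u, xs)" if "cs = xs @ a # b # ys" for xs ys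
    using assms that unfolding p
    by (auto simp: qpaths_Cons_iff successively_append_iff successively_Cons ptarget_conv hd_append
             split: if_splits)
  then show ?thesis
    using assms unfolding p by (subst subpath_Pair_iff[OF wf_digraph_axioms]) auto
qed

text \<open>Paths in \<open>R\<close> have length two, so avoiding them is a condition on
  consecutive arrows.\<close>

lemma Bset_eq: "Bset Q I = B.npaths"
proof (intro equalityI subsetI)
  fix p assume p: "p \<in> Bset Q I"
  then have q: "p \<in> qpaths Q" by (simp add: Bset_def)
  have "nB a b" if "snd p = xs @ a # b # ys" for xs a b ys
  proof -
    have "subpath Q (tail Q a, [a, b]) p"
      using that length_two_subpath_iff[OF q] by blast
    then have "(tail Q a, [a, b]) \<in> qpaths Q" "(tail Q a, [a, b]) \<notin> Rset Q I"
      using p by (auto simp: Bset_def subpath_def)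
    then show ?thesis
      by (auto simp: Rset_def nB_def two_path_eq plength_def qpaths_Cons_iff)
  qed
  then show "p \<in> B.npaths"
    using q by (auto simp: B.npaths_def successively_conv_split)
next
  fix p assume p: "p \<in> B.npaths"
  then have q: "p \<in> qpaths Q" by (simp add: B.npaths_def)
  have False if "r \<in> Rset Q I" "subpath Q r p" for r
  proof -
    obtain a b where r: "r = (tail Q a, [a, b])"
      using \<open>r \<in> Rset Q I\<close> length_two_qpath_iff[of r] unfolding Rset_def by blast
    then obtain xs ys where "snd p = xs @ a # b # ys"
      using \<open>subpath Q r p\<close> length_two_subpath_iff[OF q] by blast
    then have "nB a b"
      using p by (auto simp: B.npaths_def successively_conv_split)
    then show False
      using that(1) by (simp add: Rset_def nB_def two_path_eq r)
  qed
  then show "p \<in> Bset Q I" using q by (auto simp: Bset_def)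
qed

lemma Gamma_set_eq: "Gamma_set Q I = \<Gamma>.npaths"
proof (intro equalityI subsetI)
  fix p assume p: "p \<in> Gamma_set Q I"
  then have q: "p \<in> qpaths Q" by (simp add: Gamma_set_def)
  have "nG a b" if "snd p = xs @ a # b # ys" for xs a b ys
  proof -
    have "subpath Q (tail Q a, [a, b]) p"
      using that length_two_subpath_iff[OF q] by blast
    then have "(tail Q a, [a, b]) \<in> Rset Q I"
      using p by (auto simp: Gamma_set_def plength_def)
    then show ?thesis
      by (auto simp: Rset_def nG_def two_path_eq plength_def qpaths_Cons_iff)
  qed
  then show "p \<in> \<Gamma>.npaths"
    using q by (auto simp: \<Gamma>.npaths_def successively_conv_split)
next
  fix p assume p: "p \<in> \<Gamma>.npaths"
  then have q: "p \<in> qpaths Q" by (simp add: \<Gamma>.npaths_def)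
  have "r \<in> Rset Q I" if "subpath Q r p" "plength r = 2" for r
  proof -
    have rq: "r \<in> qpaths Q" using that(1) by (simp add: subpath_def)
    then obtain a b where r: "r = (tail Q a, [a, b])"
      using \<open>plength r = 2\<close> length_two_qpath_iff[of r] by auto
    then obtain xs ys where "snd p = xs @ a # b # ys"
      using \<open>subpath Q r p\<close> length_two_subpath_iff[OF q] by blast
    then have "nG a b"
      using p by (auto simp: \<Gamma>.npaths_def successively_conv_split)
    then show ?thesis
      using \<open>plength r = 2\<close> rq by (simp add: Rset_def nG_def two_path_eq r)
  qed
  then show "p \<in> Gamma_set Q I" using q by (auto simp: Gamma_set_def)
qed

text \<open>If the tail of some arrow differs from \<open>v\<close>, connectedness gives an
  undirected walk from \<open>v\<close> to it, and the first step of this walk is an arrow at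
  \<open>v\<close>.\<close>

lemma incident_arc:
  assumes "v \<in> verts Q"
  shows "\<exists>a \<in> arcs Q. tail Q a = v \<or> head Q a = v"
proof -
  obtain a where a: "a \<in> arcs Q" using arcs_nonempty by blast
  show ?thesis
  proof (cases "tail Q a = v")
    case False
    have "v \<rightarrow>\<^sup>*\<^bsub>with_proj (mk_symmetric Q)\<^esub> tail Q a"
      using connected assms a by (simp add: Digraph_Component.connected_def strongly_connected_def)
    then have "(v, tail Q a) \<in> (arcs_ends (with_proj (mk_symmetric Q)))\<^sup>*"
      by (simp add: reachable_def rtrancl_on_rtranclI)
    then obtain w where "(v, w) \<in> arcs_ends (with_proj (mk_symmetric Q))"
      using False by (metis converse_rtranclE)
    then show ?thesis
      by (auto simp: mk_symmetric_def arcs_ends_conv)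
  qed (use a in blast)
qed

lemma CC': "circuit_representatives Q {C. primitive_cycle Q C \<and> ppower C 2 \<in> B.npaths} CC"
  using CC by (simp add: prim_cocomplete_cycles_def Bset_eq)

lemma DD': "circuit_representatives Q {C. primitive_cycle Q C \<and> ppower C 2 \<in> \<Gamma>.npaths} DD"
  using DD by (simp add: prim_complete_cycles_def Gamma_set_eq)

lemma fst_in_verts: "p \<in> qpaths Q \<Longrightarrow> fst p \<in> verts Q"
  by (cases p) (auto simp: qpaths_def awalk_def)

text \<open>Each vertex meets an arrow, so no trivial path is maximal and the description by chains
  is complete.\<close>

lemma maximal_in_B_iff:
  "maximal_in Q (Bset Q I) p \<longleftrightarrow> B.maximal_chain (snd p) \<and> fst p = tail Q (hd (snd p))"
proof
  assume p: "maximal_in Q (Bset Q I) p"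
  then have "fst p \<in> verts Q"
    using fst_in_verts by (auto simp: maximal_in_def Bset_def)
  then show "B.maximal_chain (snd p) \<and> fst p = tail Q (hd (snd p))"
    using B.maximal_in_npathsE[of p] incident_arc p unfolding Bset_eq by metis
next
  assume "B.maximal_chain (snd p) \<and> fst p = tail Q (hd (snd p))"
  then show "maximal_in Q (Bset Q I) p"
    unfolding Bset_eq using B.maximal_in_npaths_iff[of "snd p" "fst p", unfolded prod.collapse]
    by (simp add: B.maximal_chain_def)
qed

lemma maximal_in_Gamma_iff:
  "maximal_in Q (Gamma_set Q I) p \<longleftrightarrow> \<Gamma>.maximal_chain (snd p) \<and> fst p = tail Q (hd (snd p))"
proof
  assume p: "maximal_in Q (Gamma_set Q I) p"
  then have "fst p \<in> verts Q"
    using fst_in_verts by (auto simp: maximal_in_def Gamma_set_def)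
  then show "\<Gamma>.maximal_chain (snd p) \<and> fst p = tail Q (hd (snd p))"
    using \<Gamma>.maximal_in_npathsE[of p] incident_arc p unfolding Gamma_set_eq by metis
next
  assume "\<Gamma>.maximal_chain (snd p) \<and> fst p = tail Q (hd (snd p))"
  then show "maximal_in Q (Gamma_set Q I) p"
    unfolding Gamma_set_eq using \<Gamma>.maximal_in_npaths_iff[of "snd p" "fst p", unfolded prod.collapse]
    by (simp add: \<Gamma>.maximal_chain_def)
qed

section \<open>Ends of edges and the arrows leaving them\<close>

abbreviation Mx :: "('v, 'a) rvertex set" where
  "Mx \<equiv> maximal_nonzero_paths Q I CC"

abbreviation W :: "('v, 'a) rvertex set" where
  "W \<equiv> rvertices Q I CC"

text \<open>The half-edges of the ribbon graph; an end also serves as the index of the black side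
  that follows it.\<close>

definition ends :: "(('v, 'a) rvertex \<times> nat) set" where
  "ends = {(q, i). q \<in> W \<and> i < valency Q q}"

lemma Finite_in_Mx:
  "Finite_Path p \<in> Mx \<longleftrightarrow> B.maximal_chain (snd p) \<and> fst p = tail Q (hd (snd p))"
  by (auto simp: maximal_nonzero_paths_def maximal_in_B_iff)

lemma Infinite_in_Mx: "Infinite_Path C \<in> Mx \<longleftrightarrow> C \<in> CC"
  by (auto simp: maximal_nonzero_paths_def)

lemma Infinite_in_W: "Infinite_Path C \<in> W \<longleftrightarrow> C \<in> CC"
  by (auto simp: rvertices_def Infinite_in_Mx)

lemma Finite_in_W:
  "Finite_Path p \<in> W \<longleftrightarrow> Finite_Path p \<in> Mx \<or>
     (\<exists>v \<in> verts Q. p = triv v \<and> card (passages Q Mx v) = 1)"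
  by (auto simp: rvertices_def)

lemma Mx_subset_W: "q \<in> Mx \<Longrightarrow> q \<in> W"
  by (simp add: rvertices_def)

lemma visits_nontrivial:
  assumes "snd p \<noteq> []"
  shows "visits Q (Finite_Path p) = map (tail Q) (snd p) @ [head Q (last (snd p))]"
  using assms by (simp add: awalk_verts_conv)

lemma edge_at_pos:
  assumes "(Finite_Path p, i) \<in> ends" "i < length (snd p)"
  shows "snd p ! i \<in> arcs Q" "edge_at Q (Finite_Path p, i) = tail Q (snd p ! i)"
    "edge_at Q (Finite_Path p, Suc i) = head Q (snd p ! i)"
    "Suc i < length (snd p) \<Longrightarrow> nB (snd p ! i) (snd p ! Suc i)"
proof -
  have mx: "B.maximal_chain (snd p)"
    using assms by (auto simp: ends_def Finite_in_W Finite_in_Mx triv_def)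
  show 1: "snd p ! i \<in> arcs Q"
    using mx nth_mem[OF assms(2)] by (auto simp: B.maximal_chain_def)
  have ne: "snd p \<noteq> []" using assms(2) by auto
  show "edge_at Q (Finite_Path p, i) = tail Q (snd p ! i)"
    using assms(2) by (simp add: edge_at_def visits_nontrivial[OF ne] nth_append del: visits.simps)
  show n: "nB (snd p ! i) (snd p ! Suc i)" if "Suc i < length (snd p)"
    using mx that by (auto simp: B.maximal_chain_def intro: successively_nthD)
  show "edge_at Q (Finite_Path p, Suc i) = head Q (snd p ! i)"
  proof (cases "Suc i < length (snd p)")
    case True
    then show ?thesis
      using n[OF True]
      by (simp add: edge_at_def visits_nontrivial[OF ne] nth_append nB_def del: visits.simps)
  next
    case False
    then have "Suc i = length (snd p)" using assms(2) by simp
    moreover from this have "i = length (snd p) - 1" by simp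
    ultimately show ?thesis
      using ne by (simp add: edge_at_def visits_nontrivial[OF ne] nth_append last_conv_nth del: visits.simps)
  qed
qed

lemma edge_at_circuit:
  assumes "(Infinite_Path C, i) \<in> ends"
  shows "snd C ! i \<in> arcs Q" "edge_at Q (Infinite_Path C, i) = tail Q (snd C ! i)"
    "nB (snd C ! i) (snd C ! (Suc i mod length (snd C)))"
proof -
  have c: "B.cyclic_chain (snd C)" and i: "i < length (snd C)"
    using assms B.representative_cyclic[OF CC'] by (auto simp: ends_def Infinite_in_W)
  then show "nB (snd C ! i) (snd C ! (Suc i mod length (snd C)))"
    by (rule B.cyclic_chain_nth)
  show "snd C ! i \<in> arcs Q" "edge_at Q (Infinite_Path C, i) = tail Q (snd C ! i)"
    using c i by (auto simp: B.cyclic_chain_def edge_at_def)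
qed

lemma succ_end_in [simp]: "e \<in> ends \<Longrightarrow> succ_end Q e \<in> ends"
  and pred_end_in [simp]: "e \<in> ends \<Longrightarrow> pred_end Q e \<in> ends"
  and pred_succ_end [simp]: "e \<in> ends \<Longrightarrow> pred_end Q (succ_end Q e) = e"
  and succ_pred_end [simp]: "e \<in> ends \<Longrightarrow> succ_end Q (pred_end Q e) = e"
  by (cases e; force simp: ends_def mod_Suc)+

lemma fst_succ_end [simp]: "fst (succ_end Q e) = fst e"
  by (cases e) simp

lemma out_arrow_Some:
  assumes "e \<in> ends" "out_arrow e = Some a"
  shows "a \<in> arcs Q" "tail Q a = edge_at Q e" "head Q a = edge_at Q (succ_end Q e)"
    "out_arrow (succ_end Q e) = Some c \<Longrightarrow> nB a c"
proof -
  obtain q i where e: "e = (q, i)" by force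
  have "a \<in> arcs Q \<and> tail Q a = edge_at Q e \<and> head Q a = edge_at Q (succ_end Q e)
     \<and> (out_arrow (succ_end Q e) = Some c \<longrightarrow> nB a c)"
  proof (cases q)
    case (Finite_Path p)
    then have "i < length (snd p)" "a = snd p ! i"
      using assms by (auto simp: e split: if_splits)
    then show ?thesis
      using edge_at_pos[of p i] assms(1) by (auto simp: e Finite_Path)
  next
    case (Infinite_Path C)
    then show ?thesis
      using edge_at_circuit[of C i] edge_at_circuit(2)[of C "Suc i mod length (snd C)"]
        succ_end_in[OF assms(1)] assms
      by (auto simp: e nB_def)
  qed
  then show "a \<in> arcs Q" "tail Q a = edge_at Q e" "head Q a = edge_at Q (succ_end Q e)"
    "out_arrow (succ_end Q e) = Some c \<Longrightarrow> nB a c" by auto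
qed

text \<open>A nonzero continuation of \<open>a\<close> stays on the path through \<open>e\<close>: a
  maximal path cannot stop after \<open>a\<close>, and the arrow that follows is unique.\<close>

lemma out_arrow_succ:
  assumes "e \<in> ends" "out_arrow e = Some a" "nB a c"
  shows "out_arrow (succ_end Q e) = Some c"
proof -
  obtain q i where e: "e = (q, i)" by force
  show ?thesis
  proof (cases q)
    case (Finite_Path p)
    then have i: "i < length (snd p)" "a = snd p ! i"
      using assms by (auto simp: e split: if_splits)
    have mx: "B.maximal_chain (snd p)"
      using assms(1) i by (auto simp: ends_def Finite_in_W Finite_in_Mx triv_def e Finite_Path)
    have "Suc i < length (snd p)"
    proof (rule ccontr)
      assume "\<not> Suc i < length (snd p)"
      then have "i = length (snd p) - 1" using i by simp
      then have "a = last (snd p)" using i by (metis last_conv_nth length_0_conv less_nat_zero_code)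
      then show False using mx assms(3) by (simp add: B.maximal_chain_def)
    qed
    then show ?thesis
      using edge_at_pos(4)[of p i] assms i B.N_fun by (auto simp: e Finite_Path)
  next
    case (Infinite_Path C)
    then show ?thesis
      using edge_at_circuit(3)[of C i] assms B.N_fun by (auto simp: e)
  qed
qed

text \<open>A partial injection puts each arrow at one place of one line or of one cycle, and
  \<open>CC\<close> contains each cycle only once up to rotation.\<close>

lemma out_arrow_inj:
  assumes "e \<in> ends" "e' \<in> ends" "out_arrow e = Some a" "out_arrow e' = Some a"
  shows "e = e'"
proof -
  have F: "i < length (snd p)" "snd p ! i = a" "B.maximal_chain (snd p)" "fst p = tail Q (hd (snd p))"
    if "(Finite_Path p, i) \<in> ends" "out_arrow (Finite_Path p, i) = Some a" for p i
    using that by (auto simp: ends_def Finite_in_W Finite_in_Mx triv_def split: if_splits)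
  have C: "i < length (snd C)" "snd C ! i = a" "C \<in> CC" "B.cyclic_chain (snd C)"
    if "(Infinite_Path C, i) \<in> ends" "out_arrow (Infinite_Path C, i) = Some a" for C i
    using that B.representative_cyclic[OF CC'] by (auto simp: ends_def Infinite_in_W)
  have FC: False if "(Finite_Path p, i) \<in> ends" "out_arrow (Finite_Path p, i) = Some a"
      "(Infinite_Path C, j) \<in> ends" "out_arrow (Infinite_Path C, j) = Some a" for p i C j
  proof -
    have "a \<in> set (snd p)" "a \<in> set (snd C)"
      using F(1,2)[OF that(1,2)] C(1,2)[OF that(3,4)] by (metis nth_mem)+
    then show False
      using B.maximal_cyclic_disjoint[OF F(3)[OF that(1,2)] C(4)[OF that(3,4)]] by blast
  qed
  obtain q i q' i' where e: "e = (q, i)" "e' = (q', i')" by force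
  show ?thesis
  proof (cases q; cases q')
    fix p p' assume *: "q = Finite_Path p" "q' = Finite_Path p'"
    note f = F[OF assms(1,3)[unfolded e *]] F[OF assms(2,4)[unfolded e *]]
    then show ?thesis
      using B.maximal_chain_unique[OF f(3,7,1,5)] by (simp add: e * prod_eq_iff)
  next
    fix C C' assume *: "q = Infinite_Path C" "q' = Infinite_Path C'"
    note c = C[OF assms(1,3)[unfolded e *]] C[OF assms(2,4)[unfolded e *]]
    have "a \<in> set (snd C)" "a \<in> set (snd C')"
      using c by (metis nth_mem)+
    then have "C = C'"
      using B.representative_eqI[OF CC' c(3,7)] by blast
    then show ?thesis
      using c nth_eq_iff_index_eq[of "snd C" i i'] by (simp add: e * B.cyclic_chain_def)
  qed (use FC assms e in blast)+
qed

lemma out_arrow_surj: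
  assumes "a \<in> arcs Q"
  obtains e where "e \<in> ends" "fst e \<in> Mx" "out_arrow e = Some a"
  using assms
proof (cases rule: B.chain_cover)
  case (maximal cs)
  then obtain i where "i < length cs" "cs ! i = a" by (auto simp: in_set_conv_nth)
  moreover have "Finite_Path (tail Q (hd cs), cs) \<in> Mx"
    using maximal by (simp add: Finite_in_Mx)
  ultimately show thesis
    using that[of "(Finite_Path (tail Q (hd cs), cs), i)"] Mx_subset_W by (simp add: ends_def)
next
  case (cyclic cs)
  then obtain C where C: "C \<in> CC" "a \<in> set (snd C)"
    using B.representative_cover[OF CC'] by blast
  then obtain i where "i < length (snd C)" "snd C ! i = a" by (auto simp: in_set_conv_nth)
  then show thesis
    using that[of "(Infinite_Path C, i)"] C Mx_subset_W by (simp add: ends_def Infinite_in_Mx)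
qed

lemma out_arrow_None_iff:
  "e \<in> ends \<Longrightarrow> out_arrow e = None \<longleftrightarrow> (\<exists>p. e = last_end p)"
  by (cases e rule: out_arrow.cases) (auto simp: last_end_def ends_def)

lemma last_end_in: "last_end p \<in> ends \<longleftrightarrow> Finite_Path p \<in> W"
  by (auto simp: last_end_def ends_def)

lemma out_arrow_last_end [simp]: "out_arrow (last_end p) = None"
  by (simp add: last_end_def)

lemma succ_last_end: "succ_end Q (last_end p) = (Finite_Path p, 0)"
  by (simp add: last_end_def)

lemma edge_at_last_end: "edge_at Q (last_end p) = ptarget Q p"
  by (cases p) (auto simp: last_end_def edge_at_def ptarget_conv awalk_verts_conv nth_append)

lemma Finite_in_W_Bset:
  assumes "Finite_Path p \<in> W"
  shows "p \<in> Bset Q I"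
proof -
  consider "B.maximal_chain (snd p)" "fst p = tail Q (hd (snd p))" | v where "v \<in> verts Q" "p = triv v"
    using assms by (auto simp: Finite_in_W Finite_in_Mx)
  then show ?thesis
  proof cases
    case 1
    then show ?thesis
      using B.npaths_iff[of "snd p" "fst p", unfolded prod.collapse]
      by (simp add: Bset_eq B.maximal_chain_def)
  next
    case 2
    then show ?thesis by (simp add: Bset_eq triv_def B.npaths_Nil_iff)
  qed
qed

lemma Finite_in_W_qpath: "Finite_Path p \<in> W \<Longrightarrow> p \<in> qpaths Q"
  using Finite_in_W_Bset by (auto simp: Bset_def)

lemma edge_at_first_end: "Finite_Path p \<in> W \<Longrightarrow> edge_at Q (Finite_Path p, 0) = psource p"
  by (cases p; cases "snd p")
     (auto simp: edge_at_def psource_def Finite_in_W Finite_in_Mx triv_def)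

lemma edge_at_in_verts:
  assumes "e \<in> ends"
  shows "edge_at Q e \<in> verts Q"
proof (cases "out_arrow e")
  case None
  then obtain p where "e = last_end p" using out_arrow_None_iff assms by blast
  then show ?thesis
    using assms Finite_in_W_qpath ptarget_in_verts by (simp add: edge_at_last_end last_end_in)
next
  case (Some a)
  then show ?thesis using out_arrow_Some[OF assms Some] by (metis tail_in_verts)
qed

section \<open>Every edge has exactly two ends\<close>

lemma passages_eq: "V \<subseteq> W \<Longrightarrow> passages Q V v = {e \<in> ends. fst e \<in> V \<and> edge_at Q e = v}"
  by (auto simp: passages_def ends_def edge_at_def)

text \<open>Maximal nonzero paths have positive length, so their last vertex is entered by an arrow.
  This is where the trivial paths of type (2) differ.\<close>

lemma adjacent_arrow:
  assumes "e \<in> ends" "fst e \<in> Mx" "out_arrow e = None"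
  obtains a where "out_arrow (pred_end Q e) = Some a" "head Q a = edge_at Q e" "a \<in> arcs Q"
proof -
  obtain p where p: "e = last_end p" using out_arrow_None_iff assms by blast
  then have "snd p \<noteq> []"
    using assms(2) by (auto simp: last_end_def Finite_in_Mx B.maximal_chain_def)
  then have "out_arrow (pred_end Q e) = Some (last (snd p))"
    by (simp add: p last_end_def last_conv_nth)
  then show thesis
    using that out_arrow_Some[of "pred_end Q e"] assms(1) by simp
qed

text \<open>If every passage through \<open>v\<close> leaves by an arrow, or every one enters by an
  arrow, the passages inject into a set of at most two arrows. Otherwise some passage ends at
  \<open>v\<close> after an arrow \<open>a\<close> and another starts at \<open>v\<close> with an
  arrow \<open>c\<close>; then \<open>c a\<close> lies in I, and a third passage would provide a
  second relation with \<open>a\<close> or with \<open>c\<close>.\<close>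

lemma passages_Mx:
  assumes "v \<in> verts Q"
  shows "passages Q Mx v \<noteq> {}" "finite (passages Q Mx v)" "card (passages Q Mx v) \<le> 2"
proof -
  have Mx: "passages Q Mx v = {e \<in> ends. fst e \<in> Mx \<and> edge_at Q e = v}" (is "_ = ?P")
    by (rule passages_eq) (auto intro: Mx_subset_W)
  obtain a where a: "a \<in> arcs Q" "tail Q a = v \<or> head Q a = v"
    using incident_arc[OF assms] by blast
  obtain e where e: "e \<in> ends" "fst e \<in> Mx" "out_arrow e = Some a"
    using out_arrow_surj[OF a(1)] by blast
  then have "e \<in> ?P \<or> succ_end Q e \<in> ?P"
    using a(2) out_arrow_Some[OF e(1,3)] by auto
  then show "passages Q Mx v \<noteq> {}" unfolding Mx by blast
  have "finite ?P \<and> card ?P \<le> 2"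
  proof (cases "(\<forall>e\<in>?P. out_arrow e \<noteq> None) \<or> (\<forall>e\<in>?P. out_arrow (pred_end Q e) \<noteq> None)")
    case True
    then show ?thesis
    proof
      assume A: "\<forall>e\<in>?P. out_arrow e \<noteq> None"
      have "the (out_arrow e) \<in> {a \<in> arcs Q. tail Q a = v}" if "e \<in> ?P" for e
      proof -
        obtain a where "out_arrow e = Some a" using A \<open>e \<in> ?P\<close> by blast
        then show ?thesis using out_arrow_Some(1,2)[of e a] that by auto
      qed
      moreover have "inj_on (\<lambda>e. the (out_arrow e)) ?P"
      proof (rule inj_onI)
        fix e e' assume *: "e \<in> ?P" "e' \<in> ?P" "the (out_arrow e) = the (out_arrow e')"
        then have "out_arrow e \<noteq> None" "out_arrow e' \<noteq> None"
          using A by blast+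
        then obtain a where "out_arrow e = Some a" "out_arrow e' = Some a"
          using *(3) by auto
        then show "e = e'" using * out_arrow_inj by blast
      qed
      ultimately show ?thesis
        using finite_card_le_2[of ?P "\<lambda>e. the (out_arrow e)" "{a \<in> arcs Q. tail Q a = v}"] gentle assms
        by (auto simp: gentle_presentation_def)
    next
      assume A: "\<forall>e\<in>?P. out_arrow (pred_end Q e) \<noteq> None"
      have "the (out_arrow (pred_end Q e)) \<in> {a \<in> arcs Q. head Q a = v}" if "e \<in> ?P" for e
      proof -
        obtain a where "out_arrow (pred_end Q e) = Some a" using A \<open>e \<in> ?P\<close> by blast
        then show ?thesis using out_arrow_Some(1,3)[of "pred_end Q e" a] that by auto
      qed
      moreover have "inj_on (\<lambda>e. the (out_arrow (pred_end Q e))) ?P"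
      proof (rule inj_onI)
        fix e e' assume *: "e \<in> ?P" "e' \<in> ?P"
          "the (out_arrow (pred_end Q e)) = the (out_arrow (pred_end Q e'))"
        then have "out_arrow (pred_end Q e) \<noteq> None" "out_arrow (pred_end Q e') \<noteq> None"
          using A by blast+
        then obtain a where "out_arrow (pred_end Q e) = Some a" "out_arrow (pred_end Q e') = Some a"
          using *(3) by auto
        then have "pred_end Q e = pred_end Q e'"
          using * out_arrow_inj[of "pred_end Q e" "pred_end Q e'"] by auto
        then show "e = e'" using * succ_pred_end by (metis (mono_tags, lifting) mem_Collect_eq)
      qed
      ultimately show ?thesis
        using finite_card_le_2[of ?P "\<lambda>e. the (out_arrow (pred_end Q e))" "{a \<in> arcs Q. head Q a = v}"]
          gentle assms
        by (auto simp: gentle_presentation_def)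
    qed
  next
    case False
    then obtain e1 e2 where e1: "e1 \<in> ?P" "out_arrow e1 = None"
      and e2: "e2 \<in> ?P" "out_arrow (pred_end Q e2) = None" by auto
    obtain a where a: "out_arrow (pred_end Q e1) = Some a" "head Q a = v" "a \<in> arcs Q"
      using adjacent_arrow[of e1] e1 by auto
    have out_if_in: "\<exists>c. out_arrow e = Some c" if "e \<in> ?P" "out_arrow (pred_end Q e) = None" for e
    proof (rule ccontr)
      assume "\<nexists>c. out_arrow e = Some c"
      then show False using adjacent_arrow[of e] that by auto
    qed
    obtain c where c: "out_arrow e2 = Some c"
      using out_if_in e2 by blast
    then have tc: "c \<in> arcs Q" "tail Q c = v" using out_arrow_Some[of e2 c] e2 by auto
    \<comment> \<open>A nonzero composite is traversed within a single passage, so arrows of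
      distinct passages at \<open>v\<close> can only form relations.\<close>
    have nonB: "\<not> nB b d" if "e \<in> ?P" "e' \<in> ?P" "out_arrow (pred_end Q e) = Some b" "out_arrow e' = Some d" "e \<noteq> e'"
      for e e' b d
    proof
      assume "nB b d"
      then have "out_arrow (succ_end Q (pred_end Q e)) = Some d"
        using out_arrow_succ[of "pred_end Q e" b d] that by simp
      then show False using that out_arrow_inj[of e e' d] by auto
    qed
    have G: "nG b d" if "e \<in> ?P" "e' \<in> ?P" "out_arrow (pred_end Q e) = Some b" "out_arrow e' = Some d" "e \<noteq> e'"
      for e e' b d
    proof -
      have "b \<in> arcs Q" "head Q b = v" "d \<in> arcs Q" "tail Q d = v"
        using out_arrow_Some[of "pred_end Q e" b] out_arrow_Some[of e' d] that by auto
      then show ?thesis using nB_or_nG nonB[OF that] by auto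
    qed
    have "e1 \<noteq> e2" using e1 e2 a by auto
    then have ac: "nG a c" using G e1 e2 a c by blast
    have "e3 = e1 \<or> e3 = e2" if e3: "e3 \<in> ?P" for e3
    proof (rule ccontr)
      assume n: "\<not> (e3 = e1 \<or> e3 = e2)"
      show False
      proof (cases "out_arrow e3")
        case (Some d)
        then have "nG a d" using G[of e1 e3 a d] e1 e3 a n by auto
        then have "c = d" using \<Gamma>.N_fun ac by blast
        then show False using out_arrow_inj[of e2 e3] e2 e3 c Some n by auto
      next
        case None
        then obtain b where b: "out_arrow (pred_end Q e3) = Some b"
          using adjacent_arrow[of e3] e3 None by auto
        then have "nG b c" using G[of e3 e2 b c] e2 e3 c n by auto
        then have "a = b" using \<Gamma>.N_inj ac by blast
        then have "pred_end Q e3 = pred_end Q e1"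
          using out_arrow_inj[of "pred_end Q e1" "pred_end Q e3" a] a b e1 e3 by auto
        then show False using e1 e3 n succ_pred_end by (metis (mono_tags, lifting) mem_Collect_eq)
      qed
    qed
    then have "?P \<subseteq> {e1, e2}" by blast
    then show ?thesis
      using card_mono[of "{e1, e2}" ?P] finite_subset[of ?P "{e1, e2}"] \<open>e1 \<noteq> e2\<close> by simp
  qed
  then show "finite (passages Q Mx v)" "card (passages Q Mx v) \<le> 2"
    unfolding Mx by auto
qed

text \<open>Trivial paths of type (2) are added exactly where the maximal paths pass once, and
  supply the missing end.\<close>

lemma card_passages:
  assumes v: "v \<in> verts Q"
  shows "card (passages Q W v) = 2"
proof -
  let ?T = "if card (passages Q Mx v) = 1 then {(Finite_Path (triv v), 0 :: nat)} else {}"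
  have t: "Finite_Path (triv w) \<notin> Mx" for w
    by (simp add: Finite_in_Mx triv_def B.maximal_chain_def)
  have "passages Q W v = passages Q Mx v \<union> passages Q (W - Mx) v"
    using Mx_subset_W by (auto simp: passages_def)
  moreover have "passages Q (W - Mx) v = ?T"
  proof -
    have "W - Mx = (\<lambda>w. Finite_Path (triv w)) ` {w \<in> verts Q. card (passages Q Mx w) = 1}"
      (is "_ = _ ` ?V")
      using t by (auto simp: rvertices_def)
    moreover have "passages Q ((\<lambda>w. Finite_Path (triv w)) ` V) v =
        (if v \<in> V then {(Finite_Path (triv v), 0)} else {})" for V
      by (auto simp: passages_def triv_def)
    ultimately show ?thesis using v by simp
  qed
  ultimately have "passages Q W v = passages Q Mx v \<union> ?T" by simp
  moreover have "passages Q Mx v \<inter> ?T = {}"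
  proof -
    have "(Finite_Path (triv v), 0) \<notin> passages Q Mx v"
      using t by (simp add: passages_def)
    then show ?thesis by simp
  qed
  ultimately have "card (passages Q W v) = card (passages Q Mx v) + card ?T"
    using passages_Mx(2)[OF v] by (simp add: card_Un_disjoint)
  moreover have "card (passages Q Mx v) \<noteq> 0" "card (passages Q Mx v) \<le> 2"
    using passages_Mx[OF v] by auto
  ultimately show ?thesis by (cases "card (passages Q Mx v) = 1") simp_all
qed

lemma ends_eq: "ends = (\<Union>v \<in> verts Q. passages Q W v)"
  using edge_at_in_verts by (auto simp: passages_eq) (auto simp: ends_def)

lemma finite_ends: "finite ends"
  unfolding ends_eq by (intro finite_UN_I finite_verts) (simp add: card_ge_0_finite card_passages)

lemma ex1_other_end:
  assumes "e \<in> ends"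
  shows "\<exists>!e'. e' \<in> ends \<and> edge_at Q e' = edge_at Q e \<and> e' \<noteq> e"
proof -
  let ?P = "passages Q W (edge_at Q e)"
  have P: "?P = {e' \<in> ends. edge_at Q e' = edge_at Q e}"
    by (auto simp: passages_eq) (auto simp: ends_def)
  obtain x y where "?P = {x, y}" "x \<noteq> y"
    using card_passages[OF edge_at_in_verts[OF assms]] by (auto simp: card_2_iff)
  then have "{e' \<in> ends. edge_at Q e' = edge_at Q e} = {x, y}" "x \<noteq> y" using P by auto
  moreover from this assms have "e = x \<or> e = y" by blast
  ultimately show ?thesis
    by (intro ex1I[of _ "if e = x then y else x"]) (simp_all, blast+)
qed

text \<open>The fixed-point-free involution of the half-edges whose orbits are the edges.\<close>

definition other :: "('v, 'a) rvertex \<times> nat \<Rightarrow> ('v, 'a) rvertex \<times> nat" where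
  "other e = (THE e'. e' \<in> ends \<and> edge_at Q e' = edge_at Q e \<and> e' \<noteq> e)"

lemma other:
  assumes "e \<in> ends"
  shows "other e \<in> ends" "edge_at Q (other e) = edge_at Q e" "other e \<noteq> e"
  using theI'[OF ex1_other_end[OF assms]] by (auto simp: other_def)

lemma other_eqI:
  "e \<in> ends \<Longrightarrow> e' \<in> ends \<Longrightarrow> edge_at Q e' = edge_at Q e \<Longrightarrow> e' \<noteq> e \<Longrightarrow> other e = e'"
  using ex1_other_end[of e] other[of e] by blast

lemma other_other [simp]: "e \<in> ends \<Longrightarrow> other (other e) = e"
  using other[of e] by (intro other_eqI) auto

text \<open>The black side after \<open>e\<close> runs into the red side of
  \<open>succ_end Q e\<close>. That red side is glued in reverse, so its initial corner becomes the
  final corner of the opposite red side, where the black side following the opposite end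
  begins.\<close>

definition next_side :: "('v, 'a) rvertex \<times> nat \<Rightarrow> ('v, 'a) rvertex \<times> nat" where
  "next_side e = other (succ_end Q e)"

lemma next_side_in [simp]: "e \<in> ends \<Longrightarrow> next_side e \<in> ends"
  by (simp add: next_side_def other)

lemma inj_on_next_side: "inj_on next_side ends"
  by (intro inj_onI) (metis next_side_def other_other pred_succ_end succ_end_in)

lemma next_side_iff:
  "e \<in> ends \<Longrightarrow> e' \<in> ends \<Longrightarrow>
     next_side e = e' \<longleftrightarrow> edge_at Q e' = edge_at Q (succ_end Q e) \<and> e' \<noteq> succ_end Q e"
  unfolding next_side_def using other_eqI[of "succ_end Q e" e'] other[of "succ_end Q e"] by auto

text \<open>When the arrows meet at an edge, a nonzero composite means that \<open>e'\<close> is the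
  very end \<open>succ_end Q e\<close>; by the dichotomy, a relation means that it is the other
  end.\<close>

lemma next_side_nG:
  assumes "e \<in> ends" "e' \<in> ends" "out_arrow e = Some a" "out_arrow e' = Some c"
  shows "next_side e = e' \<longleftrightarrow> nG a c"
proof -
  have a: "a \<in> arcs Q" "head Q a = edge_at Q (succ_end Q e)"
    using out_arrow_Some[OF assms(1,3)] by auto
  have c: "c \<in> arcs Q" "tail Q c = edge_at Q e'"
    using out_arrow_Some[OF assms(2,4)] by auto
  have "e' = succ_end Q e \<longleftrightarrow> nB a c"
  proof
    assume "e' = succ_end Q e"
    then show "nB a c"
      using out_arrow_Some(4)[OF assms(1,3)] assms(4) by blast
  next
    assume "nB a c"
    then show "e' = succ_end Q e"
      using out_arrow_succ[OF assms(1,3)] out_arrow_inj[OF assms(2) succ_end_in[OF assms(1)] assms(4)] by blast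
  qed
  then show ?thesis
    using next_side_iff[OF assms(1,2)] a c nB_or_nG[of a c] by (auto simp: nG_def)
qed

end

lemma disjoint_Un_eqpoll_Plus:
  assumes "A \<inter> B = {}"
  shows "A \<union> B \<approx> A <+> B"
proof (rule eqpoll_sym, unfold eqpoll_def, intro exI)
  show "bij_betw (case_sum id id) (A <+> B) (A \<union> B)"
    using assms by (auto simp: bij_betw_def inj_on_def Plus_def image_Un image_image)
qed

section \<open>Cyclic sequences of black sides\<close>

context gentle_surface
begin

text \<open>Orbit equivalence of the permutation \<open>next_side\<close>, generated in both
  directions to match the symmetric relation of two sides sharing a corner.\<close>

definition side_rel :: "((('v, 'a) rvertex \<times> nat) \<times> (('v, 'a) rvertex \<times> nat)) set" where
  "side_rel = {(e, e'). e \<in> ends \<and> e' \<in> ends \<and> (next_side e = e' \<or> next_side e' = e)}\<^sup>*"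

definition side_class :: "('v, 'a) rvertex \<times> nat \<Rightarrow> (('v, 'a) rvertex \<times> nat) set" where
  "side_class e = side_rel `` {e}"

definition marked_ends :: "(('v, 'a) rvertex \<times> nat) set" where
  "marked_ends = {e \<in> ends. out_arrow e = None}"

definition arrow_side :: "'a \<Rightarrow> ('v, 'a) rvertex \<times> nat" where
  "arrow_side a = (THE e. e \<in> ends \<and> out_arrow e = Some a)"

lemma side_rel_sym: "(e, e') \<in> side_rel \<Longrightarrow> (e', e) \<in> side_rel"
  unfolding side_rel_def by (rule symD[OF sym_rtrancl]) (auto simp: sym_def)

lemma side_rel_trans: "(e, e') \<in> side_rel \<Longrightarrow> (e', e'') \<in> side_rel \<Longrightarrow> (e, e'') \<in> side_rel"
  unfolding side_rel_def by (rule rtrancl_trans)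

lemma side_rel_refl [simp]: "(e, e) \<in> side_rel"
  by (simp add: side_rel_def)

lemma side_rel_next: "e \<in> ends \<Longrightarrow> (e, next_side e) \<in> side_rel"
  unfolding side_rel_def by (rule r_into_rtrancl) auto

lemma side_class_eq_iff: "side_class e = side_class e' \<longleftrightarrow> (e, e') \<in> side_rel"
  unfolding side_class_def using side_rel_sym side_rel_trans side_rel_refl by blast

lemma side_class_iff: "e' \<in> side_class e \<longleftrightarrow> (e, e') \<in> side_rel"
  by (simp add: side_class_def)

text \<open>Closure under \<open>next_side\<close> suffices: a finite \<open>X\<close> is mapped
  injectively into itself, hence onto itself, and so is closed under predecessors too.\<close>

lemma side_class_subset:
  assumes "X \<subseteq> ends" "\<And>x. x \<in> X \<Longrightarrow> next_side x \<in> X" "e \<in> X"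
  shows "side_class e \<subseteq> X"
proof
  have "next_side ` X = X"
    using assms(1,2) finite_subset[OF assms(1) finite_ends] inj_on_subset[OF inj_on_next_side assms(1)]
    by (intro endo_inj_surj) auto
  then have X: "x \<in> X" if "next_side x \<in> X" "x \<in> ends" for x
  proof -
    obtain y where y: "y \<in> X" "next_side x = next_side y"
      using \<open>next_side ` X = X\<close> \<open>next_side x \<in> X\<close> by blast
    then have "x = y"
      using inj_onD[OF inj_on_next_side, of x y] assms(1) \<open>x \<in> ends\<close> by auto
    then show ?thesis using y(1) by simp
  qed
  fix e' assume "e' \<in> side_class e"
  then have "(e, e') \<in> side_rel" by (simp add: side_class_iff)
  then show "e' \<in> X"
    unfolding side_rel_def
  proof (induction rule: rtrancl_induct)
    case (step y z)
    then show ?case using assms(2)[of y] X[of z] by auto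
  qed (rule assms(3))
qed

lemma side_class_ends: "e \<in> ends \<Longrightarrow> side_class e \<subseteq> ends"
  by (rule side_class_subset) auto

lemma arrow_side_eq: "e \<in> ends \<Longrightarrow> out_arrow e = Some a \<Longrightarrow> arrow_side a = e"
  unfolding arrow_side_def using out_arrow_inj by (intro the_equality) auto

lemma arrow_side:
  assumes "a \<in> arcs Q"
  shows "arrow_side a \<in> ends" "out_arrow (arrow_side a) = Some a" "fst (arrow_side a) \<in> Mx"
    "edge_at Q (arrow_side a) = tail Q a" "edge_at Q (succ_end Q (arrow_side a)) = head Q a"
  using out_arrow_surj[OF assms] arrow_side_eq out_arrow_Some by metis+

lemma next_arrow_side:
  assumes "nG a b"
  shows "next_side (arrow_side a) = arrow_side b"
  using assms \<Gamma>.N_arcs[OF assms] by (simp add: next_side_nG[of _ _ a b] arrow_side)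

lemma next_arrow_side_Some:
  assumes "a \<in> arcs Q" "out_arrow (next_side (arrow_side a)) = Some b"
  shows "nG a b"
  using assms next_side_nG[of "arrow_side a" "next_side (arrow_side a)" a b] by (simp add: arrow_side)

lemma chain_side_rel:
  assumes "successively nG cs" "set cs \<subseteq> arcs Q" "a \<in> set cs" "b \<in> set cs"
  shows "(arrow_side a, arrow_side b) \<in> side_rel"
proof -
  have *: "(arrow_side (cs ! 0), arrow_side (cs ! i)) \<in> side_rel" if "i < length cs" for i
    using that
  proof (induction i)
    case (Suc i)
    then have "nG (cs ! i) (cs ! Suc i)"
      using successively_nthD[OF assms(1)] by simp
    then have "(arrow_side (cs ! i), arrow_side (cs ! Suc i)) \<in> side_rel"
      using side_rel_next[of "arrow_side (cs ! i)"] next_arrow_side[of "cs ! i"]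
        arrow_side(1)[of "cs ! i"] \<Gamma>.N_arcs[of "cs ! i"] by auto
    then show ?case using Suc side_rel_trans by simp
  qed simp
  obtain i j where "i < length cs" "j < length cs" "a = cs ! i" "b = cs ! j"
    using assms(3,4) by (metis in_set_conv_nth)
  then show ?thesis using side_rel_trans[OF side_rel_sym[OF *[of i]] *[of j]] by simp
qed

lemma cyclic_chain_side_class:
  assumes "\<Gamma>.cyclic_chain cs" "a \<in> set cs"
  shows "side_class (arrow_side a) \<subseteq> arrow_side ` set cs"
proof (rule side_class_subset)
  have arcs: "set cs \<subseteq> arcs Q" using assms(1) by (simp add: \<Gamma>.cyclic_chain_def)
  then show "arrow_side ` set cs \<subseteq> ends" using arrow_side(1) by auto
  fix e assume "e \<in> arrow_side ` set cs"
  then obtain i where i: "i < length cs" "e = arrow_side (cs ! i)"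
    by (auto simp: in_set_conv_nth)
  then have "next_side e = arrow_side (cs ! (Suc i mod length cs))"
    using next_arrow_side \<Gamma>.cyclic_chain_nth[OF assms(1)] by simp
  moreover have "Suc i mod length cs < length cs" using i(1) by (intro mod_less_divisor) auto
  ultimately show "next_side e \<in> arrow_side ` set cs" by simp
qed (use assms in simp)

text \<open>A relation chain through an arrow of an unmarked class cannot stop, since a last arrow
  is followed by a marked side; so the arrow lies on one of the cycles represented by
  \<open>DD\<close>.\<close>

lemma unmarked_classes:
  "{c \<in> side_class ` ends. c \<inter> marked_ends = {}} \<approx> DD" (is "?S \<approx> _")
proof (rule eqpoll_sym, unfold eqpoll_def, intro exI)
  let ?f = "\<lambda>D. side_class (arrow_side (hd (snd D)))"
  have cyc: "\<Gamma>.cyclic_chain (snd D)" "hd (snd D) \<in> set (snd D)" "set (snd D) \<subseteq> arcs Q" if "D \<in> DD" for D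
    using \<Gamma>.representative_cyclic(1)[OF DD' that] by (auto simp: \<Gamma>.cyclic_chain_def)
  show "bij_betw ?f DD ?S"
  proof (rule bij_betw_imageI)
    show "inj_on ?f DD"
    proof (rule inj_onI)
      fix D D' assume *: "D \<in> DD" "D' \<in> DD" "?f D = ?f D'"
      have "arrow_side (hd (snd D')) \<in> ?f D"
        unfolding *(3) by (simp add: side_class_iff)
      then have "arrow_side (hd (snd D')) \<in> arrow_side ` set (snd D)"
        using cyclic_chain_side_class[OF cyc(1,2)[OF *(1)]] by blast
      then obtain a where a: "a \<in> set (snd D)" "arrow_side (hd (snd D')) = arrow_side a"
        by blast
      have "a \<in> arcs Q" "hd (snd D') \<in> arcs Q"
        using a(1) cyc(2,3) *(1,2) by blast+
      then have "a = hd (snd D')"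
        using a(2) arrow_side(2)[of a] arrow_side(2)[of "hd (snd D')"] by simp
      then show "D = D'"
        using \<Gamma>.representative_eqI[OF DD' *(1,2)] a(1) cyc(2)[OF *(2)] by blast
    qed
    have "?f D \<in> ?S" if D: "D \<in> DD" for D
    proof -
      have "?f D \<inter> marked_ends = {}"
        using cyclic_chain_side_class[OF cyc(1,2)[OF D]] arrow_side(2) cyc(3)[OF D]
        by (fastforce simp: marked_ends_def)
      then show ?thesis using cyc(2,3)[OF D] arrow_side(1) by auto
    qed
    moreover have "c \<in> ?f ` DD" if c: "c \<in> ?S" for c
    proof -
      obtain e where e: "e \<in> ends" "c = side_class e" "c \<inter> marked_ends = {}" using c by auto
      have Some: "\<exists>a. out_arrow e' = Some a" if "e' \<in> c" for e'
        using that e side_class_ends[OF e(1)] by (auto simp: marked_ends_def)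
      obtain a where a: "out_arrow e = Some a"
        using Some[of e] e(2) by (auto simp: side_class_iff)
      then have a': "a \<in> arcs Q" "e = arrow_side a"
        using out_arrow_Some(1) arrow_side_eq e(1) by auto
      from a'(1) show ?thesis
      proof (cases rule: \<Gamma>.chain_cover)
        case (maximal cs)
        let ?l = "arrow_side (last cs)"
        have l: "last cs \<in> set cs" "last cs \<in> arcs Q" using maximal(1) by (auto simp: \<Gamma>.maximal_chain_def)
        have "(e, ?l) \<in> side_rel"
          using chain_side_rel[of cs a "last cs"] maximal l by (simp add: \<Gamma>.maximal_chain_def a'(2))
        then have "next_side ?l \<in> c"
          unfolding e(2) side_class_iff
          by (rule side_rel_trans[OF _ side_rel_next[OF arrow_side(1)[OF l(2)]]])
        \<comment> \<open>In an unmarked class the side after \<open>last cs\<close> belongs to an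
          arrow, which contradicts maximality of the chain.\<close>
        then have "\<exists>b. nG (last cs) b"
          using Some next_arrow_side_Some[OF l(2)] by blast
        then show ?thesis using maximal(1) by (simp add: \<Gamma>.maximal_chain_def)
      next
        case (cyclic cs)
        then obtain D where D: "D \<in> DD" "a \<in> set (snd D)"
          using \<Gamma>.representative_cover[OF DD'] by blast
        have "(arrow_side (hd (snd D)), e) \<in> side_rel"
          using chain_side_rel[of "snd D" "hd (snd D)" a] cyc[OF D(1)] D(2)
          by (simp add: \<Gamma>.cyclic_chain_def a'(2))
        then have "?f D = c" unfolding e(2) by (simp add: side_class_eq_iff)
        then show ?thesis using D(1) by blast
      qed
    qed
    ultimately show "?f ` DD = ?S" by blast
  qed
qed

section \<open>Components with exactly one marked point\<close>

definition maximal_cycles :: "('v, 'a) qpath set" where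
  "maximal_cycles = {x. is_cycle Q x \<and> maximal_in Q (Bset Q I) x}"

definition maximal_pairs :: "(('v, 'a) qpath \<times> ('v, 'a) qpath) set" where
  "maximal_pairs = {(g, x). (g, x) \<in> parallel_pairs Q I \<and> maximal_in Q (Gamma_set Q I) g \<and>
     \<not> begin_alike g x \<and> \<not> end_alike g x}"

text \<open>The first and last passages of a closed path lie at the same edge and differ because the
  length is positive; so they are the two ends of that edge.\<close>

lemma next_side_maximal_cycle:
  assumes "p \<in> maximal_cycles"
  shows "Finite_Path p \<in> W" "next_side (last_end p) = last_end p"
proof -
  show W: "Finite_Path p \<in> W"
    using assms by (auto simp: maximal_cycles_def Finite_in_W Finite_in_Mx maximal_in_B_iff)
  have "snd p \<noteq> []" "psource p = ptarget Q p"
    using assms by (auto simp: maximal_cycles_def is_cycle_def plength_def)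
  then show "next_side (last_end p) = last_end p"
    using W next_side_iff[of "last_end p" "last_end p"]
    by (simp add: last_end_in succ_last_end edge_at_first_end edge_at_last_end) (simp add: last_end_def)
qed

text \<open>Maximality of \<open>g\<close> means that no relation precedes its first arrow or
  follows its last one. An arrow extending a nontrivial \<open>x\<close> would compose nonzero with
  \<open>g\<close> too, so that the paths would share their first or last arrow. Hence
  \<open>x\<close> is maximal, or it is trivial and its vertex has a single passage.\<close>

lemma maximal_pair_ends:
  assumes "(g, x) \<in> maximal_pairs"
  shows "Finite_Path x \<in> W" "next_side (last_end x) = arrow_side (hd (snd g))"
    "next_side (arrow_side (last (snd g))) = last_end x"
proof -
  have par: "x \<in> B.npaths" "psource g = psource x" "ptarget Q g = ptarget Q x"
    using assms by (auto simp: maximal_pairs_def parallel_pairs_def Bset_eq)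
  have g: "\<Gamma>.maximal_chain (snd g)" "fst g = tail Q (hd (snd g))"
    using assms by (auto simp: maximal_pairs_def maximal_in_Gamma_iff)
  have na: "\<not> begin_alike g x" "\<not> end_alike g x"
    using assms by (auto simp: maximal_pairs_def)
  have ne: "snd g \<noteq> []" using g(1) by (simp add: \<Gamma>.maximal_chain_def)
  have g0: "hd (snd g) \<in> arcs Q" "last (snd g) \<in> arcs Q" "tail Q (hd (snd g)) = psource x"
     "head Q (last (snd g)) = ptarget Q x"
    using g ne par(2,3) ptarget_conv[of Q "fst g" "snd g", unfolded prod.collapse] by (auto simp: \<Gamma>.maximal_chain_def psource_def)
  have nBhd: "nB a (hd (snd g))" if "a \<in> arcs Q" "head Q a = psource x" for a
    using that g(1) g0 nB_or_nG[of a "hd (snd g)"] by (auto simp: \<Gamma>.maximal_chain_def)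
  have nBlast: "nB (last (snd g)) b" if "b \<in> arcs Q" "tail Q b = ptarget Q x" for b
    using that g(1) g0 nB_or_nG[of "last (snd g)" b] by (auto simp: \<Gamma>.maximal_chain_def)
  show W: "Finite_Path x \<in> W"
  proof (cases "snd x = []")
    case False
    have x: "fst x = tail Q (hd (snd x))" "set (snd x) \<subseteq> arcs Q" "successively nB (snd x)"
      using B.npaths_iff[OF False, of "fst x"] par(1) by auto
    have "\<not> nB a (hd (snd x))" for a
    proof
      assume a: "nB a (hd (snd x))"
      then have "nB a (hd (snd g))"
        using B.N_arcs[OF a] x(1) by (intro nBhd) (auto simp: psource_def)
      then have "hd (snd g) = hd (snd x)" using B.N_fun a by blast
      then show False using na(1) ne False by (simp add: begin_alike_def)
    qed
    moreover have "\<not> nB (last (snd x)) b" for b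
    proof
      assume b: "nB (last (snd x)) b"
      then have "nB (last (snd g)) b"
        using B.N_arcs[OF b] ptarget_conv[of Q "fst x" "snd x", unfolded prod.collapse] False by (intro nBlast) auto
      then have "last (snd g) = last (snd x)" using B.N_inj b by blast
      then show False using na(2) ne False by (simp add: end_alike_def)
    qed
    ultimately show ?thesis
      using x False by (simp add: Finite_in_W Finite_in_Mx B.maximal_chain_def)
  next
    case True
    define v where "v = fst x"
    have x: "x = triv v" using True by (simp add: triv_def v_def prod_eq_iff)
    have v: "v \<in> verts Q" using par(1) by (simp add: x triv_def B.npaths_Nil_iff)
    have st: "psource x = v" "ptarget Q x = v" by (simp_all add: x triv_def psource_def ptarget_conv)
    let ?e = "arrow_side (hd (snd g))"
    have P: "passages Q Mx v = {e \<in> ends. fst e \<in> Mx \<and> edge_at Q e = v}"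
      by (rule passages_eq) (auto intro: Mx_subset_W)
    \<comment> \<open>For trivial \<open>x\<close> the path \<open>g\<close> is closed, and its last
      arrow is followed by its first one along a nonzero path.\<close>
    have succ: "succ_end Q (arrow_side (last (snd g))) = ?e"
      using out_arrow_succ[of "arrow_side (last (snd g))" "last (snd g)" "hd (snd g)"]
        arrow_side(1,2)[OF g0(2)] nBlast[of "hd (snd g)"] g0 st arrow_side_eq by (metis succ_end_in)
    \<comment> \<open>A passage leaving \<open>v\<close> uses the first arrow of \<open>g\<close>;
      one stopping at \<open>v\<close> would have entered by the last arrow of \<open>g\<close>,
      which puts it at the same end.\<close>
    have "e = ?e" if e: "e \<in> passages Q Mx v" for e
    proof (cases "out_arrow e")
      case (Some d)
      then have "d \<in> arcs Q" "tail Q d = v" using out_arrow_Some[of e d] e P by auto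
      then have "nB (last (snd g)) d" "nB (last (snd g)) (hd (snd g))"
        using nBlast g0 st by auto
      then have "d = hd (snd g)" using B.N_fun by blast
      then show ?thesis using Some e P arrow_side_eq[of e d] by simp
    next
      case None
      then obtain b where b: "out_arrow (pred_end Q e) = Some b" "head Q b = v" "b \<in> arcs Q"
        using adjacent_arrow[of e] e P by auto
      then have "nB b (hd (snd g))" "nB (last (snd g)) (hd (snd g))"
        using nBhd nBlast g0 st by auto
      then have "b = last (snd g)" using B.N_inj by blast
      then have "pred_end Q e = arrow_side (last (snd g))"
        using b e P arrow_side_eq[of "pred_end Q e" b] by simp
      then show ?thesis using succ succ_pred_end[of e] e P by auto
    qed
    moreover have "?e \<in> passages Q Mx v"
      using arrow_side[OF g0(1)] g0(3) st by (simp add: P)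
    ultimately have "passages Q Mx v = {?e}" by blast
    then show ?thesis using v by (auto simp: Finite_in_W x)
  qed
  have le: "last_end x \<in> ends" using W by (simp add: last_end_in)
  \<comment> \<open>The edge at the source of \<open>x\<close> has two ends; since \<open>g\<close>
    and \<open>x\<close> do not begin alike, the first arrow of \<open>g\<close> leaves from the end
    opposite to the start of \<open>x\<close>.\<close>
  have "arrow_side (hd (snd g)) \<noteq> (Finite_Path x, 0)"
  proof
    assume "arrow_side (hd (snd g)) = (Finite_Path x, 0)"
    then have "out_arrow (Finite_Path x, 0) = Some (hd (snd g))"
      using arrow_side(2)[OF g0(1)] by simp
    then show False
      using na(1) ne by (auto simp: begin_alike_def hd_conv_nth split: if_splits)
  qed
  then show "next_side (last_end x) = arrow_side (hd (snd g))"
    using le arrow_side[OF g0(1)] g0(3) W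
    by (subst next_side_iff) (simp_all add: succ_last_end edge_at_first_end)
  have "last_end x \<noteq> succ_end Q (arrow_side (last (snd g)))"
  proof
    assume *: "last_end x = succ_end Q (arrow_side (last (snd g)))"
    have "pred_end Q (last_end x) = arrow_side (last (snd g))"
      unfolding * using arrow_side(1)[OF g0(2)] by simp
    then have "out_arrow (pred_end Q (last_end x)) = Some (last (snd g))"
      using arrow_side(2)[OF g0(2)] by simp
    then show False
      using na(2) ne by (auto simp: end_alike_def last_end_def last_conv_nth split: if_splits)
  qed
  then show "next_side (arrow_side (last (snd g))) = last_end x"
    using le arrow_side[OF g0(2)] g0(4)
    by (subst next_side_iff) (simp_all add: edge_at_last_end)
qed

text \<open>Both kinds of generators go to the end before the marked side of their nonzero path.
  Conversely, either the marked side closes up on itself and its path is a maximal cycle, or it is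
  followed by an arrow with no preceding relation, whose maximal relation chain leads back to the
  mark and is parallel to the path.\<close>

lemma singly_marked_ends:
  "{e \<in> marked_ends. side_class e \<inter> marked_ends = {e}} \<approx> maximal_cycles <+> maximal_pairs"
  (is "?M \<approx> _")
proof (rule eqpoll_sym, unfold eqpoll_def, intro exI)
  let ?f = "case_sum last_end (\<lambda>(g, x). last_end x)"
  have next1: "out_arrow (next_side (last_end x)) = Some (hd (snd g))"
    if "(g, x) \<in> maximal_pairs" for g x
  proof -
    have "hd (snd g) \<in> arcs Q"
      using that by (auto simp: maximal_pairs_def maximal_in_Gamma_iff \<Gamma>.maximal_chain_def)
    then show ?thesis
      using maximal_pair_ends(2)[OF that] arrow_side(2) by simp
  qed
  show "bij_betw ?f (maximal_cycles <+> maximal_pairs) ?M"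
  proof (rule bij_betw_imageI)
    \<comment> \<open>A maximal chain is determined by its first arrow, which is read off from the
      side after the mark.\<close>
    have uniq: "g = g'" if *: "(g, x) \<in> maximal_pairs" "(g', x) \<in> maximal_pairs" for g g' x
    proof -
      have "hd (snd g) = hd (snd g')" using next1[OF *(1)] next1[OF *(2)] by simp
      moreover have mx: "\<Gamma>.maximal_chain (snd g)" "\<Gamma>.maximal_chain (snd g')"
         "fst g = tail Q (hd (snd g))" "fst g' = tail Q (hd (snd g'))"
        using * by (auto simp: maximal_pairs_def maximal_in_Gamma_iff)
      ultimately show ?thesis
        using \<Gamma>.maximal_chain_unique[OF mx(1,2), of 0 0]
        by (auto simp: prod_eq_iff hd_conv_nth \<Gamma>.maximal_chain_def)
    qed
    have neq: False if "x \<in> maximal_cycles" "(g, x) \<in> maximal_pairs" for g x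
      using next1[OF that(2)] next_side_maximal_cycle(2)[OF that(1)] by auto
    show "inj_on ?f (maximal_cycles <+> maximal_pairs)"
    proof (rule inj_onI)
      fix y z
      assume *: "y \<in> maximal_cycles <+> maximal_pairs" "z \<in> maximal_cycles <+> maximal_pairs" "?f y = ?f z"
      then show "y = z"
        using uniq by (cases y; cases z) (auto simp: inj_eq[OF inj_last_end] dest: neq)
    qed
    have M1: "last_end p \<in> ?M" if p: "p \<in> maximal_cycles" for p
    proof -
      have "last_end p \<in> ends"
        using next_side_maximal_cycle(1)[OF p] by (simp add: last_end_in)
      moreover from this have "side_class (last_end p) \<subseteq> {last_end p}"
        using next_side_maximal_cycle(2)[OF p] by (intro side_class_subset) auto
      ultimately show ?thesis by (auto simp: marked_ends_def side_class_iff)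
    qed
    have M2: "last_end x \<in> ?M" if gx: "(g, x) \<in> maximal_pairs" for g x
    proof -
      have g: "\<Gamma>.maximal_chain (snd g)" "set (snd g) \<subseteq> arcs Q" "snd g \<noteq> []"
        using gx by (auto simp: maximal_pairs_def maximal_in_Gamma_iff \<Gamma>.maximal_chain_def)
      have le: "last_end x \<in> ends"
        using maximal_pair_ends(1)[OF gx] by (simp add: last_end_in)
      have "side_class (last_end x) \<subseteq> insert (last_end x) (arrow_side ` set (snd g))"
      proof (rule side_class_subset)
        show "insert (last_end x) (arrow_side ` set (snd g)) \<subseteq> ends"
          using le g(2) arrow_side(1) by auto
        fix e assume "e \<in> insert (last_end x) (arrow_side ` set (snd g))"
        then consider "e = last_end x" | i where "i < length (snd g)" "e = arrow_side (snd g ! i)"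
          by (auto simp: in_set_conv_nth)
        then show "next_side e \<in> insert (last_end x) (arrow_side ` set (snd g))"
        proof cases
          case 1
          then show ?thesis using maximal_pair_ends(2)[OF gx] g(3) by simp
        next
          case (2 i)
          show ?thesis
          proof (cases "Suc i < length (snd g)")
            case True
            then have "nG (snd g ! i) (snd g ! Suc i)"
              using g(1) by (auto simp: \<Gamma>.maximal_chain_def intro: successively_nthD)
            then show ?thesis using next_arrow_side 2 True by simp
          next
            case False
            then have "i = length (snd g) - 1" using 2 by simp
            then have "snd g ! i = last (snd g)" using g(3) by (simp add: last_conv_nth)
            then show ?thesis using maximal_pair_ends(3)[OF gx] 2 by simp
          qed
        qed
      qed simp
      then have "side_class (last_end x) \<inter> marked_ends \<subseteq> {last_end x}"
        using g(2) arrow_side(2) by (fastforce simp: marked_ends_def)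
      then show ?thesis using le by (auto simp: marked_ends_def side_class_iff)
    qed
    moreover have "e \<in> ?f ` (maximal_cycles <+> maximal_pairs)" if e: "e \<in> ?M" for e
    proof -
      have ends: "e \<in> ends" "next_side e \<in> ends" and cls: "side_class e \<inter> marked_ends = {e}"
        using e by (auto simp: marked_ends_def)
      obtain p where p: "e = last_end p"
        using e out_arrow_None_iff[of e] ends(1) unfolding marked_ends_def by blast
      have W: "Finite_Path p \<in> W" using ends p last_end_in by simp
      have nx: "edge_at Q (next_side e) = psource p" "next_side e \<noteq> (Finite_Path p, 0)"
        using next_side_iff[OF ends(1,2)] W edge_at_first_end by (simp_all add: p succ_last_end)
      have ncl: "next_side e \<in> side_class e"
        using side_rel_next[OF ends(1)] by (simp add: side_class_iff)
      show ?thesis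
      proof (cases "out_arrow (next_side e)")
        case None
        then have "next_side e = e" using cls ncl ends(2) by (auto simp: marked_ends_def)
        \<comment> \<open>For trivial \<open>p\<close> the first end would be \<open>e\<close>
          itself, whereas \<open>next_side e\<close> never equals the first end.\<close>
        then have "ptarget Q p = psource p" "snd p \<noteq> []"
          using nx edge_at_last_end[of p] by (auto simp: p last_end_def)
        moreover from this W have "Finite_Path p \<in> Mx"
          by (auto simp: Finite_in_W triv_def)
        ultimately have "p \<in> maximal_cycles"
          using Finite_in_W_qpath[OF W]
          by (simp add: maximal_cycles_def is_cycle_def plength_def Finite_in_Mx maximal_in_B_iff)
        then show ?thesis using p by force
      next
        case (Some c)
        have c: "c \<in> arcs Q" "next_side e = arrow_side c" "tail Q c = psource p"
          using out_arrow_Some[OF ends(2) Some] arrow_side_eq[OF ends(2) Some] nx by auto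
        \<comment> \<open>\<open>next_side\<close> is injective, so an arrow preceding
          \<open>c\<close> in a relation would have \<open>e\<close> as its side, but
          \<open>e\<close> is marked.\<close>
        have npred: "\<not> nG a c" for a
        proof
          assume a: "nG a c"
          then have "next_side (arrow_side a) = next_side e" "a \<in> arcs Q"
            using next_arrow_side c \<Gamma>.N_arcs by auto
          then have "arrow_side a = e"
            using inj_onD[OF inj_on_next_side] arrow_side(1) ends(1) by blast
          then show False using arrow_side(2)[OF \<open>a \<in> arcs Q\<close>] p by simp
        qed
        from c(1) obtain cs where cs: "\<Gamma>.maximal_chain cs" "c \<in> set cs"
        proof (cases rule: \<Gamma>.chain_cover)
          case (cyclic cs)
          then obtain k where k: "k < length cs" "c = cs ! k" by (auto simp: in_set_conv_nth)
          have "\<exists>a. nG a c"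
          proof (cases k)
            case 0
            then show ?thesis using cyclic(1) k by (auto simp: \<Gamma>.cyclic_chain_def hd_conv_nth)
          next
            case (Suc j)
            then show ?thesis using \<Gamma>.cyclic_chain_nth[OF cyclic(1), of j] k by auto
          qed
          then show ?thesis using npred by blast
        qed (use that in blast)
        then have ne: "cs \<noteq> []" and arcs: "set cs \<subseteq> arcs Q" and suc: "successively nG cs"
          by (auto simp: \<Gamma>.maximal_chain_def)
        obtain k where k: "k < length cs" "c = cs ! k" using cs(2) by (auto simp: in_set_conv_nth)
        have hd: "hd cs = c"
        proof (cases k)
          case 0
          then show ?thesis using k ne by (simp add: hd_conv_nth)
        next
          case (Suc j)
          then show ?thesis using successively_nthD[OF suc, of j] k npred by auto
        qed
        let ?l = "arrow_side (last cs)"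
        have l: "last cs \<in> arcs Q" using arcs ne by auto
        have "(arrow_side c, ?l) \<in> side_rel"
          using chain_side_rel[OF suc arcs cs(2)] ne by simp
        then have "next_side ?l \<in> side_class e"
          unfolding side_class_iff
          using side_rel_trans[OF side_rel_trans[OF side_rel_next[OF ends(1)]] side_rel_next[OF arrow_side(1)[OF l]]]
            c(2) by simp
        moreover have "out_arrow (next_side ?l) = None"
          using next_arrow_side_Some[OF l] cs(1) unfolding \<Gamma>.maximal_chain_def
          by (cases "out_arrow (next_side ?l)") blast+
        \<comment> \<open>The side after the chain is marked and lies in the class, whose only
          marked side is \<open>e\<close>.\<close>
        ultimately have nl: "next_side ?l = e"
        proof -
          have "next_side ?l \<in> side_class e \<inter> marked_ends"
            using \<open>next_side ?l \<in> side_class e\<close> \<open>out_arrow (next_side ?l) = None\<close> arrow_side(1)[OF l]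
            by (simp add: marked_ends_def)
          then show ?thesis unfolding cls by simp
        qed
        then have l2: "edge_at Q e = head Q (last cs)" "e \<noteq> succ_end Q ?l"
          using next_side_iff[OF arrow_side(1)[OF l] ends(1)] arrow_side(5)[OF l] by auto
        let ?g = "(tail Q c, cs)"
        have "?g \<in> \<Gamma>.npaths" using hd arcs suc ne by (simp add: \<Gamma>.npaths_iff)
        moreover have "psource ?g = psource p" using c(3) by (simp add: psource_def)
        moreover have "ptarget Q ?g = ptarget Q p"
          using l2(1) ne by (simp add: ptarget_conv p edge_at_last_end)
        moreover have "maximal_in Q (Gamma_set Q I) ?g"
          using cs(1) hd by (simp add: maximal_in_Gamma_iff)
        \<comment> \<open>An arrow leaves from one end only, so a common first arrow would identify
          \<open>next_side e\<close> with the first end of \<open>p\<close>.\<close>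
        moreover have "\<not> begin_alike ?g p"
        proof
          assume "begin_alike ?g p"
          then have "out_arrow (Finite_Path p, 0) = Some c"
            using hd by (auto simp: begin_alike_def hd_conv_nth)
          moreover have "(Finite_Path p, 0) \<in> ends" using W by (simp add: ends_def)
          ultimately show False using nx(2) out_arrow_inj[OF ends(2) _ Some] by blast
        qed
        moreover have "\<not> end_alike ?g p"
        proof
          assume "end_alike ?g p"
          then have "out_arrow (pred_end Q e) = Some (last cs)"
            by (auto simp: end_alike_def last_conv_nth p last_end_def)
          then have "?l = pred_end Q e" using arrow_side_eq ends(1) by simp
          then show False using l2(2) ends(1) by simp
        qed
        ultimately have "(?g, p) \<in> maximal_pairs"
          using Finite_in_W_Bset[OF W]
          by (simp add: maximal_pairs_def parallel_pairs_def Gamma_set_eq)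
        then show ?thesis using p by (intro image_eqI[of _ _ "Inr (?g, p)"]) auto
      qed
    qed
    moreover have "?f z \<in> ?M" if "z \<in> maximal_cycles <+> maximal_pairs" for z
      using that
    proof (rule PlusE)
      fix p assume "p \<in> maximal_cycles" "z = Inl p"
      then show ?thesis using M1[of p] by simp
    next
      fix gx assume "gx \<in> maximal_pairs" "z = Inr gx"
      then show ?thesis using M2[of "fst gx" "snd gx"] by (simp add: case_prod_beta)
    qed
    ultimately show "?f ` (maximal_cycles <+> maximal_pairs) = ?M" by blast
  qed
qed

text \<open>The single marked end is a canonical representative of such a class.\<close>

lemma classes_with_one_mark:
  "{c \<in> side_class ` ends. card (c \<inter> marked_ends) = 1} \<approx> maximal_cycles <+> maximal_pairs"
  (is "?S \<approx> _")
proof -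
  let ?M = "{e \<in> marked_ends. side_class e \<inter> marked_ends = {e}}"
  have "bij_betw side_class ?M ?S"
  proof (rule bij_betw_imageI)
    show "inj_on side_class ?M"
      by (intro inj_onI) auto
    have "c \<in> side_class ` ?M" if c: "c \<in> ?S" for c
    proof -
      obtain e' where e': "e' \<in> ends" "c = side_class e'" using c by auto
      obtain e where e: "c \<inter> marked_ends = {e}" using c by (auto simp: card_1_singleton_iff)
      then have "(e', e) \<in> side_rel" using e' by (auto simp flip: side_class_iff)
      then have "c = side_class e" using e'(2) side_class_eq_iff by simp
      then show ?thesis using e by blast
    qed
    then show "side_class ` ?M = ?S" by (auto simp: marked_ends_def)
  qed
  then have "?M \<approx> ?S" by (auto simp: eqpoll_def)
  then show ?thesis using singly_marked_ends eqpoll_sym eqpoll_trans by blast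
qed

lemma classes_with_at_most_one_mark:
  "{c \<in> side_class ` ends. card (c \<inter> marked_ends) \<le> 1} \<approx> (maximal_cycles <+> maximal_pairs) <+> DD"
  (is "?S \<approx> _")
proof -
  let ?Z = "{c \<in> side_class ` ends. c \<inter> marked_ends = {}}"
  let ?U = "{c \<in> side_class ` ends. card (c \<inter> marked_ends) = 1}"
  have fin: "finite (c \<inter> marked_ends)" for c
    by (rule finite_subset[OF _ finite_ends]) (auto simp: marked_ends_def)
  have "card (c \<inter> marked_ends) \<le> 1 \<longleftrightarrow> card (c \<inter> marked_ends) = 1 \<or> c \<inter> marked_ends = {}" for c
    using card_0_eq[OF fin[of c]] by linarith
  then have "?S = ?U \<union> ?Z" by blast
  moreover have "?U \<inter> ?Z = {}"
    by (rule equals0I) (elim IntE CollectE conjE, simp)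
  ultimately have "?S \<approx> ?U <+> ?Z"
    using disjoint_Un_eqpoll_Plus[of ?U ?Z] by (simp only:)
  also have "?U <+> ?Z \<approx> (maximal_cycles <+> maximal_pairs) <+> DD"
    by (intro sum_eqpoll_cong classes_with_one_mark unmarked_classes)
  finally show ?thesis .
qed

end

section \<open>The boundary of the surface\<close>

text \<open>The complement of a member is a finite union of closed sets, so each member is open as
  well as closed and connected.\<close>

lemma connected_components_of_finite_partition:
  assumes "finite \<P>" "\<Union>\<P> = topspace X" "disjoint \<P>"
    and P: "\<And>P. P \<in> \<P> \<Longrightarrow> closedin X P \<and> connectedin X P \<and> P \<noteq> {}"
  shows "connected_components_of X = \<P>"
proof -
  have comp: "connected_component_of_set X x = P" if "P \<in> \<P>" "x \<in> P" for P x
  proof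
    show "P \<subseteq> connected_component_of_set X x"
      using connected_component_of_maximal P that by metis
    have dj: "y \<notin> P" if "R \<in> \<P>" "y \<in> R" "R \<noteq> P" for R y
      using pairwiseD[OF assms(3) \<open>R \<in> \<P>\<close> \<open>P \<in> \<P>\<close>] that(2,3) by (auto simp: disjnt_iff)
    have "topspace X - P = \<Union>(\<P> - {P})"
      unfolding assms(2)[symmetric] by (auto dest: dj)
    moreover have "closedin X (\<Union>(\<P> - {P}))"
      using assms(1) P by (intro closedin_Union) auto
    ultimately have "openin X P"
      using closedin_subset[of X P] P[OF that(1)] by (simp add: openin_closedin_eq)
    then have "connected_component_of_set X x \<subseteq> P \<or> disjnt (connected_component_of_set X x) P"
      using connectedin_clopen_cases[OF connectedin_connected_component_of, of X P x] P[OF that(1)] by simp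
    moreover have "x \<in> connected_component_of_set X x"
      using assms(2) that connected_component_of_refl[of X x] by auto
    ultimately show "connected_component_of_set X x \<subseteq> P"
      using that(2) by (auto simp: disjnt_iff)
  qed
  show ?thesis
    unfolding connected_components_of_def
  proof (intro equalityI subsetI)
    fix S assume "S \<in> (connected_component_of_set X) ` topspace X"
    then show "S \<in> \<P>" using comp assms(2) by fastforce
  next
    fix P assume "P \<in> \<P>"
    then show "P \<in> (connected_component_of_set X) ` topspace X"
      using comp P assms(2) by (metis UnionI ex_in_conv image_eqI)
  qed
qed

lemma perimeter_eq_iff:
  assumes "valency Q q > 0"
  shows "perimeter Q q x = perimeter Q q' y \<longleftrightarrow>
    q = q' \<and> (\<exists>k::int. x = y + 2 * real (valency Q q) * k)"
proof -
  let ?n = "real (valency Q q)"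
  have "cis (- (pi * x / ?n)) = cis (- (pi * y / ?n)) \<longleftrightarrow> (\<exists>k::int. x = y + 2 * ?n * k)"
  proof -
    have "cis (- (pi * x / ?n)) = cis (- (pi * y / ?n)) \<longleftrightarrow>
       sin (pi * x / ?n) = sin (pi * y / ?n) \<and> cos (pi * x / ?n) = cos (pi * y / ?n)"
      by (auto simp: complex_eq_iff)
    also have "\<dots> \<longleftrightarrow> (\<exists>k::int. pi * x / ?n = pi * y / ?n + 2 * pi * k)"
      by (rule sin_cos_eq_iff)
    also have "\<dots> \<longleftrightarrow> (\<exists>k::int. x = y + 2 * ?n * k)"
    proof (intro ex_cong1)
      fix k :: int
      have "pi * x / ?n = pi * y / ?n + 2 * pi * k \<longleftrightarrow> pi * x = pi * (y + 2 * ?n * k)"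
        using assms by (simp add: field_simps)
      then show "pi * x / ?n = pi * y / ?n + 2 * pi * k \<longleftrightarrow> x = y + 2 * ?n * k" by simp
    qed
    finally show ?thesis .
  qed
  then show ?thesis by (auto simp: perimeter_def)
qed

lemma mod_eq_of_int_eq: "int i = int j + int n * k \<Longrightarrow> i mod n = j mod n"
  by (metis mod_mult_self2 of_nat_eq_iff of_nat_mod)

text \<open>Red sides start at even parameters, so \<open>s - t\<close> is an even integer between
  -1 and 1, hence zero. Black sides reduce to this by a shift of both parameters by one.\<close>

lemma red_param_cong:
  fixes s t :: real
  assumes "2 * real i + t = 2 * real j + s + 2 * real n * of_int k"
    "i < n" "j < n" "0 \<le> s" "s \<le> 1" "0 \<le> t" "t \<le> 1"
  shows "i = j \<and> s = t"
proof -
  define m where "m = int i - int j - int n * k"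
  have m: "2 * real_of_int m = s - t" using assms(1) by (simp add: m_def algebra_simps)
  then have "m = 0" using assms(4-) by linarith
  then have "int i = int j + int n * k" by (simp add: m_def)
  then have "i = j" using mod_eq_of_int_eq assms(2,3) by (metis mod_less)
  then show ?thesis using m \<open>m = 0\<close> by simp
qed

text \<open>Here \<open>1 + s - t\<close> is an even integer between 0 and 2, and the two possible
  values give the two corners of the black side.\<close>

lemma black_red_param_cong:
  fixes s t :: real
  assumes "2 * real i + 1 + s = 2 * real j + t + 2 * real n * of_int k"
    "i < n" "j < n" "0 \<le> s" "s \<le> 1" "0 \<le> t" "t \<le> 1"
  shows "s = 0 \<and> t = 1 \<and> j = i \<or> s = 1 \<and> t = 0 \<and> j = Suc i mod n"
proof -
  define m where "m = int j + int n * k - int i"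
  have m: "2 * real_of_int m = 1 + s - t" using assms(1) by (simp add: m_def algebra_simps)
  then consider "m = 0" | "m = 1" using assms(4-) by linarith
  then show ?thesis
  proof cases
    case 1
    then have "int i = int j + int n * k" by (simp add: m_def)
    then have "i = j" using mod_eq_of_int_eq assms(2,3) by (metis mod_less)
    then show ?thesis using m 1 assms(4-) by simp
  next
    case 2
    then have "int (Suc i) = int j + int n * k" by (simp add: m_def)
    then have "Suc i mod n = j" using mod_eq_of_int_eq[of "Suc i" j n k] assms(3) by simp
    then show ?thesis using m 2 assms(4-) by simp
  qed
qed

section \<open>Sides of the polygons and their gluing\<close>

context gentle_surface
begin

definition red :: "('v, 'a) rvertex \<times> nat \<Rightarrow> real \<Rightarrow> ('v, 'a) rvertex \<times> complex" where
  "red e t = perimeter Q (fst e) (2 * real (snd e) + t)"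

definition black :: "('v, 'a) rvertex \<times> nat \<Rightarrow> real \<Rightarrow> ('v, 'a) rvertex \<times> complex" where
  "black e s = perimeter Q (fst e) (2 * real (snd e) + 1 + s)"

abbreviation glue_class :: "('v, 'a) rvertex \<times> complex \<Rightarrow> (('v, 'a) rvertex \<times> complex) set" where
  "glue_class z \<equiv> glued Q W `` {z}"

definition side :: "('v, 'a) rvertex \<times> nat \<Rightarrow> (('v, 'a) rvertex \<times> complex) set set" where
  "side e = glue_class ` black e ` {0..1}"

lemma endsD: "e \<in> ends \<Longrightarrow> fst e \<in> W" "e \<in> ends \<Longrightarrow> snd e < valency Q (fst e)"
  by (auto simp: ends_def)

lemma red_eq_iff:
  assumes "e \<in> ends" "e' \<in> ends" "t \<in> {0..1}" "t' \<in> {0..1}"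
  shows "red e t = red e' t' \<longleftrightarrow> e = e' \<and> t = t'"
proof
  assume r: "red e t = red e' t'"
  have n: "0 < valency Q (fst e)" using endsD(2)[OF assms(1)] by simp
  obtain k :: int where "fst e = fst e'"
      "2 * real (snd e) + t = 2 * real (snd e') + t' + 2 * real (valency Q (fst e)) * k"
    using r unfolding red_def perimeter_eq_iff[OF n] by blast
  then show "e = e' \<and> t = t'"
    using red_param_cong[of "snd e" t "snd e'" t' "valency Q (fst e)" k] endsD(2)[OF assms(1)]
      endsD(2)[OF assms(2)] assms(3,4) by (simp add: prod_eq_iff)
qed simp

lemma black_eq_iff:
  assumes "e \<in> ends" "e' \<in> ends" "t \<in> {0..1}" "t' \<in> {0..1}"
  shows "black e t = black e' t' \<longleftrightarrow> e = e' \<and> t = t'"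
proof
  assume r: "black e t = black e' t'"
  have n: "0 < valency Q (fst e)" using endsD(2)[OF assms(1)] by simp
  obtain k :: int where "fst e = fst e'"
      "2 * real (snd e) + 1 + t = 2 * real (snd e') + 1 + t' + 2 * real (valency Q (fst e)) * k"
    using r unfolding black_def perimeter_eq_iff[OF n] by blast
  then show "e = e' \<and> t = t'"
    using red_param_cong[of "snd e" t "snd e'" t' "valency Q (fst e)" k] endsD(2)[OF assms(1)]
      endsD(2)[OF assms(2)] assms(3,4) by (simp add: prod_eq_iff)
qed simp

lemma black_0: "black e 0 = red e 1"
  by (simp add: black_def red_def)

lemma black_1:
  assumes "e \<in> ends"
  shows "black e 1 = red (succ_end Q e) 0"
proof -
  obtain q i where e: "e = (q, i)" by force
  have i: "i < valency Q q" using assms by (simp add: e ends_def)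
  then have n: "0 < valency Q q" by simp
  show ?thesis
  proof (cases "Suc i = valency Q q")
    case True
    then have "2 * real i + 1 + 1 = 2 * real (valency Q q)" by (simp flip: True)
    \<comment> \<open>The last black side wraps around to the first red side, and one full turn,
      \<open>k = 1\<close>, accounts for the jump of the index.\<close>
    then have "\<exists>k::int. 2 * real i + 1 + 1 = 2 * real (Suc i mod valency Q q) + 0 + 2 * real (valency Q q) * k"
      by (intro exI[of _ 1]) (simp add: True)
    then show ?thesis by (simp only: black_def red_def e perimeter_eq_iff[OF n] fst_conv snd_conv succ_end.simps simp_thms)
  next
    case False
    then have "Suc i mod valency Q q = Suc i" using i by simp
    then show ?thesis by (simp add: black_def red_def e)
  qed
qed

lemma black_eq_redD:
  assumes "e \<in> ends" "e' \<in> ends" "s \<in> {0..1}" "t \<in> {0..1}" "black e s = red e' t"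
  shows "s = 0 \<and> t = 1 \<and> e' = e \<or> s = 1 \<and> t = 0 \<and> e' = succ_end Q e"
proof -
  have n: "0 < valency Q (fst e)" using endsD(2)[OF assms(1)] by simp
  obtain k :: int where "fst e = fst e'"
      "2 * real (snd e) + 1 + s = 2 * real (snd e') + t + 2 * real (valency Q (fst e)) * k"
    using assms(5) unfolding black_def red_def perimeter_eq_iff[OF n] by blast
  moreover have "succ_end Q e = (fst e, Suc (snd e) mod valency Q (fst e))" by (cases e) simp
  ultimately show ?thesis
    using black_red_param_cong[of "snd e" s "snd e'" t "valency Q (fst e)" k] endsD(2)[OF assms(1)]
      endsD(2)[OF assms(2)] assms(3,4) by (auto simp: prod_eq_iff)
qed

text \<open>An edge has only two ends, so the pairs of ends in \<open>gluing\<close> form the graph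
  of the involution \<open>other\<close>.\<close>

lemma gluing_iff:
  "(z, w) \<in> gluing Q W \<longleftrightarrow> (\<exists>e \<in> ends. \<exists>t \<in> {0..1}. z = red e t \<and> w = red (other e) (1 - t))"
proof
  assume "(z, w) \<in> gluing Q W"
  then obtain q i q' j t v where *: "z = perimeter Q q (2 * real i + t)"
      "w = perimeter Q q' (2 * real j + 1 - t)" "v \<in> verts Q" "(q, i) \<in> passages Q W v"
      "(q', j) \<in> passages Q W v" "(q, i) \<noteq> (q', j)" "0 \<le> t" "t \<le> 1"
    unfolding gluing_def by blast
  then have e: "(q, i) \<in> ends" "(q', j) \<in> ends" "edge_at Q (q', j) = edge_at Q (q, i)"
    by (auto simp: passages_eq)
  then have "other (q, i) = (q', j)" using *(6) by (intro other_eqI) auto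
  then have "z = red (q, i) t" "w = red (other (q, i)) (1 - t)"
    using *(1,2) by (simp_all add: red_def algebra_simps)
  then show "\<exists>e \<in> ends. \<exists>t \<in> {0..1}. z = red e t \<and> w = red (other e) (1 - t)"
    using e(1) *(7,8) by (intro bexI[of _ "(q, i)"] bexI[of _ t]) auto
next
  assume "\<exists>e \<in> ends. \<exists>t \<in> {0..1}. z = red e t \<and> w = red (other e) (1 - t)"
  then obtain e t where *: "e \<in> ends" "0 \<le> t" "t \<le> 1" "z = red e t" "w = red (other e) (1 - t)"
    by auto
  obtain q i q' j where e: "e = (q, i)" "other e = (q', j)" by force
  have "(q, i) \<in> passages Q W (edge_at Q e)" "(q', j) \<in> passages Q W (edge_at Q e)" "(q, i) \<noteq> (q', j)"
    using other[OF *(1)] *(1) endsD(1) by (auto simp: passages_eq e(2)[symmetric] simp flip: e(1))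
  moreover have "z = perimeter Q q (2 * real i + t)" "w = perimeter Q q' (2 * real j + 1 - t)"
    using *(4,5) e by (simp_all add: red_def algebra_simps)
  ultimately show "(z, w) \<in> gluing Q W"
    unfolding gluing_def using *(2,3) edge_at_in_verts[OF *(1)] by blast
qed

lemma gluing_sym: "(z, w) \<in> gluing Q W \<Longrightarrow> (w, z) \<in> gluing Q W"
proof -
  assume "(z, w) \<in> gluing Q W"
  then obtain e t where "e \<in> ends" "t \<in> {0..1}" "z = red e t" "w = red (other e) (1 - t)"
    by (auto simp: gluing_iff)
  then show "(w, z) \<in> gluing Q W"
    unfolding gluing_iff using other(1) by (intro bexI[of _ "other e"] bexI[of _ "1 - t"]) auto
qed

lemma gluing_unique: "(z, w) \<in> gluing Q W \<Longrightarrow> (z, w') \<in> gluing Q W \<Longrightarrow> w = w'"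
  unfolding gluing_iff using red_eq_iff by (metis (no_types, lifting))

text \<open>Gluing is a symmetric partial function, because different red sides do not even share
  corners; so its transitive closure adds only the identity and classes have at most two
  points.\<close>

lemma glued_iff: "(z, w) \<in> glued Q W \<longleftrightarrow> z = w \<or> (z, w) \<in> gluing Q W"
proof
  assume "(z, w) \<in> glued Q W"
  then show "z = w \<or> (z, w) \<in> gluing Q W"
    unfolding glued_def
  proof (induction rule: rtrancl_induct)
    case (step y w)
    then have "(y, w) \<in> gluing Q W" using gluing_sym[of w y] by blast
    then show ?case using step.IH gluing_sym gluing_unique by metis
  qed simp
qed (auto simp: glued_def)

lemma glued_sym: "(z, w) \<in> glued Q W \<Longrightarrow> (w, z) \<in> glued Q W"
  using gluing_sym[of z w] unfolding glued_iff by blast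

lemma glue_class_eq_iff: "glue_class z = glue_class w \<longleftrightarrow> (z, w) \<in> glued Q W"
proof -
  have "(x, y) \<in> glued Q W \<Longrightarrow> (y, z) \<in> glued Q W \<Longrightarrow> (x, z) \<in> glued Q W" for x y z
    unfolding glued_def by (rule rtrancl_trans)
  moreover have "(x, x) \<in> glued Q W" for x by (simp add: glued_def)
  ultimately show ?thesis using glued_sym by blast
qed

text \<open>A black side meets red sides only at its corners: the initial one is identified with the
  end of the preceding black side, the final one with the start of the next.\<close>

lemma black_gluing:
  assumes "e \<in> ends" "s \<in> {0..1}" "(black e s, w) \<in> gluing Q W"
  shows "s = 0 \<and> w = black (pred_end Q (other e)) 1 \<or> s = 1 \<and> w = black (next_side e) 0"
proof -
  obtain e' t where *: "e' \<in> ends" "t \<in> {0..1}" "black e s = red e' t" "w = red (other e') (1 - t)"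
    using assms(3) by (auto simp: gluing_iff)
  from black_eq_redD[OF assms(1) *(1) assms(2) *(2,3)] show ?thesis
  proof
    assume "s = 0 \<and> t = 1 \<and> e' = e"
    then show ?thesis
      using *(4) black_1[of "pred_end Q (other e)"] other(1)[OF assms(1)] by simp
  next
    assume "s = 1 \<and> t = 0 \<and> e' = succ_end Q e"
    then show ?thesis using *(4) by (simp add: next_side_def black_0)
  qed
qed

lemma black_next_glued:
  assumes "e \<in> ends"
  shows "(black e 1, black (next_side e) 0) \<in> glued Q W"
  unfolding glued_iff gluing_iff black_1[OF assms] black_0 next_side_def
  by (rule disjI2) (intro bexI[of _ "succ_end Q e"] bexI[of _ 0]; use assms in simp)

lemma next_side_pred: "e \<in> ends \<Longrightarrow> next_side (pred_end Q (other e)) = e"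
  using other(1) by (simp add: next_side_def)

text \<open>Different black sides are disjoint in the polygons, so in the surface they can meet only
  at identified corners.\<close>

lemma side_Int_iff:
  assumes "e \<in> ends" "e' \<in> ends"
  shows "side e \<inter> side e' \<noteq> {} \<longleftrightarrow> e = e' \<or> next_side e = e' \<or> next_side e' = e"
proof
  assume "side e \<inter> side e' \<noteq> {}"
  then obtain s s' where s: "s \<in> {0..1}" "s' \<in> {0..1}" "glue_class (black e s) = glue_class (black e' s')"
    unfolding side_def by blast
  then consider "black e s = black e' s'" | "(black e s, black e' s') \<in> gluing Q W"
    unfolding glue_class_eq_iff glued_iff by blast
  then show "e = e' \<or> next_side e = e' \<or> next_side e' = e"
  proof cases
    case 1
    then show ?thesis using black_eq_iff[OF assms s(1,2)] by simp
  next
    case 2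
    from black_gluing[OF assms(1) s(1) 2] show ?thesis
    proof
      assume "s = 0 \<and> black e' s' = black (pred_end Q (other e)) 1"
      then have "e' = pred_end Q (other e)"
        using black_eq_iff[of e' "pred_end Q (other e)" s' 1] assms s(2) other(1) by simp
      then show ?thesis using next_side_pred[OF assms(1)] by simp
    next
      assume "s = 1 \<and> black e' s' = black (next_side e) 0"
      then have "e' = next_side e"
        using black_eq_iff[of e' "next_side e" s' 0] assms s(2) by simp
      then show ?thesis by simp
    qed
  qed
next
  have *: "side x \<inter> side (next_side x) \<noteq> {}" if x: "x \<in> ends" for x
  proof -
    have "glue_class (black x 1) = glue_class (black (next_side x) 0)"
      using black_next_glued[OF x] by (simp only: glue_class_eq_iff)
    moreover have "glue_class (black x 1) \<in> side x" "glue_class (black (next_side x) 0) \<in> side (next_side x)"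
      by (auto simp: side_def)
    ultimately show ?thesis by auto
  qed
  assume "e = e' \<or> next_side e = e' \<or> next_side e' = e"
  moreover have "side e \<noteq> {}" by (simp add: side_def)
  ultimately show "side e \<inter> side e' \<noteq> {}" using *[OF assms(1)] *[OF assms(2)] by blast
qed

section \<open>Black sides as closed connected subsets of the surface\<close>

lemma continuous_map_perimeter:
  assumes "q \<in> W"
  shows "continuous_map euclideanreal (polygons W) (perimeter Q q)"
proof -
  have "continuous_map euclideanreal (top_of_set (cball 0 1)) (\<lambda>x. cis (- (pi * x / real (valency Q q))))"
    by (auto simp: continuous_map_in_subtopology image_subset_iff divide_inverse intro!: continuous_intros)
  then have "continuous_map euclideanreal (polygons W) ((\<lambda>z. (q, z)) \<circ> (\<lambda>x. cis (- (pi * x / real (valency Q q)))))"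
    unfolding polygons_def
    by (rule continuous_map_compose) (rule continuous_map_component_injection[OF assms])
  then show ?thesis by (simp add: perimeter_def[abs_def] o_def)
qed

lemma continuous_map_black:
  assumes "e \<in> ends"
  shows "continuous_map euclideanreal (polygons W) (black e)"
proof -
  have "continuous_map euclideanreal (polygons W) (perimeter Q (fst e) \<circ> (\<lambda>s. 2 * real (snd e) + 1 + s))"
    by (rule continuous_map_compose[OF _ continuous_map_perimeter[OF endsD(1)[OF assms]]])
       (auto intro!: continuous_intros)
  then show ?thesis by (simp add: black_def[abs_def] o_def)
qed

lemma topspace_polygons: "topspace (polygons W) = W \<times> cball 0 1"
  by (auto simp: polygons_def)

lemma perimeter_in_polygons: "q \<in> W \<Longrightarrow> perimeter Q q x \<in> topspace (polygons W)"
  by (simp add: topspace_polygons perimeter_def)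

lemma closedin_polygons:
  assumes "q \<in> W" "closed K" "K \<subseteq> cball 0 1"
  shows "closedin (polygons W) (Pair q ` K)"
proof -
  have "closedin (top_of_set (cball 0 1)) K"
    using assms(2,3) by (simp add: closed_subset)
  then show ?thesis
    using closed_map_component_injection[OF assms(1), of "\<lambda>q. top_of_set (cball 0 1)"]
    unfolding closed_map_def polygons_def by blast
qed

lemma closedin_black:
  assumes "e \<in> ends"
  shows "closedin (polygons W) (black e ` {0..1})"
proof -
  let ?f = "\<lambda>s. cis (- (pi * (2 * real (snd e) + 1 + s) / real (valency Q (fst e))))"
  have "black e ` {0..1} = Pair (fst e) ` ?f ` {0..1}"
    unfolding black_def perimeter_def image_image by simp
  moreover have "compact (?f ` {0..1})"
    by (intro compact_continuous_image) (auto simp: divide_inverse intro!: continuous_intros)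
  moreover have "?f ` {0..1} \<subseteq> cball 0 1" by auto
  ultimately show ?thesis
    using closedin_polygons[OF endsD(1)[OF assms], of "?f ` {0..1}"] by (simp add: compact_imp_closed)
qed

lemma closedin_black_point:
  assumes "e \<in> ends"
  shows "closedin (polygons W) {black e s}"
  using closedin_polygons[OF endsD(1)[OF assms], of "{snd (black e s)}"]
  by (simp add: black_def perimeter_def)

lemma quotient_map_surface: "quotient_map (polygons W) (surface Q W) glue_class"
  unfolding surface_def by (rule quotient_map_quotient_topology)

lemma black_in_polygons: "e \<in> ends \<Longrightarrow> black e s \<in> topspace (polygons W)"
  by (simp add: black_def perimeter_in_polygons endsD)

lemma glue_class_in_surface: "z \<in> topspace (polygons W) \<Longrightarrow> glue_class z \<in> topspace (surface Q W)"
  using quotient_map_surface unfolding quotient_map_def by blast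

lemma side_subset_surface: "e \<in> ends \<Longrightarrow> side e \<subseteq> topspace (surface Q W)"
  using glue_class_in_surface[OF black_in_polygons] unfolding side_def by blast

lemma closedin_side:
  assumes "e \<in> ends"
  shows "closedin (surface Q W) (side e)"
proof -
  \<comment> \<open>Saturating the arc under the gluing adds at most the two points identified with
    its corners, and these are closed.\<close>
  let ?A = "black e ` {0..1} \<union> ({black (pred_end Q (other e)) 1} \<union> {black (next_side e) 0})"
  have pe: "pred_end Q (other e) \<in> ends" using other(1)[OF assms] by simp
  have "{z \<in> topspace (polygons W). glue_class z \<in> side e} = ?A"
  proof (intro equalityI subsetI)
    fix z assume "z \<in> {z \<in> topspace (polygons W). glue_class z \<in> side e}"
    then obtain s where s: "s \<in> {0..1}" "glue_class z = glue_class (black e s)"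
      by (auto simp: side_def)
    then have "black e s = z \<or> (black e s, z) \<in> gluing Q W"
      using glued_iff glued_sym glue_class_eq_iff by blast
    then show "z \<in> ?A"
      using black_gluing[OF assms s(1)] s(1) by blast
  next
    fix z assume "z \<in> ?A"
    then consider "z \<in> black e ` {0..1}" | "z = black (pred_end Q (other e)) 1" | "z = black (next_side e) 0"
      by blast
    then show "z \<in> {z \<in> topspace (polygons W). glue_class z \<in> side e}"
    proof cases
      case 1
      then show ?thesis using black_in_polygons[OF assms] by (auto simp: side_def)
    next
      case 2
      have "glue_class z = glue_class (black e 0)"
        unfolding glue_class_eq_iff 2 using black_next_glued[OF pe] next_side_pred[OF assms] by simp
      then show ?thesis using black_in_polygons[OF pe] 2 by (auto simp: side_def)
    next
      case 3
      have "glue_class (black e 1) = glue_class z"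
        unfolding glue_class_eq_iff 3 using black_next_glued[OF assms] .
      then have "glue_class z \<in> side e" unfolding side_def by (intro image_eqI[of _ _ "black e 1"]) auto
      then show ?thesis using black_in_polygons[of "next_side e" 0] assms 3 by simp
    qed
  qed
  moreover have "closedin (polygons W) ?A"
    using closedin_black[OF assms] closedin_black_point[OF pe] closedin_black_point[of "next_side e"] assms
    by (intro closedin_Un) auto
  ultimately show ?thesis
    using quotient_map_surface[unfolded quotient_map_closedin, THEN conjunct2, rule_format, OF side_subset_surface[OF assms]]
    by simp
qed

lemma connectedin_side:
  assumes "e \<in> ends"
  shows "connectedin (surface Q W) (side e)"
proof -
  have "connectedin (polygons W) (black e ` {0..1})"
    by (rule connectedin_continuous_map_image[OF continuous_map_black[OF assms]])
       simp
  then show ?thesis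
    unfolding side_def
    by (rule connectedin_continuous_map_image[OF quotient_imp_continuous_map[OF quotient_map_surface]])
qed

section \<open>Connected components of the boundary\<close>

abbreviation boundary_topology :: "(('v, 'a) rvertex \<times> complex) set topology" where
  "boundary_topology \<equiv> subtopology (surface Q W) (surface_boundary Q W)"

lemma black_points_eq: "black_points Q W = (\<Union>e \<in> ends. black e ` {0..1})"
proof (intro equalityI subsetI)
  fix z assume "z \<in> black_points Q W"
  then obtain q i x where z: "z = perimeter Q q x" "q \<in> W" "i < valency Q q"
      "2 * real i + 1 \<le> x" "x \<le> 2 * real i + 2"
    by (auto simp: black_points_def)
  then have "z = black (q, i) (x - (2 * real i + 1))" by (simp add: black_def)
  moreover have "x - (2 * real i + 1) \<in> {0..1}" "(q, i) \<in> ends"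
    using z by (simp_all add: ends_def)
  ultimately show "z \<in> (\<Union>e \<in> ends. black e ` {0..1})" by blast
next
  fix z assume "z \<in> (\<Union>e \<in> ends. black e ` {0..1})"
  then obtain q i s where "(q, i) \<in> ends" "0 \<le> s" "s \<le> 1" "z = black (q, i) s" by auto
  then show "z \<in> black_points Q W"
    unfolding black_points_def
    by (intro CollectI exI[of _ q] exI[of _ i] exI[of _ "2 * real i + 1 + s"]) (auto simp: black_def ends_def)
qed

lemma surface_boundary_eq: "surface_boundary Q W = (\<Union>e \<in> ends. side e)"
  by (simp add: surface_boundary_def black_points_eq side_def image_UN)

lemma topspace_boundary: "topspace boundary_topology = (\<Union>e \<in> ends. side e)"
  using side_subset_surface by (auto simp: surface_boundary_eq)

lemma side_in_boundary:
  assumes "e \<in> ends"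
  shows "closedin boundary_topology (side e)" "connectedin boundary_topology (side e)"
  using closedin_side[OF assms] connectedin_side[OF assms] assms
  by (auto simp: surface_boundary_eq connectedin_subtopology intro!: closedin_subset_topspace)

text \<open>Neighbouring sides share a corner, so the union stays connected along a chain in
  \<open>side_rel\<close>; all these unions contain \<open>side e\<close> and can be joined.\<close>

lemma connectedin_side_class:
  assumes e: "e \<in> ends"
  shows "connectedin boundary_topology (\<Union>(side ` side_class e))"
proof -
  have T: "\<exists>T. connectedin boundary_topology T \<and> side e \<subseteq> T \<and> side e' \<subseteq> T \<and> T \<subseteq> \<Union>(side ` side_class e)"
    if "(e, e') \<in> side_rel" for e'
    using that[unfolded side_rel_def]
  proof (induction rule: rtrancl_induct)
    case base
    have "e \<in> side_class e" by (simp add: side_class_iff)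
    then have "side e \<subseteq> \<Union>(side ` side_class e)" by blast
    then show ?case using side_in_boundary[OF e] by blast
  next
    case (step y z)
    then obtain T where T: "connectedin boundary_topology T" "side e \<subseteq> T" "side y \<subseteq> T"
        "T \<subseteq> \<Union>(side ` side_class e)" by blast
    have yz: "y \<in> ends" "z \<in> ends" "next_side y = z \<or> next_side z = y" using step.hyps(2) by auto
    have "(e, z) \<in> side_rel"
      unfolding side_rel_def using step.hyps by (rule rtrancl_into_rtrancl)
    then have "side z \<subseteq> \<Union>(side ` side_class e)" by (auto simp: side_class_iff)
    moreover have "connectedin boundary_topology (T \<union> side z)"
      using T(1,3) side_in_boundary(2)[OF yz(2)] side_Int_iff[OF yz(1,2)] yz(3)
      by (intro connectedin_Un) auto
    ultimately show ?case using T by (intro exI[of _ "T \<union> side z"]) auto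
  qed
  then obtain T where T: "\<And>e'. e' \<in> side_class e \<Longrightarrow> connectedin boundary_topology (T e') \<and>
      side e \<subseteq> T e' \<and> side e' \<subseteq> T e' \<and> T e' \<subseteq> \<Union>(side ` side_class e)"
    unfolding side_class_iff by metis
  have "side e \<noteq> {}" by (simp add: side_def)
  moreover have "e \<in> side_class e" by (simp add: side_class_iff)
  ultimately have "connectedin boundary_topology (\<Union>(T ` side_class e))"
    using T by (intro connectedin_Union) blast+
  moreover have "\<Union>(T ` side_class e) = \<Union>(side ` side_class e)"
    using T by blast
  ultimately show ?thesis by simp
qed

lemma side_meet_class:
  assumes "e \<in> ends" "e' \<in> ends" "\<Union>(side ` side_class e) \<inter> \<Union>(side ` side_class e') \<noteq> {}"
  shows "side_class e = side_class e'"
proof -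
  obtain x y where xy: "x \<in> side_class e" "y \<in> side_class e'" "side x \<inter> side y \<noteq> {}"
    using assms(3) by blast
  then have "x \<in> ends" "y \<in> ends" using side_class_ends assms(1,2) by blast+
  then have "(x, y) \<in> side_rel"
    using xy(3) side_Int_iff[of x y] side_rel_next side_rel_sym side_rel_refl by metis
  then show ?thesis
    using xy(1,2) side_class_eq_iff side_class_iff by metis
qed

lemma boundary_components_eq:
  "boundary_components Q W = (\<lambda>c. \<Union>(side ` c)) ` side_class ` ends"
  unfolding boundary_components_def
proof (rule connected_components_of_finite_partition)
  let ?P = "(\<lambda>c. \<Union>(side ` c)) ` side_class ` ends"
  show "finite ?P" using finite_ends by simp
  have self: "e \<in> side_class e" for e by (simp add: side_class_iff)
  show "\<Union>?P = topspace boundary_topology"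
    unfolding topspace_boundary using side_class_ends self by blast
  show "disjoint ?P"
    unfolding pairwise_def disjnt_def
  proof (intro ballI impI)
    fix A B assume "A \<in> ?P" "B \<in> ?P" and ne: "A \<noteq> B"
    then obtain e e' where "e \<in> ends" "A = \<Union>(side ` side_class e)" "e' \<in> ends" "B = \<Union>(side ` side_class e')"
      by blast
    then show "A \<inter> B = {}" using side_meet_class[of e e'] ne by metis
  qed
  fix P assume "P \<in> ?P"
  then obtain e where e: "e \<in> ends" "P = \<Union>(side ` side_class e)" by blast
  have "closedin boundary_topology P"
    unfolding e(2)
    using side_class_ends[OF e(1)] finite_subset[OF side_class_ends[OF e(1)] finite_ends] side_in_boundary(1)
    by (intro closedin_Union) auto
  moreover have "side e \<subseteq> P" "side e \<noteq> {}"
    using e self[of e] by (auto simp: side_def)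
  ultimately show "closedin boundary_topology P \<and> connectedin boundary_topology P \<and> P \<noteq> {}"
    using connectedin_side_class[OF e(1)] e(2) by blast
qed

text \<open>\<open>1 / 2\<close> is the middle of a black side, away from both corners and hence
  glued to nothing.\<close>

definition mark :: "('v, 'a) rvertex \<times> nat \<Rightarrow> (('v, 'a) rvertex \<times> complex) set" where
  "mark e = glue_class (black e (1 / 2))"

lemma boundary_marked_points_eq: "boundary_marked_points Q W = mark ` marked_ends"
proof -
  have m: "marked_ends = last_end ` {p. Finite_Path p \<in> W}"
  proof (intro equalityI subsetI)
    fix e assume "e \<in> marked_ends"
    then obtain p where "e = last_end p" "last_end p \<in> ends"
      using out_arrow_None_iff[of e] by (auto simp: marked_ends_def)
    then show "e \<in> last_end ` {p. Finite_Path p \<in> W}" using last_end_in by blast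
  qed (auto simp: marked_ends_def last_end_in)
  \<comment> \<open>For valency \<open>n\<close>, the parameter \<open>2 n - 1/2\<close> equals
    \<open>2 (n - 1) + 1 + 1/2\<close>, and \<open>n - 1\<close> is the index of the last
    end.\<close>
  have "perimeter Q (Finite_Path p) (2 * real (valency Q (Finite_Path p)) - 1 / 2) = black (last_end p) (1 / 2)"
    for p
    by (simp add: black_def last_end_def algebra_simps)
  then have "boundary_marked_points Q W = {mark (last_end p) | p. Finite_Path p \<in> W}"
    unfolding mark_def boundary_marked_points_def by (simp only:)
  then show ?thesis unfolding m by blast
qed

lemma mark_in_side:
  assumes "e \<in> ends" "e' \<in> ends"
  shows "mark e \<in> side e' \<longleftrightarrow> e = e'"
proof
  assume "mark e \<in> side e'"
  then obtain s where s: "s \<in> {0..1}" "glue_class (black e (1 / 2)) = glue_class (black e' s)"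
    unfolding mark_def side_def by blast
  moreover have "(black e (1 / 2), black e' s) \<notin> gluing Q W"
    using black_gluing[OF assms(1), of "1 / 2" "black e' s"] by (intro notI) simp
  ultimately have "black e (1 / 2) = black e' s"
    unfolding glue_class_eq_iff glued_iff by blast
  then show "e = e'" using black_eq_iff[OF assms, of "1 / 2" s] s(1) by simp
qed (auto simp: mark_def side_def)

text \<open>A mark lies on the side of its own end and on no other, so counting marks on a component
  amounts to counting marked ends in the class.\<close>

lemma small_components_eqpoll:
  "components_with_at_most_one_mark Q W \<approx> {c \<in> side_class ` ends. card (c \<inter> marked_ends) \<le> 1}"
  (is "_ \<approx> ?S")
proof (rule eqpoll_sym, unfold eqpoll_def, intro exI)
  let ?u = "\<lambda>c. \<Union>(side ` c)"
  have M: "marked_ends \<subseteq> ends" by (auto simp: marked_ends_def)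
  have inj_mark: "inj_on mark ends"
  proof (rule inj_onI)
    fix e e' assume "e \<in> ends" "e' \<in> ends" "mark e = mark e'"
    then show "e = e'" using mark_in_side[of e e'] mark_in_side[of e' e'] by simp
  qed
  have marks: "?u c \<inter> boundary_marked_points Q W = mark ` (c \<inter> marked_ends)" if "c \<subseteq> ends" for c
    unfolding boundary_marked_points_eq
  proof (intro equalityI subsetI)
    fix y assume "y \<in> ?u c \<inter> mark ` marked_ends"
    then obtain e e' where "e \<in> c" "e' \<in> marked_ends" "y = mark e'" "mark e' \<in> side e" by blast
    then show "y \<in> mark ` (c \<inter> marked_ends)"
      using mark_in_side[of e' e] M that by auto
  next
    fix y assume "y \<in> mark ` (c \<inter> marked_ends)"
    then obtain e where "e \<in> c" "e \<in> marked_ends" "y = mark e" by blast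
    then show "y \<in> ?u c \<inter> mark ` marked_ends"
      using mark_in_side[of e e] M by auto
  qed
  have card: "card (?u c \<inter> boundary_marked_points Q W) = card (c \<inter> marked_ends)"
    "finite (?u c \<inter> boundary_marked_points Q W)" if "c \<subseteq> ends" for c
    unfolding marks[OF that]
    using finite_subset[OF that finite_ends] inj_on_subset[OF inj_mark, of "c \<inter> marked_ends"] that
    by (auto intro!: card_image)
  show "bij_betw ?u ?S (components_with_at_most_one_mark Q W)"
  proof (rule bij_betw_imageI)
    show "inj_on ?u ?S"
    proof (rule inj_onI)
      fix c c' assume *: "c \<in> ?S" "c' \<in> ?S" "?u c = ?u c'"
      then obtain e e' where e: "e \<in> ends" "e' \<in> ends" "c = side_class e" "c' = side_class e'" by blast
      have "e \<in> c" "side e \<noteq> {}" using e(3) by (auto simp: side_class_iff side_def)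
      then have "?u c \<inter> ?u c' \<noteq> {}" using *(3) by auto
      then show "c = c'" using side_meet_class[OF e(1,2)] e(3,4) by simp
    qed
    have "c \<subseteq> ends" if "c \<in> side_class ` ends" for c using that side_class_ends by blast
    then show "?u ` ?S = components_with_at_most_one_mark Q W"
      unfolding components_with_at_most_one_mark_def boundary_components_eq using card by auto
  qed
qed

text \<open>The centre of a polygon is off the perimeter, so it is glued to nothing and different
  circuits give different punctures.\<close>

lemma G_punctures_eqpoll: "G_punctures Q W \<approx> CC"
proof (rule eqpoll_sym, unfold eqpoll_def, intro exI)
  let ?f = "\<lambda>C. glue_class (Infinite_Path C, 0)"
  have "(Infinite_Path C, 0) \<noteq> red e t" for C e t
    by (auto simp: red_def perimeter_def)
  then have "((Infinite_Path C, 0), w) \<notin> gluing Q W" for C w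
    by (auto simp: gluing_iff)
  then have "inj_on ?f CC"
    by (intro inj_onI) (simp add: glue_class_eq_iff glued_iff)
  moreover have "?f ` CC = G_punctures Q W"
    by (auto simp: G_punctures_def Infinite_in_W)
  ultimately show "bij_betw ?f CC (G_punctures Q W)" by (rule bij_betw_imageI)
qed

end

section \<open>The generating classes\<close>

definition unaligned_pairs :: "(('v, 'a) qpath \<times> ('v, 'a) qpath) set" where
  "unaligned_pairs = {(g, x). \<not> begin_alike g x \<and> \<not> end_alike g x}"

lemma lookup_differential:
  assumes "p \<in> unaligned_pairs"
  shows "Poly_Mapping.lookup (differential Q I f) p = 0"
proof -
  have "(pcomp (arrow Q b) g, pcomp (arrow Q b) x) \<noteq> p" for b g x
    using assms by (auto simp: unaligned_pairs_def pcomp_def arrow_def end_alike_def)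
  moreover have "(pcomp g (arrow Q a), pcomp x (arrow Q a)) \<noteq> p" for a g x
    using assms by (auto simp: unaligned_pairs_def pcomp_def arrow_def begin_alike_def)
  ultimately show ?thesis
    unfolding differential_def
    by (simp add: lookup_sum lookup_minus case_prod_beta lookup_single)
qed

text \<open>The zero cochain shows that a representative lies in its class; equal classes can then
  be compared without linearity of the differential.\<close>

lemma cohomology_class_self: "f \<in> cohomology_class Q I f"
proof -
  have "differential Q I 0 = 0" by (simp add: differential_def)
  moreover have "0 \<in> cochains Q I" by (simp add: cochains_def)
  ultimately show ?thesis
    unfolding cohomology_class_def by (intro CollectI exI[of _ 0]) simp
qed

lemma lookup_cohomology_class:
  assumes "cohomology_class Q I f = cohomology_class Q I f'" "p \<in> unaligned_pairs"
  shows "Poly_Mapping.lookup f p = Poly_Mapping.lookup f' p"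
proof -
  have "f \<in> cohomology_class Q I f'" using cohomology_class_self assms(1) by metis
  then obtain h where "f = f' + differential Q I h" by (auto simp: cohomology_class_def)
  then show ?thesis by (simp add: lookup_add lookup_differential[OF assms(2)])
qed

text \<open>When both supports consist of unaligned pairs, the coefficients fixed by the class
  determine the whole cochain.\<close>

lemma cohomology_class_inj:
  assumes "cohomology_class Q I f = cohomology_class Q I f'"
    "Poly_Mapping.keys f \<subseteq> unaligned_pairs" "Poly_Mapping.keys f' \<subseteq> unaligned_pairs"
  shows "f = f'"
proof (rule poly_mapping_eqI)
  fix p
  show "Poly_Mapping.lookup f p = Poly_Mapping.lookup f' p"
  proof (cases "p \<in> unaligned_pairs")
    case False
    then have "p \<notin> Poly_Mapping.keys f" "p \<notin> Poly_Mapping.keys f'" using assms(2,3) by blast+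
    then show ?thesis by (simp add: in_keys_iff)
  qed (rule lookup_cohomology_class[OF assms(1)])
qed

lemma lookup_basis: "Poly_Mapping.lookup (basis p) q = (if p = q then 1 else 0)"
  by (simp add: basis_def lookup_single when_def)

lemma keys_basis [simp]: "Poly_Mapping.keys (basis p :: _ \<Rightarrow>\<^sub>0 'k::field) = {p}"
  by (simp add: basis_def)

lemma basis_eq_iff [simp]: "(basis p :: _ \<Rightarrow>\<^sub>0 'k::field) = basis q \<longleftrightarrow> p = q"
  by (metis keys_basis singleton_inject)

text \<open>Ensures that the \<open>LEAST\<close> in \<open>period\<close> ranges over a nonempty
  set.\<close>

lemma period_exists:
  assumes "snd C \<noteq> []" "fst C = tail Q (hd (snd C))"
  shows "(rot Q ^^ length (snd C)) C = C"
  using funpow_rot[OF assms, of "length (snd C)"] funpow_rotl_append[of "snd C" "[]"] assms(2)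
  unfolding prod.collapse by (simp add: prod_eq_iff)

text \<open>Within one period only the zeroth rotation gives back \<open>C\<close>, so the
  coefficient is a single 1 in every characteristic.\<close>

lemma lookup_orbit_sum:
  fixes F :: "('v, 'a) qpath \<Rightarrow> 'p"
  assumes "inj F" "snd C \<noteq> []" "fst C = tail Q (hd (snd C))"
  shows "Poly_Mapping.lookup (\<Sum>i < period Q C. basis (F ((rot Q ^^ i) C)) :: 'p \<Rightarrow>\<^sub>0 'k::field) (F C) = 1"
proof -
  let ?P = "\<lambda>i. i \<ge> 1 \<and> (rot Q ^^ i) C = C"
  have "?P (length (snd C))" using period_exists[OF assms(2,3)] assms(2) by (simp add: Suc_le_eq)
  then have "?P (period Q C)" unfolding period_def by (rule LeastI)
  then have pos: "0 \<in> {..<period Q C}" by simp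
  have "(rot Q ^^ i) C \<noteq> C" if "i < period Q C" "i \<noteq> 0" for i
    using not_less_Least[of i ?P] that unfolding period_def by auto
  then have "(\<Sum>i < period Q C. Poly_Mapping.lookup (basis (F ((rot Q ^^ i) C)) :: 'p \<Rightarrow>\<^sub>0 'k) (F C)) =
     (\<Sum>i < period Q C. if i = 0 then 1 else 0)"
    by (intro sum.cong) (auto simp: lookup_basis inj_eq[OF assms(1)])
  also have "\<dots> = 1" using pos by (simp add: sum.delta)
  finally show ?thesis by (simp add: lookup_sum)
qed

lemma lookup_orbit_sumD:
  fixes F :: "('v, 'a) qpath \<Rightarrow> 'p"
  assumes "Poly_Mapping.lookup (\<Sum>i < period Q C. basis (F ((rot Q ^^ i) C)) :: 'p \<Rightarrow>\<^sub>0 'k::field) p \<noteq> 0"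
  obtains i where "p = F ((rot Q ^^ i) C)"
proof -
  have "\<exists>i \<in> {..<period Q C}. Poly_Mapping.lookup (basis (F ((rot Q ^^ i) C)) :: 'p \<Rightarrow>\<^sub>0 'k) p \<noteq> 0"
    using assms sum.not_neutral_contains_not_neutral unfolding lookup_sum by blast
  then show thesis using that by (auto simp: lookup_basis split: if_splits)
qed

lemma inj_triv_pairs:
  "inj (\<lambda>C. (triv (psource C), C))" "inj (\<lambda>C. (C, triv (psource C)))"
  by (auto simp: inj_def)

lemma set_snd_funpow_rot: "snd C \<noteq> [] \<Longrightarrow> set (snd ((rot Q ^^ i) C)) = set (snd C)"
  by (simp add: snd_funpow_rot)

section \<open>Counting the generators outside \<open>F\<close>\<close>

context gentle_surface
begin

text \<open>One function for the case distinction of \<open>basic_Gamma\<close>: squares are indexed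
  by their roots, so that \<open>DD\<close> counts the generators.\<close>

definition complete_cycle :: "('v, 'a) qpath \<Rightarrow> ('v, 'a) qpath" where
  "complete_cycle D = (if CHAR('k) = 2 \<or> even (plength D) then D else ppower D 2)"

lemma basic_Gamma_eq: "basic_Gamma TYPE('k) DD = complete_cycle ` DD"
  by (auto simp: basic_Gamma_def complete_cycle_def)

text \<open>The last conclusion says that the cycle can be continued by a relation, which separates
  it from the maximal paths of \<open>Gamma_set\<close>.\<close>

lemma complete_cycle:
  assumes "D \<in> DD"
  shows "snd (complete_cycle D) \<noteq> []"
    "fst (complete_cycle D) = tail Q (hd (snd (complete_cycle D)))"
    "set (snd (complete_cycle D)) = set (snd D)"
    "nG (last (snd (complete_cycle D))) (hd (snd D))"
  using \<Gamma>.representative_cyclic[OF DD' assms]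
  by (auto simp: complete_cycle_def \<Gamma>.cyclic_chain_def ppower_def numeral_2_eq_2)

lemma CC_cyclic:
  assumes "x \<in> CC"
  shows "snd x \<noteq> []" "fst x = tail Q (hd (snd x))" "nB (last (snd x)) (hd (snd x))"
  using B.representative_cyclic[OF CC' assms] by (auto simp: B.cyclic_chain_def)

abbreviation cycle_basis :: "('v, 'a) qpath \<Rightarrow> (('v, 'a) qpath \<times> ('v, 'a) qpath \<Rightarrow>\<^sub>0 'k)" where
  "cycle_basis x \<equiv> basis (triv (psource x), x)"

lemma lookup_cocomplete:
  assumes "x \<in> CC"
  shows "Poly_Mapping.lookup (cocomplete_cochain Q x :: _ \<Rightarrow>\<^sub>0 'k) (triv (psource x), x) = 1"
  unfolding cocomplete_cochain_def
  using lookup_orbit_sum[OF inj_triv_pairs(1) CC_cyclic(1,2)[OF assms]] by simp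

lemma lookup_cocompleteD:
  assumes "Poly_Mapping.lookup (cocomplete_cochain Q x :: _ \<Rightarrow>\<^sub>0 'k) p \<noteq> 0"
  obtains i where "p = (triv (psource ((rot Q ^^ i) x)), (rot Q ^^ i) x)"
  by (rule lookup_orbit_sumD[where F = "\<lambda>C. (triv (psource C), C)" and C = x and p = p])
     (use assms that in \<open>simp_all add: cocomplete_cochain_def\<close>)

lemma lookup_complete:
  assumes "D \<in> DD"
  shows "Poly_Mapping.lookup (complete_cochain Q (complete_cycle D) :: _ \<Rightarrow>\<^sub>0 'k)
     (complete_cycle D, triv (psource (complete_cycle D))) = 1"
  unfolding complete_cochain_def
  using lookup_orbit_sum[OF inj_triv_pairs(2) complete_cycle(1,2)[OF assms]] by simp

lemma lookup_completeD:
  assumes "Poly_Mapping.lookup (complete_cochain Q C :: _ \<Rightarrow>\<^sub>0 'k) p \<noteq> 0"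
  obtains i where "p = ((rot Q ^^ i) C, triv (psource ((rot Q ^^ i) C)))"
  by (rule lookup_orbit_sumD[where F = "\<lambda>C. (C, triv (psource C))" and C = C and p = p])
     (use assms that in \<open>simp_all add: complete_cochain_def\<close>)

text \<open>Rotations keep the set of arrows, and representatives with a common arrow are
  equal.\<close>

lemma inj_on_cocomplete_cochain: "inj_on (cocomplete_cochain Q :: _ \<Rightarrow> _ \<Rightarrow>\<^sub>0 'k) CC"
proof (rule inj_onI)
  fix x y assume *: "x \<in> CC" "y \<in> CC" "(cocomplete_cochain Q x :: _ \<Rightarrow>\<^sub>0 'k) = cocomplete_cochain Q y"
  have "Poly_Mapping.lookup (cocomplete_cochain Q y :: _ \<Rightarrow>\<^sub>0 'k) (triv (psource x), x) \<noteq> 0"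
    using lookup_cocomplete[OF *(1)] *(3) by simp
  then obtain i where "x = (rot Q ^^ i) y" by (rule lookup_cocompleteD) simp
  then have "set (snd x) = set (snd y)"
    using set_snd_funpow_rot CC_cyclic(1)[OF *(2)] by simp
  then show "x = y"
    using B.representative_eqI[OF CC' *(1,2), of "hd (snd x)"] hd_in_set[OF CC_cyclic(1)[OF *(1)]] by simp
qed

lemma inj_on_complete_cochain:
  "inj_on (\<lambda>D. complete_cochain Q (complete_cycle D) :: _ \<Rightarrow>\<^sub>0 'k) DD"
proof (rule inj_onI)
  fix x y assume *: "x \<in> DD" "y \<in> DD"
    "(complete_cochain Q (complete_cycle x) :: _ \<Rightarrow>\<^sub>0 'k) = complete_cochain Q (complete_cycle y)"
  have "Poly_Mapping.lookup (complete_cochain Q (complete_cycle y) :: _ \<Rightarrow>\<^sub>0 'k)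
      (complete_cycle x, triv (psource (complete_cycle x))) \<noteq> 0"
    using lookup_complete[OF *(1)] *(3) by simp
  then obtain i where "complete_cycle x = (rot Q ^^ i) (complete_cycle y)" by (rule lookup_completeD) simp
  then have "set (snd x) = set (snd y)"
    using set_snd_funpow_rot[OF complete_cycle(1)[OF *(2)], of i Q] complete_cycle(3)[OF *(1)]
      complete_cycle(3)[OF *(2)] by simp
  moreover have "hd (snd x) \<in> set (snd x)"
    using complete_cycle(1,3)[OF *(1)] by (cases "snd x") simp_all
  ultimately show "x = y"
    using \<Gamma>.representative_eqI[OF DD' *(1,2), of "hd (snd x)"] by simp
qed

lemma inj_on_cycle_basis: "inj_on cycle_basis maximal_cycles"
  by (auto simp: inj_on_def)

lemma inj_on_pair_basis: "inj_on (basis :: _ \<Rightarrow> _ \<Rightarrow>\<^sub>0 'k) maximal_pairs"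
  by (auto simp: inj_on_def)

lemma maximal_pair_nontrivial:
  assumes "(g, x) \<in> maximal_pairs"
  shows "snd g \<noteq> []" "\<not> nG (last (snd g)) b"
  using assms by (auto simp: maximal_pairs_def maximal_in_Gamma_iff \<Gamma>.maximal_chain_def)

definition boundary_cochains :: "(('v, 'a) qpath \<times> ('v, 'a) qpath \<Rightarrow>\<^sub>0 'k) set" where
  "boundary_cochains = (cycle_basis ` maximal_cycles \<union> basis ` maximal_pairs) \<union>
     (\<lambda>D. complete_cochain Q (complete_cycle D)) ` DD \<union> cocomplete_cochain Q ` CC"

text \<open>Two families are told apart at one pair of the support: either its first path is trivial
  in one family and not in the other, or a maximal path would coincide with a cycle that can be
  continued.\<close>

lemma boundary_cochains_eqpoll:
  "boundary_cochains \<approx> ((maximal_cycles <+> maximal_pairs) <+> DD) <+> CC"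
proof -
  let ?A = "cycle_basis ` maximal_cycles" and ?B = "(basis :: _ \<Rightarrow> _ \<Rightarrow>\<^sub>0 'k) ` maximal_pairs"
    and ?C = "(\<lambda>D. complete_cochain Q (complete_cycle D) :: _ \<Rightarrow>\<^sub>0 'k) ` DD"
    and ?D = "(cocomplete_cochain Q :: _ \<Rightarrow> _ \<Rightarrow>\<^sub>0 'k) ` CC"
  have AB: "?A \<inter> ?B = {}"
    using maximal_pair_nontrivial(1) by (force simp: triv_def)
  have ABC: "(?A \<union> ?B) \<inter> ?C = {}"
  proof (rule equals0I)
    fix f assume f: "f \<in> (?A \<union> ?B) \<inter> ?C"
    then obtain D where D: "D \<in> DD" "f = complete_cochain Q (complete_cycle D)" by blast
    let ?p = "(complete_cycle D, triv (psource (complete_cycle D)))"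
    have one: "Poly_Mapping.lookup f ?p = 1" using lookup_complete[OF D(1)] D(2) by simp
    from f consider x where "f = cycle_basis x" | gx where "gx \<in> maximal_pairs" "f = basis gx" by blast
    then show False
    proof cases
      case 1
      then have "?p = (triv (psource x), x)"
        using one by (auto simp: lookup_basis split: if_splits)
      then show False using complete_cycle(1)[OF D(1)] by (simp add: triv_def prod_eq_iff)
    next
      case 2
      then have "gx = ?p" using one by (auto simp: lookup_basis split: if_splits)
      then have "\<not> nG (last (snd (complete_cycle D))) (hd (snd D))"
        using 2(1) maximal_pair_nontrivial(2)[of "complete_cycle D"] by simp
      then show False using complete_cycle(4)[OF D(1)] by simp
    qed
  qed
  have ABCD: "(?A \<union> ?B \<union> ?C) \<inter> ?D = {}"
  proof (rule equals0I)
    fix f assume f: "f \<in> (?A \<union> ?B \<union> ?C) \<inter> ?D"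
    then obtain y where y: "y \<in> CC" "f = cocomplete_cochain Q y" by blast
    let ?p = "(triv (psource y), y)"
    have one: "Poly_Mapping.lookup f ?p = 1" using lookup_cocomplete[OF y(1)] y(2) by simp
    from f consider x where "x \<in> maximal_cycles" "f = cycle_basis x"
      | gx where "gx \<in> maximal_pairs" "f = basis gx"
      | D where "D \<in> DD" "f = complete_cochain Q (complete_cycle D)" by blast
    then show False
    proof cases
      case 1
      then have "?p = (triv (psource x), x)"
        using one by (auto simp: lookup_basis split: if_splits)
      then have "\<not> nB (last (snd y)) (hd (snd y))"
        using 1(1) by (auto simp: maximal_cycles_def maximal_in_B_iff B.maximal_chain_def)
      then show False using CC_cyclic(3)[OF y(1)] by simp
    next
      case 2
      then have "gx = ?p" using one by (auto simp: lookup_basis split: if_splits)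
      then show False using 2(1) maximal_pair_nontrivial(1)[of "triv (psource y)"] by (simp add: triv_def)
    next
      case 3
      then have "Poly_Mapping.lookup (complete_cochain Q (complete_cycle D) :: _ \<Rightarrow>\<^sub>0 'k) ?p \<noteq> 0"
        using one by simp
      then obtain i where "triv (psource y) = (rot Q ^^ i) (complete_cycle D)"
        by (rule lookup_completeD) blast
      then have "set (snd (complete_cycle D)) = set (snd (triv (psource y)))"
        using set_snd_funpow_rot[OF complete_cycle(1)[OF 3(1)], of i Q] by simp
      then show False using complete_cycle(1)[OF 3(1)] by (simp add: triv_def)
    qed
  qed
  have "boundary_cochains \<approx> (?A \<union> ?B \<union> ?C) <+> ?D"
    unfolding boundary_cochains_def by (rule disjoint_Un_eqpoll_Plus[OF ABCD])
  also have "\<dots> \<approx> ((?A \<union> ?B) <+> ?C) <+> ?D"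
    by (intro sum_eqpoll_cong disjoint_Un_eqpoll_Plus[OF ABC] eqpoll_refl)
  also have "\<dots> \<approx> ((?A <+> ?B) <+> ?C) <+> ?D"
    by (intro sum_eqpoll_cong disjoint_Un_eqpoll_Plus[OF AB] eqpoll_refl)
  also have "\<dots> \<approx> ((maximal_cycles <+> maximal_pairs) <+> DD) <+> CC"
    by (intro sum_eqpoll_cong inj_on_image_eqpoll_self inj_on_cycle_basis inj_on_pair_basis
        inj_on_complete_cochain inj_on_cocomplete_cochain)
  finally show ?thesis .
qed

text \<open>Being nonzero yields a pair in the support, at which a cochain with all its pairs
  aligned has coefficient zero.\<close>

lemma keys_boundary_cochains:
  assumes "f \<in> boundary_cochains"
  shows "Poly_Mapping.keys f \<subseteq> unaligned_pairs" "f \<noteq> 0"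
proof -
  consider x where "f = cycle_basis x" | gx where "gx \<in> maximal_pairs" "f = basis gx"
    | D where "D \<in> DD" "f = complete_cochain Q (complete_cycle D)"
    | x where "x \<in> CC" "f = cocomplete_cochain Q x"
    using assms unfolding boundary_cochains_def by blast
  then have "Poly_Mapping.keys f \<subseteq> unaligned_pairs \<and> f \<noteq> 0"
  proof cases
    case 1
    then have "Poly_Mapping.keys f = {(triv (psource x), x)}" by simp
    then show ?thesis
      by (auto simp: unaligned_pairs_def begin_alike_def end_alike_def triv_def)
  next
    case 2
    then have "Poly_Mapping.keys f = {gx}" by simp
    then show ?thesis using 2(1) by (auto simp: unaligned_pairs_def maximal_pairs_def)
  next
    case 3
    have "p \<in> unaligned_pairs" if "p \<in> Poly_Mapping.keys f" for p
    proof -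
      have "Poly_Mapping.lookup (complete_cochain Q (complete_cycle D) :: _ \<Rightarrow>\<^sub>0 'k) p \<noteq> 0"
        using that 3(2) by (simp add: in_keys_iff)
      then obtain C where "p = (C, triv (psource C))" by (rule lookup_completeD) blast
      then show ?thesis by (simp add: unaligned_pairs_def begin_alike_def end_alike_def triv_def)
    qed
    moreover have "f \<noteq> 0" using lookup_complete[OF 3(1)] 3(2) by force
    ultimately show ?thesis by blast
  next
    case 4
    have "p \<in> unaligned_pairs" if "p \<in> Poly_Mapping.keys f" for p
    proof -
      have "Poly_Mapping.lookup (cocomplete_cochain Q x :: _ \<Rightarrow>\<^sub>0 'k) p \<noteq> 0"
        using that 4(2) by (simp add: in_keys_iff)
      then obtain C where "p = (triv (psource C), C)" by (rule lookup_cocompleteD) blast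
      then show ?thesis by (simp add: unaligned_pairs_def begin_alike_def end_alike_def triv_def)
    qed
    moreover have "f \<noteq> 0" using lookup_cocomplete[OF 4(1)] 4(2) by force
    ultimately show ?thesis by blast
  qed
  then show "Poly_Mapping.keys f \<subseteq> unaligned_pairs" "f \<noteq> 0" by auto
qed

text \<open>Removing F removes classes, so another generator in the class of some
  \<open>(c, c)\<close> would be lost. This cannot happen: it has a nonzero coefficient at an
  unaligned pair, and \<open>(c, c)\<close> is aligned.\<close>

lemma generating_classes_diff:
  "generating_classes Q I T CC DD - fundamental_classes Q I T = cohomology_class Q I ` boundary_cochains"
proof -
  have "generating_classes Q I T CC DD =
      cohomology_class Q I ` boundary_cochains \<union> fundamental_classes Q I T"
  proof -
    have eq1: "{basis (triv (psource x), x) | x. is_cycle Q x \<and> maximal_in Q (Bset Q I) x} = cycle_basis ` maximal_cycles"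
      by (auto simp: maximal_cycles_def)
    have eq2: "{basis (g, x) | g x. (g, x) \<in> parallel_pairs Q I \<and> maximal_in Q (Gamma_set Q I) g \<and>
          \<not> begin_alike g x \<and> \<not> end_alike g x} = basis ` maximal_pairs"
      by (auto simp: maximal_pairs_def)
    show ?thesis
      unfolding generating_classes_def eq1 eq2 basic_Gamma_eq boundary_cochains_def image_image image_Un
      by (simp only: Un_ac)
  qed
  moreover have "cohomology_class Q I f \<notin> fundamental_classes Q I T" if f: "f \<in> boundary_cochains" for f
  proof
    assume "cohomology_class Q I f \<in> fundamental_classes Q I T"
    then obtain c where c: "cohomology_class Q I f = cohomology_class Q I (basis (arrow Q c, arrow Q c))"
      by (auto simp: fundamental_classes_def)
    obtain p where p: "p \<in> Poly_Mapping.keys f"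
      using keys_boundary_cochains(2)[OF f] by (metis ex_in_conv keys_eq_empty)
    then have "p \<in> unaligned_pairs" using keys_boundary_cochains(1)[OF f] by blast
    moreover from this have "p \<noteq> (arrow Q c, arrow Q c)"
      by (auto simp: unaligned_pairs_def begin_alike_def arrow_def)
    ultimately have "Poly_Mapping.lookup f p = 0"
      using lookup_cohomology_class[OF c, of p] by (simp add: lookup_basis)
    then show False using p by (simp add: in_keys_iff)
  qed
  ultimately show ?thesis by blast
qed

lemma generators_eqpoll_boundary:
  "generating_classes Q I T CC DD - fundamental_classes Q I T \<approx>
     components_with_at_most_one_mark Q W <+> G_punctures Q W"
proof -
  have "inj_on (cohomology_class Q I) boundary_cochains"
    by (rule inj_onI) (rule cohomology_class_inj[OF _ keys_boundary_cochains(1) keys_boundary_cochains(1)])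
  then have "generating_classes Q I T CC DD - fundamental_classes Q I T \<approx> boundary_cochains"
    unfolding generating_classes_diff by (rule inj_on_image_eqpoll_self)
  also note boundary_cochains_eqpoll
  also have "((maximal_cycles <+> maximal_pairs) <+> DD) <+> CC \<approx>
      components_with_at_most_one_mark Q W <+> G_punctures Q W"
    by (intro sum_eqpoll_cong eqpoll_sym[OF G_punctures_eqpoll]
        eqpoll_sym[OF eqpoll_trans[OF small_components_eqpoll classes_with_at_most_one_mark]])
  finally show ?thesis .
qed

end

theorem theorem7p1:
  fixes Q :: "('v, 'a) pre_digraph"
    and I :: "(('v, 'a) qpath \<Rightarrow>\<^sub>0 'k::field) set"
    and T :: "'a set"
    and CC DD :: "('v, 'a) qpath set"
  assumes "fin_digraph Q"
    and "Digraph_Component.connected Q"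
    and "arcs Q \<noteq> {}"
    and "gentle_presentation Q I"
    and "spanning_tree_arcs Q T"
    and "circuit_representatives Q (prim_cocomplete_cycles Q I) CC"
    and "circuit_representatives Q (prim_complete_cycles Q I) DD"
  shows "\<exists>f. bij_betw f
           (generating_classes Q I T CC DD - fundamental_classes Q I T)
           (components_with_at_most_one_mark Q (rvertices Q I CC)
              <+> G_punctures Q (rvertices Q I CC))"
proof -
  interpret gentle_surface Q I CC DD
    using assms by (simp add: gentle_surface_def gentle_surface_axioms_def)
  show ?thesis
    using generators_eqpoll_boundary unfolding eqpoll_def .
qed

end
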